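(* Let $Z$ be a real valued symmetric Lévy process with characteristic exponent $\psi$, i.e. $E(e^{i\lambda Z_t})=e^{-t\psi(\lambda)}$ for all $t\ge 0$, where $\psi$ is an even function with $\frac{1}{1+\psi(\lambda)}\in L^1(\mathbb R^1)$, and assume that $0$ is recurrent for $Z$. Let $$(\sigma^0)^2(x)=\frac{2}{\pi}\int_0^\infty\frac{1-\cos\lambda x}{\psi(\lambda)}\,d\lambda,\qquad \Phi(x,y)=\frac{(\sigma^0)^2(x)}{2}+\frac{(\sigma^0)^2(y)}{2}-\frac{(\sigma^0)^2(x-y)}{2},\qquad x,y\in\mathbb R^1 .$$ Let $\mu$ be a finite positive measure on $T=\mathbb R^1-\{0\}$ with total mass $|\mu|=\mu(T)$, and let $$f_{\Phi,\mu}(y)=\int_T\Phi(x,y)\,d\mu(x),\qquad v(x,y)=\Phi(x,y)+f_{\Phi,\mu}(y).$$ Let $\alpha>0$ and let $\{X_\alpha(x),\ x\in[0,1]\}$ be an $\alpha$-permanental process with kernel $\{v(x,y),\ x,y\in[0,1]\}$. Assume that $\sigma^0\in C^1(0,\infty)$ and that $\sigma^0$ is a regularly varying function at zero with positive index. Then $X_\alpha(t)$ is continuous on $[0,\delta]$ for some $\delta>0$. Furthermore: (i) when $\displaystyle\lim_{t\downarrow 0}\frac{t}{(\sigma^0)^2(t)}=0$, $$\limsup_{t\downarrow 0}\frac{X_\alpha(t)}{(\sigma^0)^2(t)\log\log 1/t}\le 1+\frac{|\mu|}{2}\qquad\text{a.s.};$$ (ii) when $\displaystyle\lim_{t\downarrow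 0}\frac{t}{(\sigma^0)^2(t)}=\frac1C$ for some $C>0$, $$\limsup_{t\downarrow 0}\frac{X_\alpha(t)}{C\,t\log\log 1/t}\le \left(1+\frac{|\mu|}{2}\right)+\frac{1}{2C}\int_{-\infty}^{\infty}\left((\sigma^0)^2\right)'(v)\,d\mu(v)\qquad\text{a.s.}$$
   Context: For $\alpha>0$, an $\alpha$-permanental process with kernel $K=\{K(s,t),\ s,t\in[0,1]\}$ is a stochastic process $\{X_\alpha(t),\ t\in[0,1]\}$ with nonnegative values such that for all $n$, all $t_1,\dots,t_n\in[0,1]$ and all $s_1,\dots,s_n>0$, $$E\left(e^{-\sum_{i=1}^n s_iX_\alpha(t_i)}\right)=\frac{1}{\det\left(I+\mathcal K\,\Sigma\right)^{\alpha}},$$ where $\mathcal K=\{K(t_i,t_j)\}_{i,j=1}^n$ and $\Sigma$ is the diagonal matrix with entries $s_1,\dots,s_n$. Sample path statements are, as usual, understood for a suitable (separable, respectively continuous) version of the process. $\Phi$, restricted to $T\times T$, is the continuous potential density, with respect to Lebesgue measure on $T$, of the process obtained by killing $Z$ the first time it hits $0$. It is known that an $\alpha$-permanental process with kernel $v$ on $[0,1]$ exists for every $\alpha>0$. The function $(\sigma^0)^2$ is even; $\left((\sigma^0)^2\right)'(v)$ denotes its derivative at $v\neq 0$, and $\mu$ gives no mass to $0$. *)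

theory Defs
  imports "HOL-Probability.Probability" "Jordan_Normal_Form.Determinant"
begin

definition cadlag_path :: "(real \<Rightarrow> real) \<Rightarrow> bool" where
  "cadlag_path f \<longleftrightarrow>
     (\<forall>t\<ge>0. continuous (at_right t) f) \<and> (\<forall>t>0. \<exists>l. (f \<longlongrightarrow> l) (at_left t))"

text \<open>Real valued Levy processes started at 0. The time parameter ranges over the
  nonnegative reals; values at negative times are irrelevant.\<close>

definition levy_process :: "'b measure \<Rightarrow> (real \<Rightarrow> 'b \<Rightarrow> real) \<Rightarrow> bool" where
  "levy_process N Z \<longleftrightarrow>
     prob_space N \<and>
     (\<forall>t\<ge>0. Z t \<in> borel_measurable N) \<and>
     (AE \<omega> in N. Z 0 \<omega> = 0) \<and>
     (\<forall>(n::nat) \<tau>. mono \<tau> \<and> 0 \<le> \<tau> 0 \<longrightarrow>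
        prob_space.indep_vars N (\<lambda>_. borel) (\<lambda>i \<omega>. Z (\<tau> (Suc i)) \<omega> - Z (\<tau> i) \<omega>) {..<n}) \<and>
     (\<forall>s\<ge>0. \<forall>t\<ge>0. distr N borel (\<lambda>\<omega>. Z (s + t) \<omega> - Z s \<omega>) = distr N borel (Z t)) \<and>
     (AE \<omega> in N. cadlag_path (\<lambda>t. Z t \<omega>))"

definition symmetric_levy_process :: "'b measure \<Rightarrow> (real \<Rightarrow> 'b \<Rightarrow> real) \<Rightarrow> bool" where
  "symmetric_levy_process N Z \<longleftrightarrow>
     levy_process N Z \<and>
     (\<forall>t\<ge>0. distr N borel (\<lambda>\<omega>. - Z t \<omega>) = distr N borel (Z t))"

text \<open>The exponent of a symmetric process is real valued.\<close>

definition has_char_exponent ::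
  "'b measure \<Rightarrow> (real \<Rightarrow> 'b \<Rightarrow> real) \<Rightarrow> (real \<Rightarrow> real) \<Rightarrow> bool" where
  "has_char_exponent N Z \<psi> \<longleftrightarrow>
     (\<forall>t\<ge>0. \<forall>l. char (distr N borel (Z t)) l = complex_of_real (exp (- t * \<psi> l)))"

text \<open>The point 0 is recurrent: almost surely the process started at 0 visits 0 at
  arbitrarily large times.\<close>

definition zero_recurrent :: "'b measure \<Rightarrow> (real \<Rightarrow> 'b \<Rightarrow> real) \<Rightarrow> bool" where
  "zero_recurrent N Z \<longleftrightarrow> (AE \<omega> in N. \<forall>s\<ge>0. \<exists>t>s. Z t \<omega> = 0)"

definition sigma0_sq :: "(real \<Rightarrow> real) \<Rightarrow> real \<Rightarrow> real" where
  "sigma0_sq \<psi> x = 2 / pi * (LBINT l:{0<..}. (1 - cos (l * x)) / \<psi> l)"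

definition sigma0 :: "(real \<Rightarrow> real) \<Rightarrow> real \<Rightarrow> real" where
  "sigma0 \<psi> x = sqrt (sigma0_sq \<psi> x)"

definition Phi :: "(real \<Rightarrow> real) \<Rightarrow> real \<Rightarrow> real \<Rightarrow> real" where
  "Phi \<psi> x y = sigma0_sq \<psi> x / 2 + sigma0_sq \<psi> y / 2 - sigma0_sq \<psi> (x - y) / 2"

text \<open>Throughout, \<open>\<mu>\<close> has the punctured line as its space, so integrals with respect to
  \<open>\<mu>\<close> are integrals over the punctured line.\<close>

definition f_Phi :: "(real \<Rightarrow> real) \<Rightarrow> real measure \<Rightarrow> real \<Rightarrow> real" where
  "f_Phi \<psi> \<mu> y = (LINT x|\<mu>. Phi \<psi> x y)"

definition v_kernel :: "(real \<Rightarrow> real) \<Rightarrow> real measure \<Rightarrow> real \<Rightarrow> real \<Rightarrow> real" where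
  "v_kernel \<psi> \<mu> x y = Phi \<psi> x y + f_Phi \<psi> \<mu> y"

text \<open>The left-hand side of the Laplace transform identity is at most 1 and the determinant
  tends to 1 as \<open>s\<close> tends to 0, so the identity itself forces the determinant to be positive
  for all positive \<open>s\<close>; only powers of positive reals matter.\<close>

definition permanental_process ::
  "'a measure \<Rightarrow> real \<Rightarrow> (real \<Rightarrow> real \<Rightarrow> real) \<Rightarrow> (real \<Rightarrow> 'a \<Rightarrow> real) \<Rightarrow> bool" where
  "permanental_process M \<alpha> K X \<longleftrightarrow>
     prob_space M \<and>
     (\<forall>t\<in>{0..1}. X t \<in> borel_measurable M \<and> (\<forall>\<omega>\<in>space M. 0 \<le> X t \<omega>)) \<and>
     (\<forall>(n::nat) (t :: nat \<Rightarrow> real) (s :: nat \<Rightarrow> real).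
        (\<forall>i<n. t i \<in> {0..1} \<and> 0 < s i) \<longrightarrow>
        (LINT \<omega>|M. exp (- (\<Sum>i<n. s i * X (t i) \<omega>))) =
          1 / (Determinant.det
                 (1\<^sub>m n + Matrix.mat n n (\<lambda>(i, j). K (t i) (t j)) * mat_diag n s)) powr \<alpha>)"

text \<open>\<open>Y\<close> is a version (modification) of \<open>X\<close> on the unit interval, on the same
  probability space.\<close>

definition version_of :: "'a measure \<Rightarrow> (real \<Rightarrow> 'a \<Rightarrow> real) \<Rightarrow> (real \<Rightarrow> 'a \<Rightarrow> real) \<Rightarrow> bool" where
  "version_of M X Y \<longleftrightarrow>
     (\<forall>t\<in>{0..1}. Y t \<in> borel_measurable M \<and> (AE \<omega> in M. Y t \<omega> = X t \<omega>))"

definition regularly_varying_at_zero :: "(real \<Rightarrow> real) \<Rightarrow> real \<Rightarrow> bool" where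
  "regularly_varying_at_zero f \<rho> \<longleftrightarrow>
     (\<exists>d>0. f \<in> borel_measurable (restrict_space borel {0<..<d}) \<and> (\<forall>x\<in>{0<..<d}. 0 < f x)) \<and>
     (\<forall>c>0. ((\<lambda>x. f (c * x) / f x) \<longlongrightarrow> c powr \<rho>) (at_right 0))"

end

(* Write g for sigma0_sq psi, m for the mass of mu and f for f_Phi, so that v(t,t) = g(t) + f(t).

   Everything on the probabilistic side rests on g being subadditive: it makes the function Phi
   nonnegative and bounded by g, and gives |f(s) - f(t)| <= m g(s - t). Subadditivity follows from
   u(x) u(y) <= u(0) u(x + y) for the resolvent density u of the Levy process, which is an instance
   of the maximum principle for potentials. The maximum principle is elementary for the discrete
   skeleton of the process, whose resolvent is computed by Fourier analysis with Fejer kernels, and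
   it survives the passage to continuous time.

   The Laplace transforms of X(t) and of the pair (X(s), X(t)) are powers of functions that are
   affine in each variable, hence they extend to positive exponents wherever the determinant stays
   positive. This gives the gamma tail of X(t), with scale v(t,t), and an exponential moment of
   |X(s) - X(t)| at the scale (g(s - t) (g(s) + g(t)))^(1/2). As g(x/2) <= q^2 g(x) with q < 1 for
   small x, dyadic chaining produces a continuous version, and on the blocks [theta^(k+1), theta^k]
   with theta = 1 - 2^(-m) an oscillation that is a small multiple of g(theta^k) log log. The gamma
   tail at theta^k and Borel-Cantelli give limsup X(t) / (v(t,t) log log 1/t) <= 1. Finally
   v(t,t) is compared with g(t) and with C t by dominated convergence, again using subadditivity. *)

theory Submission
  imports Defs "HOL-Complex_Analysis.Complex_Analysis" "HOL-Real_Asymp.Real_Asymp"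
begin

text \<open>The kernel \<open>v\<close> is in general not symmetric, so a representation by squared
  Gaussian processes cannot be relied on, and all estimates come from determinants of order one and
  two. For a pair of points the decisive quantity is the second minor
  \<open>v(s,s) v(t,t) - v(s,t) v(t,s)\<close>. With off-diagonal entries \<open>b\<close> and
  \<open>a\<close>, the diagonal ones are \<open>a + x\<close> and \<open>b + y\<close> with
  \<open>x\<close>, \<open>y\<close> between \<open>0\<close> and \<open>g(s - t)\<close>; so the
  minor is at most \<open>(1 + m) (g(s) + g(t)) g(s - t)\<close>, asymmetry notwithstanding, and its
  square root is the scale of an increment. Tails are exponential and not Gaussian: log log enters
  to the first power, with the gamma rate \<open>1 / v(t,t)\<close>, whatever \<alpha> is. Regular
  variation is used through the ratio 1/2, apart from positivity near zero. This is why the blocks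
  have relative length \<open>2^(-m)\<close>: after \<open>m\<close> halvings \<open>g\<close> has
  lost a factor \<open>q^(2m)\<close>, so the increment scale across a block is \<open>q^m\<close>
  times \<open>g\<close> at its right end, an arbitrarily small part of the level to be
  beaten.\<close>

section \<open>Laplace transforms of gamma type\<close>

text \<open>A Laplace transform expanded about a positive point is compared with a binomial series
  on one side of the centre only, hence the range of \<open>u\<close>. Convergence there gives a
  whole disc for the difference series, and the zeros of a nonzero power series are
  isolated.\<close>

lemma powser_coeffs_unique_right:
  fixes a b :: "nat \<Rightarrow> real"
  assumes r: "0 < r"
    and a: "\<And>u. 0 \<le> u \<Longrightarrow> u < r \<Longrightarrow> (\<lambda>n. a n * u ^ n) sums F u"
    and b: "\<And>u. 0 \<le> u \<Longrightarrow> u < r \<Longrightarrow> (\<lambda>n. b n * u ^ n) sums F u"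
  shows "a = b"
proof (rule ccontr)
  assume "a \<noteq> b"
  define d where "d n = a n - b n" for n
  define f where "f x = (\<Sum>n. d n * x ^ n)" for x
  have d0: "(\<lambda>n. d n * u ^ n) sums 0" if "0 \<le> u" "u < r" for u
    using sums_diff[OF a[OF that] b[OF that]] by (simp add: d_def algebra_simps)
  have sm: "(\<lambda>n. d n * x ^ n) sums f x" if x: "\<bar>x\<bar> < r" for x
  proof -
    have "summable (\<lambda>n. d n * ((\<bar>x\<bar> + r) / 2) ^ n)"
      using d0[of "(\<bar>x\<bar> + r) / 2"] x r by (auto simp: sums_iff)
    moreover have "norm x < norm ((\<bar>x\<bar> + r) / 2)"
      using x r by auto
    ultimately have "summable (\<lambda>n. d n * x ^ n)"
      by (rule powser_inside)
    then show ?thesis unfolding f_def by (rule summable_sums)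
  qed
  have f0: "f u = 0" if "0 \<le> u" "u < r" for u
    using d0[OF that] sm[of u] that sums_unique2 by auto
  obtain m where m: "d m \<noteq> 0" using \<open>a \<noteq> b\<close> by (auto simp: d_def fun_eq_iff)
  have "f 0 = d 0" unfolding f_def by (simp add: powser_zero)
  then have "m \<noteq> 0" using m f0[of 0] r by (cases m) auto
  then have "m > 0" by simp
  obtain s where s: "0 < s" "\<And>z. z \<in> cball 0 s - {0} \<Longrightarrow> f z \<noteq> 0"
    by (rule powser_0_nonzero[of r 0 d f m]) (use r sm f0[of 0] m \<open>m > 0\<close> in auto)
  have "f (min s (r/2)) \<noteq> 0" using s r by (intro s(2)) auto
  then show False using f0[of "min s (r/2)"] r s by auto
qed

text \<open>The transform is given for positive exponents, with no moment of \<open>X\<close> known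
  to be finite. It is therefore expanded about \<open>s = 1\<close>, in powers of
  \<open>u = 1 - s\<close>: the factor \<open>exp (- X)\<close> tames every moment, all coefficients
  are nonnegative, and the expansion holds in \<open>ennreal\<close> for every
  \<open>u \<ge> 0\<close>. The coefficients are those of a binomial series, which converges up to
  the zero of \<open>c0 + c1 * s\<close>; so the moment series does too, and \<open>s = - p\<close>
  is reached at \<open>u = 1 + p\<close>. The weight \<open>W\<close> makes room for a second
  variable frozen at a fixed exponent.\<close>

lemma gamma_laplace_imp_mgf:
  fixes X W :: "'a \<Rightarrow> real"
  assumes [measurable]: "X \<in> borel_measurable M" "W \<in> borel_measurable M"
    and X: "\<And>\<omega>. \<omega> \<in> space M \<Longrightarrow> 0 \<le> X \<omega>"
    and W: "\<And>\<omega>. \<omega> \<in> space M \<Longrightarrow> 0 \<le> W \<omega>"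
    and Wint: "integrable M W"
    and c0: "0 < c0" and c1: "0 \<le> c1" and p: "0 \<le> p" "c1 * p < c0"
    and L: "\<And>s. 0 < s \<Longrightarrow> (LINT \<omega>|M. W \<omega> * exp (- s * X \<omega>)) = (c0 + c1 * s) powr (- \<alpha>)"
  shows "(\<integral>\<^sup>+ \<omega>. ennreal (W \<omega> * exp (p * X \<omega>)) \<partial>M) = ennreal ((c0 - c1 * p) powr (- \<alpha>))"
proof -
  \<comment> \<open>Value of the affine function at the centre \<open>s = 1\<close>; at
    \<open>s = 1 - u\<close> it is \<open>D - c1 * u = D * (1 - k * u)\<close>.\<close>
  define D where "D = c0 + c1"
  define k where "k = c1 / D"
  have D: "D > 0" using c0 c1 by (simp add: D_def add_pos_nonneg)
  define G where "G u = (D - c1 * u) powr (- \<alpha>)" for u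
  define I where "I u = (\<integral>\<^sup>+ \<omega>. ennreal (W \<omega> * exp ((u - 1) * X \<omega>)) \<partial>M)" for u :: real
  define J where "J n = (\<integral>\<^sup>+ \<omega>. ennreal (W \<omega> * exp (- X \<omega>) * X \<omega> ^ n / fact n) \<partial>M)" for n
  define b where "b n = D powr (- \<alpha>) * ((- \<alpha>) gchoose n) * (- k) ^ n" for n
  have IJ: "I u = (\<Sum>n. J n * ennreal (u ^ n))" if u: "0 \<le> u" for u
  proof -
    have "I u = (\<integral>\<^sup>+ \<omega>. (\<Sum>n. ennreal (W \<omega> * exp (- X \<omega>) * X \<omega> ^ n / fact n) * ennreal (u ^ n)) \<partial>M)"
      unfolding I_def
    proof (rule nn_integral_cong)
      fix \<omega> assume w: "\<omega> \<in> space M"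
      have "(\<lambda>n. (u * X \<omega>) ^ n /\<^sub>R fact n) sums exp (u * X \<omega>)" by (rule exp_converges)
      then have "(\<lambda>n. (W \<omega> * exp (- X \<omega>)) * ((u * X \<omega>) ^ n /\<^sub>R fact n)) sums
          ((W \<omega> * exp (- X \<omega>)) * exp (u * X \<omega>))" by (rule sums_mult)
      moreover have "(W \<omega> * exp (- X \<omega>)) * exp (u * X \<omega>) = W \<omega> * exp ((u - 1) * X \<omega>)"
        by (simp add: mult_exp_exp algebra_simps)
      ultimately have "(\<lambda>n. W \<omega> * exp (- X \<omega>) * X \<omega> ^ n / fact n * u ^ n) sums
          (W \<omega> * exp ((u - 1) * X \<omega>))"
        by (simp only: power_mult_distrib divide_inverse real_scaleR_def mult_ac)
      then have "(\<Sum>n. ennreal (W \<omega> * exp (- X \<omega>) * X \<omega> ^ n / fact n * u ^ n)) =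
          ennreal (W \<omega> * exp ((u - 1) * X \<omega>))"
        by (rule suminf_ennreal_eq[rotated]) (use X[OF w] W[OF w] u in auto)
      then show "ennreal (W \<omega> * exp ((u - 1) * X \<omega>)) =
          (\<Sum>n. ennreal (W \<omega> * exp (- X \<omega>) * X \<omega> ^ n / fact n) * ennreal (u ^ n))"
        by (simp only: ennreal_mult''[OF zero_le_power[OF u], symmetric])
    qed
    also have "\<dots> = (\<Sum>n. \<integral>\<^sup>+ \<omega>. ennreal (W \<omega> * exp (- X \<omega>) * X \<omega> ^ n / fact n) * ennreal (u ^ n) \<partial>M)"
      by (rule nn_integral_suminf) measurable
    also have "\<dots> = (\<Sum>n. J n * ennreal (u ^ n))"
      unfolding J_def by (subst nn_integral_multc) auto
    finally show ?thesis .
  qed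
  have Gpos: "G u \<ge> 0" for u by (simp add: G_def)
  have IG: "I u = ennreal (G u)" if u: "0 \<le> u" "u < 1" for u
  proof -
    have int: "integrable M (\<lambda>\<omega>. W \<omega> * exp (- (1 - u) * X \<omega>))"
    proof (rule Bochner_Integration.integrable_bound[OF Wint])
      show "AE \<omega> in M. norm (W \<omega> * exp (- (1 - u) * X \<omega>)) \<le> norm (W \<omega>)"
      proof (rule AE_I2)
        fix \<omega> assume w: "\<omega> \<in> space M"
        have "exp (- (1 - u) * X \<omega>) \<le> 1" using X[OF w] u by (simp add: mult_nonpos_nonneg)
        then show "norm (W \<omega> * exp (- (1 - u) * X \<omega>)) \<le> norm (W \<omega>)"
          using W[OF w] by (simp add: mult_left_le)
      qed
    qed measurable
    have "I u = ennreal (LINT \<omega>|M. W \<omega> * exp (- (1 - u) * X \<omega>))"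
      unfolding I_def
      by (subst nn_integral_eq_integral[symmetric, OF int]) (use W in \<open>auto intro!: AE_I2 nn_integral_cong\<close>)
    also have "\<dots> = ennreal (G u)"
      using L[of "1 - u"] u by (simp add: G_def D_def algebra_simps)
    finally show ?thesis .
  qed
  have Jfin: "J n < \<top>" for n
  proof -
    have "J n * ennreal ((1/2) ^ n) \<le> (\<Sum>n. J n * ennreal ((1/2) ^ n))"
    proof -
      have "sum (\<lambda>n. J n * ennreal ((1/2) ^ n)) {n} \<le> (\<Sum>n. J n * ennreal ((1/2) ^ n))"
        by (rule sum_le_suminf) auto
      then show ?thesis by simp
    qed
    also have "\<dots> = ennreal (G (1/2))" using IJ[of "1/2"] IG[of "1/2"] by simp
    finally have "J n * ennreal ((1/2) ^ n) < \<top>" by (simp add: le_less_trans)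
    then show ?thesis by (auto simp: ennreal_mult_less_top)
  qed
  define a where "a n = enn2real (J n)" for n
  have Ja: "J n = ennreal (a n)" for n using Jfin by (simp add: a_def)
  have a0: "a n \<ge> 0" for n by (simp add: a_def)
  have asum: "(\<lambda>n. a n * u ^ n) sums G u" if u: "0 \<le> u" "u < 1" for u
  proof -
    have "(\<Sum>n. ennreal (a n * u ^ n)) = ennreal (G u)"
      using IJ[OF u(1)] IG[OF u] u a0 by (simp add: Ja ennreal_mult)
    then have "(\<lambda>n. ennreal (a n * u ^ n)) sums ennreal (G u)" by (simp add: sums_iff)
    then show ?thesis using a0 u Gpos by (subst (asm) sums_ennreal) auto
  qed
  have bsum: "(\<lambda>n. b n * u ^ n) sums G u" if u: "0 \<le> u" "c1 * u < D" for u
  proof -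
    have ku: "\<bar>- (k * u)\<bar> < 1" using u D c1 by (simp add: k_def field_simps abs_mult)
    have "(\<lambda>n. D powr (- \<alpha>) * (((- \<alpha>) gchoose n) * (- (k * u)) ^ n)) sums (D powr (- \<alpha>) * (1 + - (k * u)) powr (- \<alpha>))"
      by (intro sums_mult gen_binomial_real ku)
    moreover have "D powr (- \<alpha>) * (1 + - (k * u)) powr (- \<alpha>) = G u"
    proof -
      have "1 + - (k * u) \<ge> 0" using ku by linarith
      then have "D powr (- \<alpha>) * (1 + - (k * u)) powr (- \<alpha>) = (D * (1 + - (k * u))) powr (- \<alpha>)"
        using D by (simp add: powr_mult)
      also have "D * (1 + - (k * u)) = D - c1 * u" using D by (simp add: k_def field_simps)
      finally show ?thesis by (simp add: G_def)
    qed
    moreover have "(- (k * u)) ^ n = (-k) ^ n * u ^ n" for n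
      by (metis mult_minus_left power_mult_distrib)
    ultimately show ?thesis by (simp add: b_def mult.assoc)
  qed
  \<comment> \<open>Both series represent \<open>G\<close> for \<open>0 \<le> u < 1\<close>. Once
    the coefficients agree, the binomial series decides convergence at \<open>u = 1 + p\<close>,
    outside the range where the transform was given.\<close>
  have "a = b"
    by (rule powser_coeffs_unique_right[of 1 _ G])
      (use asum bsum c0 c1 in \<open>auto simp: D_def intro!: bsum\<close>, smt (verit) mult_left_le)
  then have "(\<Sum>n. a n * (1 + p) ^ n) = G (1 + p)" "summable (\<lambda>n. a n * (1 + p) ^ n)"
    using bsum[of "1 + p"] p by (simp_all add: D_def algebra_simps sums_iff)
  then have "I (1 + p) = ennreal (G (1 + p))"
    using IJ[of "1 + p"] p a0
    by (simp add: Ja suminf_ennreal2 ennreal_mult''[symmetric])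
  then show ?thesis by (simp add: I_def G_def D_def algebra_simps)
qed

section \<open>Determinants of order one and two\<close>

lemma det_one_plus_single:
  fixes K :: "nat \<Rightarrow> nat \<Rightarrow> real"
  shows "Determinant.det (1\<^sub>m 1 + Matrix.mat 1 1 (\<lambda>(i, j). K i j) * mat_diag 1 s) = 1 + K 0 0 * s 0"
  by (subst det_single) (auto simp: mat_diag_def scalar_prod_def)

lemma det_one_plus_pair:
  fixes K :: "nat \<Rightarrow> nat \<Rightarrow> real"
  shows "Determinant.det (1\<^sub>m 2 + Matrix.mat 2 2 (\<lambda>(i, j). K i j) * mat_diag 2 s) =
    (1 + K 0 0 * s 0) * (1 + K 1 1 * s 1) - K 0 1 * s 1 * (K 1 0 * s 0)"
proof -
  let ?A = "1\<^sub>m 2 + Matrix.mat 2 2 (\<lambda>(i, j). K i j) * mat_diag 2 s"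
  have A: "?A \<in> carrier_mat 2 2" unfolding mat_diag_def
    by (intro add_carrier_mat mult_carrier_mat[of _ 2 2]) auto
  have [simp]: "dim_row (mat_diag 2 s) = 2" "dim_col (mat_diag 2 s) = 2"
    by (auto simp: mat_diag_def)
  have e: "?A $$ (i, j) = (if i = j then 1 else 0) + K i j * s j" if "i < 2" "j < 2" for i j
    using that by (simp add: mat_diag_mult_right[of _ 2 2])
  have "Determinant.det ?A = (\<Sum>i<2. ?A $$ (i,0) * cofactor ?A i 0)"
    by (rule laplace_expansion_column[OF A]) simp
  also have "\<dots> = ?A $$ (0,0) * cofactor ?A 0 0 + ?A $$ (1,0) * cofactor ?A 1 0"
    by (simp only: numeral_2_eq_2 lessThan_Suc) simp
  also have "cofactor ?A 0 0 = ?A $$ (1,1)"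
    unfolding cofactor_def by (subst det_single) (auto simp: mat_delete_def)
  also have "cofactor ?A 1 0 = - ?A $$ (0,1)"
    unfolding cofactor_def by (subst det_single) (auto simp: mat_delete_def)
  finally show ?thesis by (simp only: e) (simp add: algebra_simps)
qed

section \<open>Dyadic chaining\<close>

text \<open>From level \<open>n\<close> to \<open>n + 1\<close> only points of odd index are new,
  and each is one step away from a point of level \<open>n\<close>; so each level is paid for
  once.\<close>

lemma dyadic_chain:
  fixes y :: "real \<Rightarrow> real"
  assumes "\<And>i j. i \<le> n \<Longrightarrow> j < 2 ^ i \<Longrightarrow> \<bar>y (real (Suc j) / 2 ^ i) - y (real j / 2 ^ i)\<bar> \<le> lam i"
  shows "j \<le> 2 ^ n \<Longrightarrow> \<bar>y (real j / 2 ^ n) - y 0\<bar> \<le> (\<Sum>i\<le>n. lam i)"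
  using assms
proof (induction n arbitrary: j)
  case 0
  have "\<bar>y (real (Suc 0) / 2 ^ 0) - y (real 0 / 2 ^ 0)\<bar> \<le> lam 0"
    by (rule 0(2)) auto
  moreover have "j = 0 \<or> j = 1" using 0 by auto
  ultimately show ?case by auto
next
  case (Suc n)
  have IH: "\<bar>y (real i / 2 ^ n) - y 0\<bar> \<le> (\<Sum>i\<le>n. lam i)" if "i \<le> 2 ^ n" for i
    using that Suc.prems(2) by (intro Suc.IH) auto
  have pos: "lam (Suc n) \<ge> 0"
    using Suc.prems(2)[of "Suc n" 0] by (meson abs_ge_zero le_refl order_trans zero_less_numeral zero_less_power)
  obtain i where "j = 2 * i \<or> j = Suc (2 * i)" by (metis oddE evenE Suc_eq_plus1)
  then show ?case
  proof
    assume j: "j = 2 * i"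
    then have "real j / 2 ^ Suc n = real i / 2 ^ n" "i \<le> 2 ^ n" using Suc.prems by auto
    then show ?thesis using IH[of i] pos by simp
  next
    assume j: "j = Suc (2 * i)"
    then have i: "i < 2 ^ n" using Suc.prems(1) by auto
    have "\<bar>y (real (Suc (2 * i)) / 2 ^ Suc n) - y (real (2 * i) / 2 ^ Suc n)\<bar> \<le> lam (Suc n)"
      using i by (intro Suc.prems) auto
    moreover have "real (2 * i) / 2 ^ Suc n = real i / 2 ^ n" by simp
    ultimately show ?thesis using IH[of i] i j by (simp del: of_nat_Suc)
  qed
qed

definition dyadic_floor :: "nat \<Rightarrow> real \<Rightarrow> real" where
  "dyadic_floor n t = real (nat \<lfloor>t * 2 ^ n\<rfloor>) / 2 ^ n"

lemma dyadic_floor_bounds: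
  assumes "0 \<le> t"
  shows "dyadic_floor n t \<le> t" "t - dyadic_floor n t \<le> 1 / 2 ^ n" "0 \<le> dyadic_floor n t"
proof -
  define x where "x = t * 2 ^ n"
  have x: "0 \<le> x" using assms by (simp add: x_def)
  have t: "t = x / 2 ^ n" by (simp add: x_def)
  have e: "real (nat \<lfloor>x\<rfloor>) \<le> x" "x - real (nat \<lfloor>x\<rfloor>) \<le> 1"
    using x by linarith+
  have d: "dyadic_floor n t = real (nat \<lfloor>x\<rfloor>) / 2 ^ n" by (simp add: dyadic_floor_def x_def)
  show "dyadic_floor n t \<le> t" "0 \<le> dyadic_floor n t"
    unfolding d using e(1) by (auto simp: t divide_right_mono)
  show "t - dyadic_floor n t \<le> 1 / 2 ^ n"
  proof -
    have "(x - real (nat \<lfloor>x\<rfloor>)) / 2 ^ n \<le> 1 / 2 ^ n" using e(2) by (intro divide_right_mono) auto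
    then show ?thesis using d t by (simp add: diff_divide_distrib)
  qed
qed

lemma dyadic_floor_tendsto:
  assumes "0 \<le> t"
  shows "(\<lambda>n. dyadic_floor n t) \<longlonglongrightarrow> t"
proof (rule Lim_null_comparison[where g = "\<lambda>n. 1 / 2 ^ n", THEN Lim_null[THEN iffD2]])
  show "\<forall>\<^sub>F n in sequentially. norm (dyadic_floor n t - t) \<le> 1 / 2 ^ n"
  proof (intro always_eventually allI)
    fix n
    show "norm (dyadic_floor n t - t) \<le> 1 / 2 ^ n"
      using dyadic_floor_bounds(1,2)[OF assms, of n] unfolding real_norm_def by linarith
  qed
  show "(\<lambda>n. 1 / 2 ^ n :: real) \<longlonglongrightarrow> 0" by real_asymp
qed

lemma nat_floor_mult_power_le:
  assumes "t \<le> (1::real)"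
  shows "nat \<lfloor>t * 2 ^ n\<rfloor> \<le> 2 ^ n"
proof -
  have "t * 2 ^ n \<le> 1 * 2 ^ n" using assms by (intro mult_right_mono) auto
  then have "\<lfloor>t * 2 ^ n\<rfloor> \<le> \<lfloor>real_of_int (2 ^ n)\<rfloor>" by (intro floor_mono) simp
  then show ?thesis by (simp only: floor_of_int) (simp add: nat_le_iff)
qed

lemma dyadic_floor_nat:
  assumes "t \<le> 1"
  obtains j where "j \<le> 2 ^ n" "dyadic_floor n t = real j / 2 ^ n"
  by (rule that[OF nat_floor_mult_power_le[OF assms]]) (simp add: dyadic_floor_def)

text \<open>Closes both chaining arguments that run over dyadic points: the one for \<open>g\<close>
  itself and the one for the paths on a block.\<close>

lemma dyadic_dense_bound:
  fixes f :: "real \<Rightarrow> real"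
  assumes c: "continuous_on {0..1} f" and b: "\<And>n j. j \<le> 2 ^ n \<Longrightarrow> f (real j / 2 ^ n) \<le> B"
    and u: "u \<in> {0..1}"
  shows "f u \<le> B"
proof (rule LIMSEQ_le_const2)
  have "dyadic_floor n u \<in> {0..1}" for n using dyadic_floor_bounds[of u n] u by auto
  then show "(\<lambda>n. f (dyadic_floor n u)) \<longlonglongrightarrow> f u"
    using c u by (intro continuous_on_tendsto_compose[OF c dyadic_floor_tendsto]) auto
  show "\<exists>N. \<forall>n\<ge>N. f (dyadic_floor n u) \<le> B"
    using b dyadic_floor_nat[of u] u by (metis atLeastAtMost_iff)
qed

text \<open>Points closer than \<open>1 / 2 ^ N\<close> lie in equal or adjacent cells of level
  \<open>N\<close>. Chaining from the left end of a cell costs a tail of the sum, and passing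
  between adjacent left ends costs one term of it.\<close>

lemma dyadic_uniformly_continuous:
  fixes y :: "real \<Rightarrow> real"
  assumes sm: "summable lam"
    and N0: "\<And>n j. n \<ge> N0 \<Longrightarrow> j < 2 ^ n \<Longrightarrow> \<bar>y (real (Suc j) / 2 ^ n) - y (real j / 2 ^ n)\<bar> \<le> lam n"
  shows "uniformly_continuous_on {real j / 2 ^ n | j n. j \<le> 2 ^ n} y"
  unfolding uniformly_continuous_on_def
proof (intro allI impI)
  fix e :: real assume e: "e > 0"
  have lam0: "lam n \<ge> 0" if "n \<ge> N0" for n
    using N0[of n 0] that by (meson abs_ge_zero order_trans zero_less_numeral zero_less_power)
  obtain N1 where N1: "\<And>m n. m \<ge> N1 \<Longrightarrow> \<bar>sum lam {m..<n}\<bar> < e / 4"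
    using sm[unfolded summable_Cauchy, rule_format, of "e / 4"] e by auto
  define N where "N = max N0 N1"
  have Nsum: "(\<Sum>i\<le>n. lam (N + i)) < e / 4" for n
  proof -
    have "(\<Sum>i\<le>n. lam (N + i)) = sum lam {N..<N + Suc n}"
      by (subst sum.atLeastLessThan_shift_0) (simp add: atLeast0LessThan lessThan_Suc_atMost)
    moreover have "\<bar>sum lam {N..<N + Suc n}\<bar> < e / 4" by (rule N1) (simp add: N_def)
    ultimately show ?thesis by linarith
  qed
  have cell: "\<bar>y s - y (dyadic_floor N s)\<bar> < e / 4"
    if s: "s = real j / 2 ^ n" "j \<le> 2 ^ n" for s j n
  proof -
    have s01: "0 \<le> s" "s \<le> 1" using s by auto
    define k where "k = nat \<lfloor>s * 2 ^ N\<rfloor>"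
    have dk: "dyadic_floor N s = real k / 2 ^ N" by (simp add: dyadic_floor_def k_def)
    have kle: "k \<le> 2 ^ N"
      using nat_floor_mult_power_le[OF s01(2)] by (simp add: k_def)
    show ?thesis
    \<comment> \<open>The cell with left end \<open>1\<close> contains only the point
      \<open>1\<close>; chaining in it would leave the unit interval.\<close>
    proof (cases "k = 2 ^ N")
      case True
      then have "dyadic_floor N s = 1" using dk by simp
      then have "s = 1" using dyadic_floor_bounds[OF s01(1), of N] s01 by linarith
      then show ?thesis using \<open>dyadic_floor N s = 1\<close> e by simp
    next
      case False
      then have k: "k < 2 ^ N" using kle by simp
      \<comment> \<open>The cell blown up to the unit interval: level \<open>a\<close> of
        \<open>z\<close> is level \<open>N + a\<close> of \<open>y\<close>.\<close>
      define z where "z u = y ((real k + u) / 2 ^ N)" for u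
      have ks: "real k / 2 ^ N \<le> s" "s - real k / 2 ^ N \<le> 1 / 2 ^ N"
        using dyadic_floor_bounds[OF s01(1), of N] dk by auto
      have "s \<le> (real k + 1) / 2 ^ N" using ks by (simp add: add_divide_distrib)
      then have "real k * 2 ^ n \<le> real j * 2 ^ N" "real j * 2 ^ N \<le> real k * 2 ^ n + 2 ^ n"
        using ks(1) by (auto simp: s(1) field_simps)
      then have "real (k * 2 ^ n) \<le> real (j * 2 ^ N)" "real (j * 2 ^ N) \<le> real (k * 2 ^ n + 2 ^ n)"
        by auto
      then have "k * 2 ^ n \<le> j * 2 ^ N" "j * 2 ^ N \<le> k * 2 ^ n + 2 ^ n"
        using of_nat_le_iff by blast+
      then obtain i where i: "j * 2 ^ N = k * 2 ^ n + i" "i \<le> 2 ^ n"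
        by (metis add_le_cancel_left le_iff_add)
      have "real (j * 2 ^ N) = real (k * 2 ^ n + i)" using i by simp
      then have "s = (real k + real i / 2 ^ n) / 2 ^ N" by (simp add: s(1) field_simps)
      then have zs: "y s = z (real i / 2 ^ n)" by (simp add: z_def)
      have "\<bar>z (real i / 2 ^ n) - z 0\<bar> \<le> (\<Sum>i\<le>n. lam (N + i))"
      proof (rule dyadic_chain[OF _ i(2)])
        fix a b :: nat assume ab: "b < 2 ^ a"
        have "k * 2 ^ a + b < 2 ^ (N + a)"
        proof -
          have "k * 2 ^ a + b < (k + 1) * 2 ^ a" using ab by simp
          also have "\<dots> \<le> 2 ^ N * 2 ^ a" using k by (intro mult_right_mono) auto
          finally show ?thesis by (simp add: power_add)
        qed
        then have "\<bar>y (real (Suc (k * 2 ^ a + b)) / 2 ^ (N + a)) - y (real (k * 2 ^ a + b) / 2 ^ (N + a))\<bar> \<le> lam (N + a)"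
          by (intro N0) (simp_all add: N_def)
        then show "\<bar>z (real (Suc b) / 2 ^ a) - z (real b / 2 ^ a)\<bar> \<le> lam (N + a)"
          by (simp add: z_def power_add field_simps)
      qed
      then show ?thesis using Nsum[of n] zs dk by (simp add: z_def)
    qed
  qed
  show "\<exists>d>0. \<forall>x\<in>{real j / 2 ^ n |j n. j \<le> 2 ^ n}. \<forall>x'\<in>{real j / 2 ^ n |j n. j \<le> 2 ^ n}. dist x' x < d \<longrightarrow> dist (y x') (y x) < e"
  proof (intro exI[of _ "1 / 2 ^ N"] conjI ballI impI)
    fix s t assume st: "s \<in> {real j / 2 ^ n |j n. j \<le> 2 ^ n}" "t \<in> {real j / 2 ^ n |j n. j \<le> 2 ^ n}"
      and d: "dist t s < 1 / 2 ^ N"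
    define a b where "a = nat \<lfloor>s * 2 ^ N\<rfloor>" and "b = nat \<lfloor>t * 2 ^ N\<rfloor>"
    have s01: "0 \<le> s" "s \<le> 1" "0 \<le> t" "t \<le> 1" using st by auto
    have da: "dyadic_floor N s = real a / 2 ^ N" "dyadic_floor N t = real b / 2 ^ N"
      by (simp_all add: dyadic_floor_def a_def b_def)
    have ab: "a \<le> 2 ^ N" "b \<le> 2 ^ N"
      using nat_floor_mult_power_le s01 by (simp_all add: a_def b_def)
    have "\<bar>t * 2 ^ N - s * 2 ^ N\<bar> < 1"
    proof -
      have "\<bar>t - s\<bar> * 2 ^ N < 1" using d by (simp add: dist_real_def field_simps)
      then show ?thesis by (simp add: abs_mult flip: left_diff_distrib)
    qed
    then have "a = b \<or> a = Suc b \<or> b = Suc a"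
    proof -
      have "t * 2 ^ N \<ge> 0" "s * 2 ^ N \<ge> 0" using s01 by auto
      then have "real a \<le> s * 2 ^ N" "s * 2 ^ N < real a + 1" "real b \<le> t * 2 ^ N" "t * 2 ^ N < real b + 1"
        unfolding a_def b_def by linarith+
      then have "real a < real b + 2" "real b < real a + 2"
        using \<open>\<bar>t * 2 ^ N - s * 2 ^ N\<bar> < 1\<close> by linarith+
      then show ?thesis by linarith
    qed
    moreover have lN: "\<bar>y (real (Suc c) / 2 ^ N) - y (real c / 2 ^ N)\<bar> < e / 4" if "Suc c \<le> 2 ^ N" for c
    proof -
      have "\<bar>y (real (Suc c) / 2 ^ N) - y (real c / 2 ^ N)\<bar> \<le> lam N"
        using that by (intro N0) (auto simp: N_def)
      moreover have "lam N < e / 4" using Nsum[of 0] by simp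
      ultimately show ?thesis by linarith
    qed
    ultimately have "\<bar>y (real b / 2 ^ N) - y (real a / 2 ^ N)\<bar> < e / 4"
      using lN[of a] lN[of b] ab e by (elim disjE) (simp_all del: of_nat_Suc add: abs_minus_commute)
    then have "\<bar>y (dyadic_floor N t) - y (dyadic_floor N s)\<bar> < e / 4"
      unfolding da .
    moreover have "\<bar>y s - y (dyadic_floor N s)\<bar> < e / 4"
      using st(1) by (elim CollectE exE conjE) (rule cell)
    moreover have "\<bar>y t - y (dyadic_floor N t)\<bar> < e / 4"
      using st(2) by (elim CollectE exE conjE) (rule cell)
    ultimately show "dist (y t) (y s) < e" using e unfolding dist_real_def by linarith
  qed simp
qed

text \<open>The extension is described as a limit along the explicit points
  \<open>dyadic_floor n t\<close>, because this makes it measurable when \<open>y\<close> is a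
  random path.\<close>

lemma dyadic_extension:
  fixes y :: "real \<Rightarrow> real"
  assumes sm: "summable lam"
    and N0: "\<And>n j. n \<ge> N0 \<Longrightarrow> j < 2 ^ n \<Longrightarrow> \<bar>y (real (Suc j) / 2 ^ n) - y (real j / 2 ^ n)\<bar> \<le> lam n"
  obtains z where "continuous_on {0..1} z" "\<And>t. t \<in> {0..1} \<Longrightarrow> (\<lambda>n. y (dyadic_floor n t)) \<longlonglongrightarrow> z t"
proof -
  define D where "D = {real j / 2 ^ n | j n. j \<le> 2 ^ n}"
  have uc: "uniformly_continuous_on D y"
    unfolding D_def by (rule dyadic_uniformly_continuous[OF sm]) (rule N0)
  obtain z where z: "uniformly_continuous_on (closure D) z" "\<forall>x\<in>D. y x = z x"
  proof (rule uniformly_continuous_on_extension_on_closure[OF uc])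
    fix g assume "uniformly_continuous_on (closure D) g" "\<And>x. x \<in> D \<Longrightarrow> y x = g x"
    then show thesis by (intro that[of g]) auto
  qed
  have dD: "dyadic_floor n t \<in> D" if "t \<in> {0..1}" for n t
    unfolding D_def dyadic_floor_def using nat_floor_mult_power_le[of t n] that
    by fastforce
  have sub: "{0..1} \<subseteq> closure D"
  proof
    fix t :: real assume t: "t \<in> {0..1}"
    show "t \<in> closure D"
      unfolding closure_sequential using dD[OF t] dyadic_floor_tendsto[of t] t
      by (intro exI[of _ "\<lambda>n. dyadic_floor n t"]) auto
  qed
  have c: "continuous_on (closure D) z" using z(1) by (rule uniformly_continuous_imp_continuous)
  show thesis
  proof
    show "continuous_on {0..1} z" using c sub by (rule continuous_on_subset)
    fix t :: real assume t: "t \<in> {0..1}"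
    have "\<forall>n. dyadic_floor n t \<in> closure D" using dD[OF t] closure_subset[of D] by blast
    then have ev: "\<forall>\<^sub>F n in sequentially. dyadic_floor n t \<in> closure D" by (rule always_eventually)
    have "t \<in> closure D" using t sub by blast
    then have "(\<lambda>n. z (dyadic_floor n t)) \<longlonglongrightarrow> z t"
      using continuous_on_tendsto_compose[OF c dyadic_floor_tendsto _ ev] t by simp
    then show "(\<lambda>n. y (dyadic_floor n t)) \<longlonglongrightarrow> z t" using z(2) dD[OF t] by simp
  qed
qed

section \<open>Processes with exponential moments of increments\<close>

text \<open>Abstracts from \<open>sigma0_sq\<close>. The halving factor is written as a square
  because \<open>q\<close> then contracts the square root of \<open>g\<close>, and increments of the
  process scale with that root.\<close>

locale subadditive_gauge =
  fixes g :: "real \<Rightarrow> real" and x0 q :: real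
  assumes g_zero [simp]: "g 0 = 0"
    and g_nonneg [simp]: "0 \<le> g x"
    and g_even: "g (- x) = g x"
    and g_subadd: "g (x + y) \<le> g x + g y"
    and g_cont: "continuous_on UNIV g"
    and x0: "0 < x0" "x0 \<le> 1"
    and q: "0 < q" "q < 1"
    and g_pos: "0 < x \<Longrightarrow> x \<le> x0 \<Longrightarrow> 0 < g x"
    and g_half: "0 < x \<Longrightarrow> x \<le> x0 \<Longrightarrow> g (x / 2) \<le> q\<^sup>2 * g x"
begin

lemma g_diff_le: "\<bar>g x - g y\<bar> \<le> g (x - y)"
  using g_subadd[of "x - y" y] g_subadd[of "y - x" x] g_even[of "x - y"] by auto

lemma g_half_iterate:
  assumes "0 < x" "x \<le> x0"
  shows "g (x / 2 ^ n) \<le> q ^ (2 * n) * g x"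
proof (induction n)
  case (Suc n)
  have "x / 2 ^ n \<le> x" using assms by (simp add: field_simps)
  then have "g (x / 2 ^ n / 2) \<le> q\<^sup>2 * g (x / 2 ^ n)"
    using assms by (intro g_half) auto
  also have "\<dots> \<le> q\<^sup>2 * (q ^ (2 * n) * g x)" by (intro mult_left_mono Suc) auto
  finally show ?case by (simp add: power2_eq_square field_simps)
qed simp

text \<open>Substitute for monotonicity, which is not assumed of \<open>g\<close>. Chaining along
  the dyadic points of \<open>[0, T]\<close>, with steps at most
  \<open>g (T / 2 ^ i) \<le> q ^ (2 * i) * g T\<close>, leaves a geometric series.\<close>

lemma g_le_endpoint:
  assumes T: "0 < T" "T \<le> x0" and x: "0 \<le> x" "x \<le> T"
  shows "g x \<le> g T / (1 - q\<^sup>2)"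
proof -
  have q2: "q\<^sup>2 < 1" using q by (simp add: power_less_one_iff)
  have "g (u * T) \<le> g T / (1 - q\<^sup>2)" if "u \<in> {0..1}" for u
  proof (rule dyadic_dense_bound[where f = "\<lambda>u. g (u * T)", OF _ _ that])
    show "continuous_on {0..1} (\<lambda>u. g (u * T))"
      by (intro continuous_on_compose2[OF g_cont] continuous_intros) auto
    fix n j :: nat assume j: "j \<le> 2 ^ n"
    have "\<bar>g (real j / 2 ^ n * T) - g (0 * T)\<bar> \<le> (\<Sum>i\<le>n. (q\<^sup>2) ^ i * g T)"
    proof (rule dyadic_chain[where y = "\<lambda>u. g (u * T)", OF _ j])
      fix i k :: nat
      have "\<bar>g (real (Suc k) / 2 ^ i * T) - g (real k / 2 ^ i * T)\<bar> \<le> g (T / 2 ^ i)"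
        using g_diff_le[of "real (Suc k) / 2 ^ i * T" "real k / 2 ^ i * T"]
        by (simp add: field_simps)
      also have "\<dots> \<le> (q\<^sup>2) ^ i * g T" using g_half_iterate[OF T, of i] by (simp add: power_mult)
      finally show "\<bar>g (real (Suc k) / 2 ^ i * T) - g (real k / 2 ^ i * T)\<bar> \<le> (q\<^sup>2) ^ i * g T" .
    qed
    also have "(\<Sum>i\<le>n. (q\<^sup>2) ^ i * g T) = (\<Sum>i<Suc n. (q\<^sup>2) ^ i) * g T"
      by (simp only: sum_distrib_right lessThan_Suc_atMost)
    also have "\<dots> \<le> (1 / (1 - q\<^sup>2)) * g T"
    proof (rule mult_right_mono)
      have "(\<Sum>i<Suc n. (q\<^sup>2) ^ i) \<le> (\<Sum>i. (q\<^sup>2) ^ i)"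
        using q2 by (intro sum_le_suminf summable_geometric) auto
      then show "(\<Sum>i<Suc n. (q\<^sup>2) ^ i) \<le> 1 / (1 - q\<^sup>2)"
        using q2 by (simp add: suminf_geometric)
    qed simp
    finally show "g (real j / 2 ^ n * T) \<le> g T / (1 - q\<^sup>2)" by simp
  qed
  from this[of "x / T"] show ?thesis using T x by simp
qed

text \<open>Halving contracts only below \<open>x0\<close>; the finitely many larger scales are
  absorbed into \<open>Cg = B / q ^ (2 * n0)\<close>, where \<open>1 / 2 ^ n0 < x0\<close>.\<close>

lemma g_power_bound:
  obtains B Cg where "1 \<le> B" "\<And>x. x \<in> {0..1} \<Longrightarrow> g x \<le> B" "1 \<le> Cg" "\<And>n. g (1 / 2 ^ n) \<le> Cg * q ^ (2 * n)"
proof -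
  have "compact (g ` {0..1})"
    by (intro compact_continuous_image continuous_on_subset[OF g_cont]) auto
  then obtain B0 where B0: "\<And>x. x \<in> {0..1} \<Longrightarrow> g x \<le> B0"
    by (metis bounded_imp_bdd_above compact_imp_bounded bdd_above.E image_eqI)
  define B where "B = max 1 B0"
  have B: "1 \<le> B" "\<And>x. x \<in> {0..1} \<Longrightarrow> g x \<le> B" using B0 by (auto simp: B_def intro: le_max_iff_disj[THEN iffD2])
  obtain n0 where n0: "(1/2::real) ^ n0 < x0"
    using real_arch_pow_inv[of x0 "1/2"] x0 by auto
  define Cg where "Cg = B / q ^ (2 * n0)"
  have qq: "0 < q ^ k" "q ^ k \<le> 1" for k using q by (auto intro: power_le_one)
  have "1 \<le> Cg" using B(1) qq[of "2 * n0"] by (simp add: Cg_def field_simps)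
  moreover have "g (1 / 2 ^ n) \<le> Cg * q ^ (2 * n)" for n
  proof (cases "n0 \<le> n")
    case True
    then obtain k where k: "n = n0 + k" by (metis le_iff_add)
    have "g (1 / 2 ^ n) = g (1 / 2 ^ n0 / 2 ^ k)" by (simp add: k power_add)
    also have "\<dots> \<le> q ^ (2 * k) * g (1 / 2 ^ n0)"
      using n0 by (intro g_half_iterate) (auto simp: power_one_over)
    also have "\<dots> \<le> q ^ (2 * k) * B" using qq[of "2 * k"] by (intro mult_left_mono B(2)) auto
    also have "\<dots> = Cg * q ^ (2 * n)" using q by (simp add: Cg_def k power_add field_simps)
    finally show ?thesis .
  next
    case False
    have "g (1 / 2 ^ n) \<le> B" by (rule B(2)) simp
    also have "\<dots> \<le> Cg * q ^ (2 * n)"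
    proof -
      have "q ^ (2 * n0) \<le> q ^ (2 * n)" using False q by (intro power_decreasing) auto
      then show ?thesis using B(1) qq[of "2 * n0"] by (simp add: Cg_def field_simps)
    qed
    finally show ?thesis .
  qed
  ultimately show thesis using B that by blast
qed

end

text \<open>For a permanental process the determinant of a pair is \<open>1\<close> minus a linear
  and a quadratic term in \<open>p\<close>. The two conditions keep each of these terms at most
  \<open>1/4\<close> and the determinant at least \<open>1/2\<close>. The quadratic one accounts for
  the scale \<open>(g (s - t) * (g s + g t)) powr (1/2)\<close>.\<close>

locale exp_increments = prob_space M + subadditive_gauge g x0 q
  for M :: "'a measure" and g x0 q +
  fixes X :: "real \<Rightarrow> 'a \<Rightarrow> real" and c C0 :: real
  assumes X_meas: "t \<in> {0..1} \<Longrightarrow> X t \<in> borel_measurable M"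
    and c1: "1 \<le> c" and C0: "0 \<le> C0"
    and exp_increment: "\<lbrakk>s \<in> {0..1}; t \<in> {0..1}; 0 \<le> p; p * c * g (s - t) \<le> 1/4;
        p\<^sup>2 * c * (g s + g t) * g (s - t) \<le> 1/4\<rbrakk>
      \<Longrightarrow> (\<integral>\<^sup>+ \<omega>. ennreal (exp (p * \<bar>X s \<omega> - X t \<omega>\<bar>)) \<partial>M) \<le> ennreal C0"
begin

lemma increment_tail:
  assumes st: "s \<in> {0..1}" "t \<in> {0..1}" and p: "0 < p" "p * c * g (s - t) \<le> 1/4"
    "p\<^sup>2 * c * (g s + g t) * g (s - t) \<le> 1/4"
  shows "prob {\<omega> \<in> space M. \<bar>X s \<omega> - X t \<omega>\<bar> > l} \<le> C0 * exp (- (p * l))"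
proof -
  note [measurable] = X_meas[OF st(1)] X_meas[OF st(2)]
  have "emeasure M {\<omega> \<in> space M. \<bar>X s \<omega> - X t \<omega>\<bar> > l} \<le>
      emeasure M {\<omega> \<in> space M. 1 \<le> ennreal (exp (- (p * l))) * ennreal (exp (p * \<bar>X s \<omega> - X t \<omega>\<bar>))}"
  proof (rule emeasure_mono)
    show "{\<omega> \<in> space M. \<bar>X s \<omega> - X t \<omega>\<bar> > l} \<subseteq>
      {\<omega> \<in> space M. 1 \<le> ennreal (exp (- (p * l))) * ennreal (exp (p * \<bar>X s \<omega> - X t \<omega>\<bar>))}"
      using p(1) by (auto simp: ennreal_mult[symmetric] mult_exp_exp ennreal_1[symmetric] simp del: ennreal_1)
  qed measurable
  also have "\<dots> \<le> ennreal (exp (- (p * l))) * (\<integral>\<^sup>+ \<omega>. ennreal (exp (p * \<bar>X s \<omega> - X t \<omega>\<bar>)) * indicator (space M) \<omega> \<partial>M)"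
    using nn_integral_Markov_inequality[of "\<lambda>\<omega>. ennreal (exp (p * \<bar>X s \<omega> - X t \<omega>\<bar>))" "space M" M "ennreal (exp (- (p * l)))"]
    by simp
  also have "(\<integral>\<^sup>+ \<omega>. ennreal (exp (p * \<bar>X s \<omega> - X t \<omega>\<bar>)) * indicator (space M) \<omega> \<partial>M) =
      (\<integral>\<^sup>+ \<omega>. ennreal (exp (p * \<bar>X s \<omega> - X t \<omega>\<bar>)) \<partial>M)"
    by (intro nn_integral_cong) simp
  also have "ennreal (exp (- (p * l))) * \<dots> \<le> ennreal (exp (- (p * l))) * ennreal C0"
    using st p by (intro mult_left_mono exp_increment) auto
  finally show ?thesis
    using C0 by (simp add: emeasure_eq_measure ennreal_mult[symmetric] mult.commute)
qed

text \<open>Serves for continuity in mean: with \<open>p\<close> fixed, both conditions hold once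
  \<open>s\<close> is close to \<open>t\<close>, and \<open>C0 / p\<close> is as small as
  desired.\<close>

lemma mean_increment:
  assumes st: "s \<in> {0..1}" "t \<in> {0..1}" and p: "0 < p" "p * c * g (s - t) \<le> 1/4"
    "p\<^sup>2 * c * (g s + g t) * g (s - t) \<le> 1/4"
  shows "(\<integral>\<^sup>+ \<omega>. ennreal \<bar>X s \<omega> - X t \<omega>\<bar> \<partial>M) \<le> ennreal (C0 / p)"
proof -
  note [measurable] = X_meas[OF st(1)] X_meas[OF st(2)]
  have "(\<integral>\<^sup>+ \<omega>. ennreal \<bar>X s \<omega> - X t \<omega>\<bar> \<partial>M) \<le> (\<integral>\<^sup>+ \<omega>. ennreal (1 / p) * ennreal (exp (p * \<bar>X s \<omega> - X t \<omega>\<bar>)) \<partial>M)"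
  proof (rule nn_integral_mono)
    fix \<omega>
    have "p * \<bar>X s \<omega> - X t \<omega>\<bar> \<le> exp (p * \<bar>X s \<omega> - X t \<omega>\<bar>)"
      using exp_ge_add_one_self[of "p * \<bar>X s \<omega> - X t \<omega>\<bar>"] by linarith
    then have "\<bar>X s \<omega> - X t \<omega>\<bar> \<le> 1 / p * exp (p * \<bar>X s \<omega> - X t \<omega>\<bar>)"
      using p(1) by (simp add: field_simps)
    then show "ennreal \<bar>X s \<omega> - X t \<omega>\<bar> \<le> ennreal (1 / p) * ennreal (exp (p * \<bar>X s \<omega> - X t \<omega>\<bar>))"
      using p(1) by (simp add: ennreal_mult[symmetric] ennreal_leI)
  qed
  also have "\<dots> = ennreal (1 / p) * (\<integral>\<^sup>+ \<omega>. ennreal (exp (p * \<bar>X s \<omega> - X t \<omega>\<bar>)) \<partial>M)"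
    by (rule nn_integral_cmult) measurable
  also have "\<dots> \<le> ennreal (1 / p) * ennreal C0"
    using st p by (intro mult_left_mono exp_increment) auto
  finally show ?thesis using p(1) C0 by (simp add: ennreal_mult[symmetric])
qed

text \<open>A union bound. The grid is left general because it is used on the dyadic points of
  \<open>[0, 1]\<close> and, run backwards, on a block of the iterated logarithm argument.\<close>

lemma grid_tail:
  fixes N :: nat
  assumes t: "\<And>j. j \<le> N \<Longrightarrow> t j \<in> {0..1}" and p: "0 < p"
    and p1: "\<And>j. j < N \<Longrightarrow> p * c * g (t (Suc j) - t j) \<le> 1/4"
    and p2: "\<And>j. j < N \<Longrightarrow> p\<^sup>2 * c * (g (t (Suc j)) + g (t j)) * g (t (Suc j) - t j) \<le> 1/4"
  shows "{\<omega> \<in> space M. \<exists>j<N. \<bar>X (t (Suc j)) \<omega> - X (t j) \<omega>\<bar> > l} \<in> sets M"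
    and "prob {\<omega> \<in> space M. \<exists>j<N. \<bar>X (t (Suc j)) \<omega> - X (t j) \<omega>\<bar> > l} \<le> real N * (C0 * exp (- (p * l)))"
proof -
  have S: "{\<omega> \<in> space M. \<bar>X (t (Suc j)) \<omega> - X (t j) \<omega>\<bar> > l} \<in> sets M" if "j < N" for j
  proof -
    have [measurable]: "X (t j) \<in> borel_measurable M" "X (t (Suc j)) \<in> borel_measurable M"
      by (intro X_meas t; use that in simp)+
    show ?thesis by measurable
  qed
  have eq: "{\<omega> \<in> space M. \<exists>j<N. \<bar>X (t (Suc j)) \<omega> - X (t j) \<omega>\<bar> > l} =
      (\<Union>j\<in>{..<N}. {\<omega> \<in> space M. \<bar>X (t (Suc j)) \<omega> - X (t j) \<omega>\<bar> > l})" by auto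
  show "{\<omega> \<in> space M. \<exists>j<N. \<bar>X (t (Suc j)) \<omega> - X (t j) \<omega>\<bar> > l} \<in> sets M"
    unfolding eq using S by (intro sets.finite_UN) auto
  have "prob {\<omega> \<in> space M. \<exists>j<N. \<bar>X (t (Suc j)) \<omega> - X (t j) \<omega>\<bar> > l} \<le>
      (\<Sum>j<N. prob {\<omega> \<in> space M. \<bar>X (t (Suc j)) \<omega> - X (t j) \<omega>\<bar> > l})"
    unfolding eq using S by (intro finite_measure_subadditive_finite) auto
  also have "\<dots> \<le> (\<Sum>j<N. C0 * exp (- (p * l)))"
  proof (rule sum_mono)
    fix j assume "j \<in> {..<N}"
    then have j: "j < N" "j \<le> N" "Suc j \<le> N" by auto
    show "prob {\<omega> \<in> space M. \<bar>X (t (Suc j)) \<omega> - X (t j) \<omega>\<bar> > l} \<le> C0 * exp (- (p * l))"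
      by (rule increment_tail[OF t[OF j(3)] t[OF j(2)] p p1[OF j(1)] p2[OF j(1)]])
  qed
  finally show "prob {\<omega> \<in> space M. \<exists>j<N. \<bar>X (t (Suc j)) \<omega> - X (t j) \<omega>\<bar> > l} \<le> real N * (C0 * exp (- (p * l)))"
    by simp
qed

text \<open>At level \<open>n\<close> the increments have scale \<open>q ^ n\<close>. With
  \<open>p = \<kappa> / q ^ n\<close> the threshold satisfies \<open>p * lam n = 2 * n\<close>, so
  \<open>2 ^ n\<close> steps fail with probability at most \<open>C0 * (2 * exp (- 2)) ^ n\<close>,
  which is summable.\<close>

lemma dyadic_increments_eventually_small:
  obtains lam where "summable lam"
    "AE \<omega> in M. \<exists>N. \<forall>n\<ge>N. \<forall>j<2 ^ n. \<bar>X (real (Suc j) / 2 ^ n) \<omega> - X (real j / 2 ^ n) \<omega>\<bar> \<le> lam n"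
proof -
  obtain B Cg where B: "1 \<le> B" "\<And>x. x \<in> {0..1} \<Longrightarrow> g x \<le> B"
    and Cg: "1 \<le> Cg" "\<And>n. g (1 / 2 ^ n) \<le> Cg * q ^ (2 * n)"
    by (rule g_power_bound) blast
  \<comment> \<open>Makes \<open>\<kappa> * (c * Cg)\<close> and
    \<open>\<kappa>\<^sup>2 * (c * (2 * B) * Cg)\<close> at most \<open>1/4\<close>, given that
    \<open>c\<close>, \<open>B\<close> and \<open>Cg\<close> are at least \<open>1\<close>.\<close>
  define \<kappa> where "\<kappa> = 1 / (8 * c * B * Cg)"
  have pos: "0 < c" "0 < B" "0 < Cg" "0 < \<kappa>" using B Cg c1 by (auto simp: \<kappa>_def)
  have BC: "1 \<le> c * B * Cg" using B(1) Cg(1) c1 by (metis mult_ge1_I)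
  have k1: "\<kappa> * (c * Cg) \<le> 1/4"
    using pos B(1) by (simp add: \<kappa>_def field_simps)
  have k2: "\<kappa>\<^sup>2 * (c * (2 * B) * Cg) \<le> 1/4"
  proof -
    have "\<kappa>\<^sup>2 * (c * (2 * B) * Cg) = \<kappa> / 4" using pos by (simp add: \<kappa>_def power2_eq_square field_simps)
    moreover have "\<kappa> \<le> 1" using BC pos unfolding \<kappa>_def by (simp add: divide_le_eq mult_ac)
    ultimately show ?thesis by simp
  qed
  define lam where "lam n = q ^ n * (2 * real n) / \<kappa>" for n
  define E where "E n = {\<omega> \<in> space M. \<exists>j<2 ^ n. \<bar>X (real (Suc j) / 2 ^ n) \<omega> - X (real j / 2 ^ n) \<omega>\<bar> > lam n}" for n
  have E: "E n \<in> sets M" "prob (E n) \<le> C0 * (2 * exp (- 2)) ^ n" for n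
  proof -
    let ?p = "\<kappa> / q ^ n"
    have qn: "0 < q ^ n" "q ^ n \<le> 1" "q \<noteq> 0" using q by (auto intro: power_le_one)
    have pp: "0 < ?p" using pos qn by simp
    have d: "real (Suc j) / 2 ^ n - real j / 2 ^ n = 1 / 2 ^ n" for j by (simp add: field_simps)
    have t01: "real j / 2 ^ n \<in> {0..1}" if "j \<le> 2 ^ n" for j using that by (simp add: field_simps)
    have h: "g (1 / 2 ^ n) \<le> Cg * (q ^ n * q ^ n)" using Cg(2)[of n] by (simp add: mult_2 power_add)
    have p1: "?p * c * g (real (Suc j) / 2 ^ n - real j / 2 ^ n) \<le> 1/4" for j
    proof -
      have "?p * c * g (1 / 2 ^ n) \<le> ?p * c * (Cg * (q ^ n * q ^ n))"
        using pos qn h by (intro mult_left_mono) auto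
      also have "\<dots> = \<kappa> * (c * Cg) * q ^ n" using qn by simp
      also have "\<dots> \<le> 1/4 * 1" using k1 qn pos by (intro mult_mono) auto
      finally show ?thesis unfolding d by simp
    qed
    have p2: "?p\<^sup>2 * c * (g (real (Suc j) / 2 ^ n) + g (real j / 2 ^ n)) * g (real (Suc j) / 2 ^ n - real j / 2 ^ n) \<le> 1/4"
      if "j < 2 ^ n" for j
    proof -
      have "g (real (Suc j) / 2 ^ n) + g (real j / 2 ^ n) \<le> 2 * B"
        using B(2)[OF t01[of j]] B(2)[OF t01[of "Suc j"]] that by auto
      then have "?p\<^sup>2 * c * (g (real (Suc j) / 2 ^ n) + g (real j / 2 ^ n)) * g (1 / 2 ^ n) \<le>
          ?p\<^sup>2 * c * (2 * B) * (Cg * (q ^ n * q ^ n))"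
        using pos qn h by (intro mult_mono) auto
      also have "\<dots> = \<kappa>\<^sup>2 * (c * (2 * B) * Cg)" using qn by (simp add: power2_eq_square field_simps)
      also have "\<dots> \<le> 1/4" by (rule k2)
      finally show ?thesis unfolding d .
    qed
    have pl: "?p * lam n = 2 * real n" using qn pos by (simp add: lam_def)
    show "E n \<in> sets M"
      unfolding E_def
      by (rule grid_tail(1)[where N = "2 ^ n" and t = "\<lambda>j. real j / 2 ^ n" and p = ?p, OF t01 pp p1 p2])
    have "prob (E n) \<le> real (2 ^ n) * (C0 * exp (- (?p * lam n)))"
      unfolding E_def
      by (rule grid_tail(2)[where N = "2 ^ n" and t = "\<lambda>j. real j / 2 ^ n" and p = ?p, OF t01 pp p1 p2])
    also have "\<dots> = C0 * (2 * exp (- 2)) ^ n"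
      unfolding pl by (simp add: power_mult_distrib exp_of_nat_mult[symmetric] mult_ac)
    finally show "prob (E n) \<le> C0 * (2 * exp (- 2)) ^ n" .
  qed
  have r: "2 * exp (- 2) < (1::real)"
  proof -
    have "(2::real) < exp 2" using exp_ge_add_one_self[of "2::real"] by simp
    then show ?thesis by (simp add: exp_minus field_simps)
  qed
  have sE: "summable (\<lambda>n. prob (E n))"
  proof (rule summable_comparison_test')
    show "summable (\<lambda>n. C0 * (2 * exp (- 2)) ^ n)" using r by (intro summable_mult summable_geometric) auto
    show "norm (prob (E n)) \<le> C0 * (2 * exp (- 2)) ^ n" if "n \<ge> 0" for n using E(2)[of n] by simp
  qed
  have "AE \<omega> in M. eventually (\<lambda>n. \<omega> \<in> space M - E n) sequentially"
    by (rule borel_cantelli_AE1[OF E(1) _ sE]) (simp add: less_top[symmetric])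
  then have "AE \<omega> in M. \<exists>N. \<forall>n\<ge>N. \<forall>j<2 ^ n. \<bar>X (real (Suc j) / 2 ^ n) \<omega> - X (real j / 2 ^ n) \<omega>\<bar> \<le> lam n"
  proof (eventually_elim)
    case (elim \<omega>)
    then obtain N where N: "\<And>n. n \<ge> N \<Longrightarrow> \<omega> \<in> space M - E n" by (auto simp: eventually_sequentially)
    show ?case
    proof (intro exI[of _ N] allI impI)
      fix n j :: nat assume "n \<ge> N" "j < 2 ^ n"
      then show "\<bar>X (real (Suc j) / 2 ^ n) \<omega> - X (real j / 2 ^ n) \<omega>\<bar> \<le> lam n"
        using N[of n] unfolding E_def by force
    qed
  qed
  moreover have "summable lam"
  proof -
    have "summable (\<lambda>n. q ^ n * real n)"
    proof -
      have "summable (\<lambda>n. real n * q ^ n)"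
      proof -
        have "summable (\<lambda>n. real (Suc n) * q ^ n - q ^ n)"
          using q geometric_deriv_sums[of q] by (intro summable_diff summable_geometric) (auto simp: sums_iff)
        then show ?thesis by (simp add: algebra_simps)
      qed
      then show ?thesis by (simp add: mult.commute)
    qed
    then have "summable (\<lambda>n. (2 / \<kappa>) * (q ^ n * real n))" by (rule summable_mult)
    then show ?thesis by (simp add: lam_def[abs_def] field_simps)
  qed
  ultimately show thesis using that by blast
qed

lemma mean_dyadic_tendsto:
  assumes t: "t \<in> {0..1}" and e: "0 < e"
  shows "eventually (\<lambda>n. (\<integral>\<^sup>+ \<omega>. ennreal \<bar>X (dyadic_floor n t) \<omega> - X t \<omega>\<bar> \<partial>M) \<le> ennreal e) sequentially"
proof -
  \<comment> \<open>Gives \<open>C0 / p \<le> e\<close>; the summand \<open>1\<close> keeps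
    \<open>p\<close> positive when \<open>C0 = 0\<close>.\<close>
  define p where "p = (C0 + 1) / e"
  have p: "0 < p" using C0 e by (simp add: p_def)
  have d: "dyadic_floor n t \<in> {0..1}" for n using dyadic_floor_bounds[of t n] t by auto
  have iso: "isCont g x" for x using g_cont by (simp add: continuous_on_eq_continuous_at)
  have dt: "(\<lambda>n. dyadic_floor n t) \<longlonglongrightarrow> t" using dyadic_floor_tendsto t by simp
  have l1: "(\<lambda>n. g (dyadic_floor n t - t)) \<longlonglongrightarrow> g 0"
    by (rule isCont_tendsto_compose[OF iso]) (use tendsto_diff[OF dt tendsto_const, of t] in simp)
  have l2: "(\<lambda>n. g (dyadic_floor n t)) \<longlonglongrightarrow> g t"
    by (rule isCont_tendsto_compose[OF iso dt])
  have a: "(\<lambda>n. p * c * g (dyadic_floor n t - t)) \<longlonglongrightarrow> p * c * g 0" by (intro tendsto_intros l1)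
  have b: "(\<lambda>n. p\<^sup>2 * c * (g (dyadic_floor n t) + g t) * g (dyadic_floor n t - t)) \<longlonglongrightarrow> p\<^sup>2 * c * (g t + g t) * g 0"
    by (intro tendsto_intros l1 l2)
  have "eventually (\<lambda>n. p * c * g (dyadic_floor n t - t) < 1/4) sequentially"
    using a by (rule order_tendstoD) simp
  moreover have "eventually (\<lambda>n. p\<^sup>2 * c * (g (dyadic_floor n t) + g t) * g (dyadic_floor n t - t) < 1/4) sequentially"
    using b by (rule order_tendstoD) simp
  ultimately show ?thesis
  proof eventually_elim
    case (elim n)
    have "(\<integral>\<^sup>+ \<omega>. ennreal \<bar>X (dyadic_floor n t) \<omega> - X t \<omega>\<bar> \<partial>M) \<le> ennreal (C0 / p)"
      by (rule mean_increment[OF d t p]) (use elim in auto)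
    also have "\<dots> \<le> ennreal e" using C0 e by (intro ennreal_leI) (simp add: p_def field_simps)
    finally show ?case .
  qed
qed

text \<open>On the event where dyadic increments are eventually small, the limit along
  \<open>dyadic_floor\<close> exists and is continuous in \<open>t\<close>. It agrees with
  \<open>X t\<close> almost surely by Fatou's lemma, since \<open>X (dyadic_floor n t)\<close>
  converges to \<open>X t\<close> in mean.\<close>

lemma continuous_version:
  assumes nonneg: "\<And>t \<omega>. t \<in> {0..1} \<Longrightarrow> \<omega> \<in> space M \<Longrightarrow> 0 \<le> X t \<omega>"
  obtains Y where "\<And>t. t \<in> {0..1} \<Longrightarrow> Y t \<in> borel_measurable M"
    "\<And>t. t \<in> {0..1} \<Longrightarrow> AE \<omega> in M. Y t \<omega> = X t \<omega>"
    "\<And>\<omega>. continuous_on {0..1} (\<lambda>t. Y t \<omega>)"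
    "\<And>t \<omega>. t \<in> {0..1} \<Longrightarrow> \<omega> \<in> space M \<Longrightarrow> 0 \<le> Y t \<omega>"
proof -
  obtain lam where lam: "summable lam"
    "AE \<omega> in M. \<exists>N. \<forall>n\<ge>N. \<forall>j<2 ^ n. \<bar>X (real (Suc j) / 2 ^ n) \<omega> - X (real j / 2 ^ n) \<omega>\<bar> \<le> lam n"
    by (rule dyadic_increments_eventually_small)
  define P where "P \<omega> \<longleftrightarrow> (\<exists>N. \<forall>n\<ge>N. \<forall>j<2 ^ n. \<bar>X (real (Suc j) / 2 ^ n) \<omega> - X (real j / 2 ^ n) \<omega>\<bar> \<le> lam n)" for \<omega>
  define G where "G = {\<omega> \<in> space M. P \<omega>}"
  have dy: "dyadic_floor n t \<in> {0..1}" if "t \<in> {0..1}" for n t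
    using dyadic_floor_bounds[of t n] that by auto
  have G: "G \<in> sets M"
  proof -
    have "{\<omega> \<in> space M. \<bar>X (real (Suc j) / 2 ^ n) \<omega> - X (real j / 2 ^ n) \<omega>\<bar> \<le> lam n} \<in> sets M" if "j < 2 ^ n" for n j
    proof -
      have "real (Suc j) \<le> real (2 ^ n)" using that by (simp only: of_nat_le_iff Suc_le_eq)
      then have "real (Suc j) / 2 ^ n \<in> {0..1}" "real j / 2 ^ n \<in> {0..1}" using that by auto
      note [measurable] = X_meas[OF this(1)] X_meas[OF this(2)]
      show ?thesis by measurable
    qed
    then have 1: "{\<omega> \<in> space M. \<forall>j\<in>{..<2 ^ n}. \<bar>X (real (Suc j) / 2 ^ n) \<omega> - X (real j / 2 ^ n) \<omega>\<bar> \<le> lam n} \<in> sets M" for n :: nat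
      by (intro sets.sets_Collect_finite_All') (auto simp del: of_nat_Suc simp: lessThan_empty_iff bot_nat_def)
    have eq: "G = {\<omega> \<in> space M. \<exists>N. \<forall>n. N \<le> n \<longrightarrow> (\<forall>j\<in>{..<2 ^ n}. \<bar>X (real (Suc j) / 2 ^ n) \<omega> - X (real j / 2 ^ n) \<omega>\<bar> \<le> lam n)}"
      by (auto simp: G_def P_def)
    show ?thesis unfolding eq
      by (intro sets.sets_Collect_countable_Ex sets.sets_Collect_countable_All sets.sets_Collect_imp 1) auto
  qed
  have AEG: "AE \<omega> in M. \<omega> \<in> G"
    using lam(2) AE_space by eventually_elim (auto simp: G_def P_def)
  have ex: "\<exists>z. continuous_on {0..1} z \<and> (\<forall>t\<in>{0..1}. (\<lambda>n. X (dyadic_floor n t) \<omega>) \<longlonglongrightarrow> z t)"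
    if w: "\<omega> \<in> G" for \<omega>
  proof -
    obtain N where N: "\<And>n j. n \<ge> N \<Longrightarrow> j < 2 ^ n \<Longrightarrow> \<bar>X (real (Suc j) / 2 ^ n) \<omega> - X (real j / 2 ^ n) \<omega>\<bar> \<le> lam n"
      using w by (auto simp: G_def P_def)
    show ?thesis
    proof (rule dyadic_extension[where y = "\<lambda>t. X t \<omega>", OF lam(1) N])
      fix z :: "real \<Rightarrow> real"
      assume "continuous_on {0..1} z" "\<And>t. t \<in> {0..1} \<Longrightarrow> (\<lambda>n. X (dyadic_floor n t) \<omega>) \<longlonglongrightarrow> z t"
      then show ?thesis by blast
    qed
  qed
  \<comment> \<open>The value \<open>0\<close> off the good event makes every path, and not just
    almost every one, continuous and nonnegative.\<close>
  define Y where "Y t \<omega> = (if \<omega> \<in> G then lim (\<lambda>n. X (dyadic_floor n t) \<omega>) else 0)" for t \<omega>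
  have YG: "(\<lambda>n. X (dyadic_floor n t) \<omega>) \<longlonglongrightarrow> Y t \<omega>" if wt: "\<omega> \<in> G" "t \<in> {0..1}" for t and \<omega>
  proof -
    obtain z where "\<forall>t\<in>{0..1}. (\<lambda>n. X (dyadic_floor n t) \<omega>) \<longlonglongrightarrow> z t"
      using ex wt(1) by blast
    then have "convergent (\<lambda>n. X (dyadic_floor n t) \<omega>)" using wt(2) by (auto simp: convergent_def)
    then show ?thesis using wt(1) by (simp add: Y_def convergent_LIMSEQ_iff)
  qed
  have Ym: "Y t \<in> borel_measurable M" if t: "t \<in> {0..1}" for t
  proof (rule borel_measurable_LIMSEQ_real)
    show "(\<lambda>\<omega>. indicator G \<omega> * X (dyadic_floor n t) \<omega>) \<in> borel_measurable M" for n
      using G X_meas[OF dy[OF t]] by measurable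
    show "(\<lambda>n. indicator G \<omega> * X (dyadic_floor n t) \<omega>) \<longlonglongrightarrow> Y t \<omega>" if "\<omega> \<in> space M" for \<omega>
      using YG[OF _ t, of \<omega>] by (cases "\<omega> \<in> G") (auto simp: Y_def)
  qed
  show thesis
  proof
    show "Y t \<in> borel_measurable M" if "t \<in> {0..1}" for t by (rule Ym[OF that])
    show "AE \<omega> in M. Y t \<omega> = X t \<omega>" if t: "t \<in> {0..1}" for t
    proof -
      note [measurable] = Ym[OF t] X_meas[OF t] X_meas[OF dy[OF t]]
      have bd: "(\<integral>\<^sup>+ \<omega>. ennreal \<bar>Y t \<omega> - X t \<omega>\<bar> \<partial>M) \<le> ennreal e" if e: "0 < e" for e
      proof -
        have "(\<integral>\<^sup>+ \<omega>. ennreal \<bar>Y t \<omega> - X t \<omega>\<bar> \<partial>M) =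
            (\<integral>\<^sup>+ \<omega>. liminf (\<lambda>n. ennreal \<bar>X (dyadic_floor n t) \<omega> - X t \<omega>\<bar>) \<partial>M)"
        proof (rule nn_integral_cong_AE)
          show "AE \<omega> in M. ennreal \<bar>Y t \<omega> - X t \<omega>\<bar> = liminf (\<lambda>n. ennreal \<bar>X (dyadic_floor n t) \<omega> - X t \<omega>\<bar>)"
            using AEG
          proof eventually_elim
            case (elim \<omega>)
            have "(\<lambda>n. ennreal \<bar>X (dyadic_floor n t) \<omega> - X t \<omega>\<bar>) \<longlonglongrightarrow> ennreal \<bar>Y t \<omega> - X t \<omega>\<bar>"
              by (intro tendsto_ennrealI tendsto_intros YG elim t)
            then show ?case by (rule lim_imp_Liminf[OF trivial_limit_sequentially, symmetric])
          qed
        qed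
        also have "\<dots> \<le> liminf (\<lambda>n. \<integral>\<^sup>+ \<omega>. ennreal \<bar>X (dyadic_floor n t) \<omega> - X t \<omega>\<bar> \<partial>M)"
          by (rule nn_integral_liminf) measurable
        also have "\<dots> \<le> limsup (\<lambda>n. \<integral>\<^sup>+ \<omega>. ennreal \<bar>X (dyadic_floor n t) \<omega> - X t \<omega>\<bar> \<partial>M)"
          by (rule Liminf_le_Limsup) simp
        also have "\<dots> \<le> ennreal e"
          by (rule Limsup_bounded) (rule mean_dyadic_tendsto[OF t e])
        finally show ?thesis .
      qed
      have "(\<integral>\<^sup>+ \<omega>. ennreal \<bar>Y t \<omega> - X t \<omega>\<bar> \<partial>M) \<le> 0"
        by (rule ennreal_le_epsilon) (use bd in simp)
      then have "AE \<omega> in M. ennreal \<bar>Y t \<omega> - X t \<omega>\<bar> = 0"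
        by (simp add: nn_integral_0_iff_AE)
      then show ?thesis by (simp add: ennreal_eq_0_iff)
    qed
    show "continuous_on {0..1} (\<lambda>t. Y t \<omega>)" for \<omega>
    proof (cases "\<omega> \<in> G")
      case True
      then obtain z where z: "continuous_on {0..1} z" "\<And>t. t \<in> {0..1} \<Longrightarrow> (\<lambda>n. X (dyadic_floor n t) \<omega>) \<longlonglongrightarrow> z t"
        using ex by blast
      then have "Y t \<omega> = z t" if "t \<in> {0..1}" for t
        using YG[OF True that] that by (intro LIMSEQ_unique) auto
      then show ?thesis using z(1) continuous_on_cong[OF refl, of "{0..1}" "\<lambda>t. Y t \<omega>" z] by blast
    qed (simp add: Y_def)
    show "0 \<le> Y t \<omega>" if "t \<in> {0..1}" "\<omega> \<in> space M" for t \<omega>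
    proof (cases "\<omega> \<in> G")
      case True
      then show ?thesis using that
        by (intro LIMSEQ_le_const[OF YG[OF True that(1)]] exI[of _ 0]) (auto intro!: nonneg dy)
    qed (simp add: Y_def)
  qed
qed

end

section \<open>Law of the iterated logarithm\<close>

text \<open>\<open>Suc k\<close> is the least exponent whose power lies below \<open>t\<close>; the
  hypothesis \<open>t \<le> \<theta> ^ K\<close> puts it beyond \<open>K\<close>.\<close>

lemma geometric_bracket:
  fixes \<theta> t :: real
  assumes th: "0 < \<theta>" "\<theta> < 1" and t: "0 < t" "t \<le> \<theta> ^ K"
  obtains k where "K \<le> k" "\<theta> ^ Suc k < t" "t \<le> \<theta> ^ k"
proof -
  obtain n where n: "\<theta> ^ n < t" using real_arch_pow_inv[OF t(1) th(2)] by blast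
  define k where "k = (LEAST n. \<theta> ^ n < t)"
  have k: "\<theta> ^ k < t" unfolding k_def by (rule LeastI[of "\<lambda>n. \<theta> ^ n < t", OF n])
  have "k > K"
  proof (rule ccontr)
    assume "\<not> k > K"
    then have "\<theta> ^ K \<le> \<theta> ^ k" using th by (intro power_decreasing) auto
    then show False using k t by simp
  qed
  then obtain k' where k': "k = Suc k'" by (cases k) auto
  have "\<not> \<theta> ^ k' < t" using not_less_Least[of k' "\<lambda>n. \<theta> ^ n < t"] k' by (simp add: k_def[symmetric])
  then show thesis using k k' \<open>k > K\<close> by (intro that[of k']) auto
qed

context exp_increments
begin

text \<open>Chaining inside the block \<open>[s - s / 2 ^ m, s]\<close>. There \<open>g\<close> is
  at most \<open>K * g s\<close>, and a step of level \<open>n\<close> has length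
  \<open>s / 2 ^ (n + m)\<close>, so the admissible \<open>p\<close> is
  \<open>\<kappa> / (g s * q ^ (n + m))\<close>. The threshold is \<open>2 * l + 2 * n\<close> in
  units of \<open>1 / p\<close>: the part \<open>exp (- 2 * n)\<close> beats the number of steps,
  the part \<open>exp (- 2 * l)\<close> remains for the sum over blocks.\<close>

lemma oscillation_bound:
  fixes m :: nat
  defines "K \<equiv> 1 / (1 - q\<^sup>2)"
  defines "\<kappa> \<equiv> 1 / (8 * c * K)"
  defines "lam S l n \<equiv> S * q ^ m * (q ^ n * (2 * l + 2 * real n)) / \<kappa>"
  assumes s: "0 < s" "s \<le> x0"
  defines "F l n \<equiv> {\<omega> \<in> space M. \<exists>j<2 ^ n. \<bar>X (s - real (Suc j) / 2 ^ n * (s / 2 ^ m)) \<omega>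
      - X (s - real j / 2 ^ n * (s / 2 ^ m)) \<omega>\<bar> > lam (g s) l n}"
  shows "F l n \<in> sets M"
    and "prob (F l n) \<le> C0 * exp (- 2 * l) * (2 * exp (- 2)) ^ n"
proof -
  define S where "S = g s"
  define p where "p = \<kappa> / (S * q ^ (n + m))"
  \<comment> \<open>The grid runs leftwards, so that chains start at \<open>s\<close>, the point
    whose one-point tail will be controlled.\<close>
  define t where "t j = s - real j / 2 ^ n * (s / 2 ^ m)" for j :: nat
  have q2: "0 \<le> q\<^sup>2" "q\<^sup>2 < 1" using q by (simp_all add: power_less_one_iff)
  have K: "1 \<le> K" using q2 by (simp add: K_def)
  have pos: "0 < c" "0 < K" "0 < \<kappa>" "0 < S" using K c1 s g_pos by (auto simp: \<kappa>_def S_def)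
  have cK: "1 \<le> c * K" using K c1 by (metis mult_ge1_I)
  have k1: "\<kappa> * c \<le> 1/4" using pos K by (simp add: \<kappa>_def field_simps)
  have k2: "\<kappa>\<^sup>2 * (c * (2 * K)) \<le> 1/4"
  proof -
    have "\<kappa>\<^sup>2 * (c * (2 * K)) = \<kappa> / 4" using pos by (simp add: \<kappa>_def power2_eq_square field_simps)
    moreover have "\<kappa> \<le> 1" using cK pos unfolding \<kappa>_def by (simp add: divide_le_eq mult_ac)
    ultimately show ?thesis by simp
  qed
  have qn: "0 < q ^ (n + m)" "q ^ (n + m) \<le> 1" "q \<noteq> 0" using q by (auto intro: power_le_one)
  have pp: "0 < p" using pos qn by (simp add: p_def)
  have pS: "p * (S * q ^ (n + m)) = \<kappa>" using qn(1) pos(4) by (simp add: p_def del: power_eq_0_iff)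
  have d: "\<bar>t (Suc j) - t j\<bar> = s / 2 ^ (n + m)" for j
    using s by (simp add: t_def power_add field_simps abs_if)
  have gd: "g (t (Suc j) - t j) = g (s / 2 ^ (n + m))" for j
    using d[of j] g_even[of "t (Suc j) - t j"] by (auto simp: abs_if split: if_splits)
  have h: "g (s / 2 ^ (n + m)) \<le> q ^ (n + m) * q ^ (n + m) * S"
  proof -
    have "q ^ (2 * (n + m)) = q ^ (n + m) * q ^ (n + m)" by (simp only: mult_2 power_add)
    then show ?thesis using g_half_iterate[OF s, of "n + m"] by (simp only: S_def)
  qed
  have ts: "t j \<in> {0..s}" if "j \<le> 2 ^ n" for j
  proof -
    have "real j / 2 ^ n \<le> 1" using that by (simp add: field_simps)
    moreover have "s / 2 ^ m \<le> s" using s by (simp add: field_simps)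
    ultimately have "real j / 2 ^ n * (s / 2 ^ m) \<le> 1 * s" using s by (intro mult_mono) auto
    then show ?thesis using s by (simp add: t_def)
  qed
  have t01: "t j \<in> {0..1}" if "j \<le> 2 ^ n" for j using ts[OF that] s x0 by auto
  have gt: "g (t j) \<le> K * S" if "j \<le> 2 ^ n" for j
    using g_le_endpoint[OF s, of "t j"] ts[OF that] by (simp add: K_def S_def)
  have p1: "p * c * g (t (Suc j) - t j) \<le> 1/4" for j
  proof -
    have "p * c * g (t (Suc j) - t j) \<le> p * c * (q ^ (n + m) * q ^ (n + m) * S)"
      unfolding gd using pp pos h by (intro mult_left_mono) auto
    also have "\<dots> = \<kappa> * c * q ^ (n + m)" using pos qn by (simp add: p_def)
    also have "\<dots> \<le> 1/4 * 1" using k1 qn pos by (intro mult_mono) auto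
    finally show ?thesis by simp
  qed
  have p2: "p\<^sup>2 * c * (g (t (Suc j)) + g (t j)) * g (t (Suc j) - t j) \<le> 1/4" if "j < 2 ^ n" for j
  proof -
    have "g (t (Suc j)) + g (t j) \<le> 2 * K * S"
      using gt[of j] gt[of "Suc j"] that by auto
    then have "p\<^sup>2 * c * (g (t (Suc j)) + g (t j)) * g (t (Suc j) - t j) \<le>
        p\<^sup>2 * c * (2 * K * S) * (q ^ (n + m) * q ^ (n + m) * S)"
      unfolding gd using pp pos qn h by (intro mult_mono) auto
    also have "\<dots> = (p * (S * q ^ (n + m)))\<^sup>2 * (c * (2 * K))"
      by (simp only: power2_eq_square mult_ac)
    also have "\<dots> = \<kappa>\<^sup>2 * (c * (2 * K))" by (simp only: pS)
    also have "\<dots> \<le> 1/4" by (rule k2)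
    finally show ?thesis .
  qed
  have pl: "p * lam S l n = 2 * l + 2 * real n"
    using qn pos by (simp add: lam_def p_def power_add)
  have F: "F l n = {\<omega> \<in> space M. \<exists>j<2 ^ n. \<bar>X (t (Suc j)) \<omega> - X (t j) \<omega>\<bar> > lam S l n}"
    by (simp only: F_def t_def S_def)
  show "F l n \<in> sets M"
    unfolding F by (rule grid_tail(1)[where N = "2 ^ n" and t = t and p = p, OF t01 pp p1 p2])
  have "prob (F l n) \<le> real (2 ^ n) * (C0 * exp (- (p * lam S l n)))"
    unfolding F by (rule grid_tail(2)[where N = "2 ^ n" and t = t and p = p, OF t01 pp p1 p2])
  also have "\<dots> = C0 * exp (- 2 * l) * (2 * exp (- 2)) ^ n"
    unfolding pl by (simp add: power_mult_distrib exp_of_nat_mult[symmetric] mult_exp_exp mult_ac)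
  finally show "prob (F l n) \<le> C0 * exp (- 2 * l) * (2 * exp (- 2)) ^ n" .
qed

text \<open>\<open>A\<close> is the diagonal of the kernel. At \<open>s k = \<theta> ^ k\<close> the
  iterated logarithm is \<open>l k = ln (k * b)\<close>, so exponential tails in \<open>l k\<close>
  are powers of \<open>k\<close>. The one-point bound at \<open>s k\<close>, the oscillation on the
  block and the change of \<open>A\<close> across the block are each given an error
  \<open>\<epsilon> / 4\<close>.\<close>

lemma lil_fixed:
  assumes cont: "\<And>\<omega>. \<omega> \<in> space M \<Longrightarrow> continuous_on {0..1} (\<lambda>t. X t \<omega>)"
    and A_lower: "\<And>t. t \<in> {0..1} \<Longrightarrow> g t \<le> A t"
    and A_diff: "\<And>s t. s \<in> {0..1} \<Longrightarrow> t \<in> {0..1} \<Longrightarrow> \<bar>A s - A t\<bar> \<le> c * g (s - t)"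
    and mgf: "\<And>t p d. t \<in> {0..1} \<Longrightarrow> 0 \<le> p \<Longrightarrow> 0 < d \<Longrightarrow> p * A t \<le> 1 - d \<Longrightarrow>
      (\<integral>\<^sup>+ \<omega>. ennreal (exp (p * X t \<omega>)) \<partial>M) \<le> ennreal (D d)"
    and D: "\<And>d. 0 \<le> D d"
    and \<epsilon>: "0 < \<epsilon>" "\<epsilon> \<le> 1"
  shows "AE \<omega> in M. eventually (\<lambda>t. X t \<omega> \<le> (1 + \<epsilon>) * A t * ln (ln (1 / t))) (at_right 0)"
proof -
  define K where "K = 1 / (1 - q\<^sup>2)"
  define \<kappa> where "\<kappa> = 1 / (8 * c * K)"
  \<comment> \<open>Factor left by summing the thresholds of one block: as \<open>l \<ge> 1\<close>,
    \<open>2 * l + 2 * n \<le> 2 * l * (n + 1)\<close>, and the sum of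
    \<open>(n + 1) * q ^ n\<close> is \<open>1 / (1 - q)\<^sup>2\<close>.\<close>
  define Q where "Q = 2 / (\<kappa> * (1 - q)\<^sup>2)"
  have q2: "0 \<le> q\<^sup>2" "q\<^sup>2 < 1" using q by (simp_all add: power_less_one_iff)
  have K: "1 \<le> K" using q2 by (simp add: K_def)
  have pos: "0 < c" "0 < K" "0 < \<kappa>" "0 < Q" using K c1 q by (auto simp: \<kappa>_def Q_def)
  obtain m0 where m0: "q ^ m0 < \<epsilon> / (4 * (Q + c * K))"
    using real_arch_pow_inv[of "\<epsilon> / (4 * (Q + c * K))" q] q \<epsilon> pos by (auto simp: add_pos_pos)
  \<comment> \<open>The successor ensures \<open>m \<ge> 1\<close>, without which
    \<open>\<theta>\<close> would be \<open>0\<close>.\<close>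
  define m where "m = Suc m0"
  have qm: "0 < q ^ m" "q ^ m \<le> 1" using q by (auto intro: power_le_one)
  have qmS: "q ^ m * (Q + c * K) \<le> \<epsilon> / 4"
  proof -
    have "q ^ m \<le> q ^ m0" unfolding m_def using q by (intro power_decreasing) auto
    then have "q ^ m \<le> \<epsilon> / (4 * (Q + c * K))" using m0 by simp
    then show ?thesis using pos by (simp add: field_simps add_pos_pos)
  qed
  have qmQ: "q ^ m * Q \<le> \<epsilon> / 4" and qmK: "q ^ m * (c * K) \<le> \<epsilon> / 4"
  proof -
    have "0 < q ^ m * Q" "0 < q ^ m * (c * K)" using qm pos by auto
    then show "q ^ m * Q \<le> \<epsilon> / 4" "q ^ m * (c * K) \<le> \<epsilon> / 4"
      using qmS unfolding distrib_left by linarith+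
  qed
  define \<theta> :: real where "\<theta> = 1 - 1 / 2 ^ m"
  have "(1::real) < 2 ^ m" unfolding m_def by (intro one_less_power) auto
  then have "1 / 2 ^ m < (1::real)" by simp
  then have th: "0 < \<theta>" "\<theta> < 1" by (auto simp: \<theta>_def)
  define b where "b = ln (1 / \<theta>)"
  have b: "0 < b" using th by (simp add: b_def)
  define s where "s k = \<theta> ^ k" for k
  define l where "l k = ln (real k * b)" for k
  have spos: "0 < s k" for k using th by (simp add: s_def)
  have lns: "ln (1 / s k) = real k * b" for k
    using th by (simp add: s_def b_def ln_div ln_realpow)
  have sdec: "s k \<le> s k'" if "k' \<le> k" for k k' using th that unfolding s_def by (intro power_decreasing) auto
  have "(\<lambda>k. s k) \<longlonglongrightarrow> 0" unfolding s_def using th by (intro LIMSEQ_realpow_zero) auto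
  then have e1: "eventually (\<lambda>k. s k < x0) sequentially" using x0 by (intro order_tendstoD) auto
  have "filterlim (\<lambda>k. real k * b) at_top sequentially" using b by real_asymp
  then have e2: "eventually (\<lambda>k. exp 1 \<le> real k * b) sequentially" by (simp add: filterlim_at_top)
  obtain k1 where k1: "\<And>k. k \<ge> k1 \<Longrightarrow> s k \<le> x0" "\<And>k. k \<ge> k1 \<Longrightarrow> exp 1 \<le> real k * b"
  proof -
    obtain N where "\<forall>k\<ge>N. s k < x0 \<and> exp 1 \<le> real k * b"
      using eventually_conj[OF e1 e2] unfolding eventually_sequentially by blast
    then show thesis by (intro that[of N]) (auto simp: less_imp_le)
  qed
  have kb: "0 < real k * b" if "k \<ge> k1" for k using k1(2)[OF that] exp_gt_zero[of "1::real"] by linarith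
  have l1: "1 \<le> l k" if "k \<ge> k1" for k
    using k1(2)[OF that] kb[OF that] unfolding l_def by (subst ln_ge_iff) auto
  have s01: "s k \<in> {0..1}" if "k \<ge> k1" for k using k1(1)[OF that] spos[of k] x0 by auto
  have Spos: "0 < g (s k)" if "k \<ge> k1" for k using k1(1)[OF that] spos[of k] g_pos by auto
  have Apos: "0 < A (s k)" if "k \<ge> k1" for k using Spos[OF that] A_lower[OF s01[OF that]] by linarith
  define lam where "lam k n = g (s k) * q ^ m * (q ^ n * (2 * l k + 2 * real n)) / \<kappa>" for k n
  define F where "F k n = {\<omega> \<in> space M. \<exists>j<2 ^ n. \<bar>X (s k - real (Suc j) / 2 ^ n * (s k / 2 ^ m)) \<omega>
      - X (s k - real j / 2 ^ n * (s k / 2 ^ m)) \<omega>\<bar> > lam k n}" for k n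
  have F: "F k n \<in> sets M" "prob (F k n) \<le> C0 * exp (- 2 * l k) * (2 * exp (- 2)) ^ n"
    if "k \<ge> k1" for k n
    unfolding F_def lam_def \<kappa>_def K_def by (rule oscillation_bound[OF spos k1(1)[OF that]])+
  define G where "G k = {\<omega> \<in> space M. X (s k) \<omega> > (1 + \<epsilon> / 4) * A (s k) * l k}" for k
  \<comment> \<open>\<open>- (1 + \<eta>)\<close> is the power of \<open>k\<close> finally obtained.
    The exponent used is \<open>1 - d\<close> times the critical value \<open>1 / A (s k)\<close>,
    and for \<open>\<epsilon> \<le> 1\<close> this loss still leaves
    \<open>(1 - d) * (1 + \<epsilon> / 4) \<ge> 1 + \<eta>\<close>.\<close>
  define \<eta> where "\<eta> = \<epsilon> / 8"
  define d where "d = \<epsilon> / 16"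
  have dd: "0 < d" "d < 1" "1 + \<eta> \<le> (1 - d) * (1 + \<epsilon> / 4)"
  proof -
    have "\<epsilon> * \<epsilon> \<le> \<epsilon> * 1" using \<epsilon> by (intro mult_left_mono) auto
    moreover have "(1 - d) * (1 + \<epsilon> / 4) = 1 + 3 * \<epsilon> / 16 - \<epsilon> * \<epsilon> / 64" by (simp add: d_def field_simps)
    ultimately show "1 + \<eta> \<le> (1 - d) * (1 + \<epsilon> / 4)" using \<epsilon> unfolding \<eta>_def by linarith
  qed (use \<epsilon> in \<open>auto simp: d_def\<close>)
  have G: "G k \<in> sets M" "prob (G k) \<le> D d * exp (- (1 + \<eta>) * l k)" if k: "k \<ge> k1" for k
  proof -
    note [measurable] = X_meas[OF s01[OF k]]
    show "G k \<in> sets M" unfolding G_def by measurable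
    define p where "p = (1 - d) / A (s k)"
    have p: "0 < p" using Apos[OF k] dd by (simp add: p_def)
    define a where "a = (1 + \<epsilon> / 4) * A (s k) * l k"
    have "emeasure M (G k) \<le>
        emeasure M {\<omega> \<in> space M. 1 \<le> ennreal (exp (- (p * a))) * ennreal (exp (p * X (s k) \<omega>))}"
    proof (rule emeasure_mono)
      show "G k \<subseteq> {\<omega> \<in> space M. 1 \<le> ennreal (exp (- (p * a))) * ennreal (exp (p * X (s k) \<omega>))}"
        using p by (auto simp: G_def a_def[symmetric] ennreal_mult[symmetric] mult_exp_exp ennreal_1[symmetric] simp del: ennreal_1)
    qed measurable
    also have "\<dots> \<le> ennreal (exp (- (p * a))) * (\<integral>\<^sup>+ \<omega>. ennreal (exp (p * X (s k) \<omega>)) * indicator (space M) \<omega> \<partial>M)"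
      using nn_integral_Markov_inequality[of "\<lambda>\<omega>. ennreal (exp (p * X (s k) \<omega>))" "space M" M "ennreal (exp (- (p * a)))"]
      by simp
    also have "(\<integral>\<^sup>+ \<omega>. ennreal (exp (p * X (s k) \<omega>)) * indicator (space M) \<omega> \<partial>M) =
        (\<integral>\<^sup>+ \<omega>. ennreal (exp (p * X (s k) \<omega>)) \<partial>M)"
      by (intro nn_integral_cong) simp
    also have "ennreal (exp (- (p * a))) * \<dots> \<le> ennreal (exp (- (p * a))) * ennreal (D d)"
      using s01[OF k] p dd Apos[OF k] by (intro mult_left_mono mgf) (auto simp: p_def)
    also have "\<dots> = ennreal (D d * exp (- (p * a)))"
      using D by (simp add: ennreal_mult[symmetric] mult.commute)
    finally have 1: "prob (G k) \<le> D d * exp (- (p * a))"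
      using D by (simp add: emeasure_eq_measure)
    have "p * a = (1 - d) * (1 + \<epsilon> / 4) * l k" using Apos[OF k] by (simp add: p_def a_def)
    then have "(1 + \<eta>) * l k \<le> p * a" using dd(3) l1[OF k] by simp
    then have "exp (- (p * a)) \<le> exp (- (1 + \<eta>) * l k)"
      by (simp only: exp_le_cancel_iff minus_mult_left[symmetric] neg_le_iff_le)
    then show "prob (G k) \<le> D d * exp (- (1 + \<eta>) * l k)"
      using 1 D by (meson mult_left_mono order_trans)
  qed
  have r: "2 * exp (- 2) < (1::real)"
  proof -
    have "(2::real) < exp 2" using exp_ge_add_one_self[of "2::real"] by simp
    then show ?thesis by (simp add: exp_minus field_simps)
  qed
  define R where "R = 1 / (1 - 2 * exp (- 2 :: real))"
  have R: "0 \<le> R" using r by (simp add: R_def)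
  \<comment> \<open>Empty below \<open>k1\<close>, where the estimates are not claimed;
    Borel-Cantelli is indifferent to finitely many indices.\<close>
  define E where "E k = (if k \<ge> k1 then (\<Union>n. F k n) \<union> G k else {})" for k
  have E: "E k \<in> sets M" "norm (prob (E k)) \<le> (C0 * R + D d) * b powr (- (1 + \<eta>)) * real k powr (- (1 + \<eta>))" for k
  proof -
    have rhs: "0 \<le> (C0 * R + D d) * b powr (- (1 + \<eta>)) * real k powr (- (1 + \<eta>))"
      using C0 R D by simp
    show "E k \<in> sets M" using F(1) G(1) by (auto simp: E_def)
    show "norm (prob (E k)) \<le> (C0 * R + D d) * b powr (- (1 + \<eta>)) * real k powr (- (1 + \<eta>))"
    proof (cases "k \<ge> k1")
      case k: True
      have sm: "summable (\<lambda>n. C0 * exp (- 2 * l k) * (2 * exp (- 2)) ^ n)"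
        using r by (intro summable_mult summable_geometric) auto
      have smF: "summable (\<lambda>n. prob (F k n))"
        using F(2)[OF k] by (intro summable_comparison_test'[OF sm, of 0]) auto
      have "prob (\<Union>n. F k n) \<le> (\<Sum>n. prob (F k n))"
        using F(1)[OF k] smF by (intro finite_measure_subadditive_countably) auto
      also have "\<dots> \<le> (\<Sum>n. C0 * exp (- 2 * l k) * (2 * exp (- 2)) ^ n)"
        by (intro suminf_le F(2)[OF k] smF sm)
      also have "\<dots> = C0 * exp (- 2 * l k) * R"
        using r by (subst suminf_mult) (auto simp: suminf_geometric R_def intro!: summable_geometric)
      also have "\<dots> \<le> C0 * exp (- (1 + \<eta>) * l k) * R"
      proof -
        have "- 2 * l k \<le> - (1 + \<eta>) * l k"
          using l1[OF k] \<epsilon> unfolding \<eta>_def by (intro mult_right_mono) auto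
        then show ?thesis using C0 R by (intro mult_right_mono mult_left_mono) auto
      qed
      finally have 1: "prob (\<Union>n. F k n) \<le> C0 * exp (- (1 + \<eta>) * l k) * R" .
      have "prob (E k) \<le> prob (\<Union>n. F k n) + prob (G k)"
        using k F(1)[OF k] G(1)[OF k] by (auto simp: E_def intro!: measure_Un_le)
      also have "\<dots> \<le> (C0 * R + D d) * exp (- (1 + \<eta>) * l k)"
        using 1 G(2)[OF k] by (simp add: algebra_simps)
      also have "exp (- (1 + \<eta>) * l k) = (real k * b) powr (- (1 + \<eta>))"
        using kb[OF k] b by (cases "k = 0") (auto simp: powr_def l_def)
      also have "\<dots> = b powr (- (1 + \<eta>)) * real k powr (- (1 + \<eta>))"
        using b by (simp add: powr_mult)
      finally show ?thesis by (simp add: mult.assoc)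
    qed (use rhs in \<open>simp add: E_def\<close>)
  qed
  have sE: "summable (\<lambda>k. prob (E k))"
  proof (rule summable_comparison_test')
    have "summable (\<lambda>k. real k powr (- (1 + \<eta>)))"
      using \<epsilon> by (subst summable_real_powr_iff) (simp add: \<eta>_def)
    then show "summable (\<lambda>k. (C0 * R + D d) * b powr (- (1 + \<eta>)) * real k powr (- (1 + \<eta>)))"
      by (rule summable_mult)
  qed (rule E(2))
  have "AE \<omega> in M. eventually (\<lambda>k. \<omega> \<in> space M - E k) sequentially"
    by (rule borel_cantelli_AE1[OF E(1) _ sE]) (simp add: less_top[symmetric])
  then show ?thesis
  proof eventually_elim
    case (elim \<omega>)
    then obtain k2 where k2: "\<And>k. k \<ge> k2 \<Longrightarrow> \<omega> \<in> space M - E k" by (auto simp: eventually_sequentially)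
    define k0 where "k0 = max k1 k2"
    have w: "\<omega> \<in> space M" using k2[of k2] by simp
    have bd: "X t \<omega> \<le> (1 + \<epsilon>) * A t * ln (ln (1 / t))" if t: "0 < t" "t < s k0" for t
    proof -
      obtain k where k: "k0 \<le> k" "s (Suc k) < t" "t \<le> s k"
        using geometric_bracket[OF th t(1), of k0] t(2) unfolding s_def by (metis less_imp_le)
      have kk: "k \<ge> k1" "k \<ge> k2" using k by (auto simp: k0_def)
      have nF: "\<omega> \<notin> F k n" for n using k2[OF kk(2)] kk(1) by (auto simp: E_def)
      have nG: "\<omega> \<notin> G k" using k2[OF kk(2)] kk(1) by (auto simp: E_def)
      \<comment> \<open>Length of the block:
        \<open>s k - s (Suc k) = (1 - \<theta>) * s k = L\<close>, so the oscillation bound covers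
        exactly \<open>[s (Suc k), s k]\<close>.\<close>
      define L where "L = s k / 2 ^ m"
      have L: "0 < L" "L \<le> s k" using spos[of k] by (auto simp: L_def field_simps)
      have sL: "s k - s (Suc k) = L" by (simp add: s_def \<theta>_def L_def algebra_simps)
      define u where "u = (s k - t) / L"
      have u: "u \<in> {0..1}" using k sL L by (simp add: u_def field_simps)
      have tu: "t = s k - u * L" using L by (simp add: u_def)
      have in01: "s k - v * L \<in> {0..1}" if "v \<in> {0..1}" for v
      proof -
        have "v * L \<le> 1 * L" using that L by (intro mult_right_mono) auto
        moreover have "0 \<le> v * L" using that L by simp
        ultimately show ?thesis using L s01[OF kk(1)] unfolding atLeastAtMost_iff by linarith
      qed
      have t01: "t \<in> {0..1}" using in01[OF u] tu by simp
      have osc: "X (s k - u * L) \<omega> - X (s k) \<omega> \<le> g (s k) * q ^ m * Q * l k"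
      proof (rule dyadic_dense_bound[where f = "\<lambda>u. X (s k - u * L) \<omega> - X (s k) \<omega>", OF _ _ u])
        show "continuous_on {0..1} (\<lambda>u. X (s k - u * L) \<omega> - X (s k) \<omega>)"
          using in01 by (intro continuous_on_diff continuous_on_const continuous_on_compose2[OF cont[OF w]] continuous_intros) auto
        fix n j :: nat assume j: "j \<le> 2 ^ n"
        have "\<bar>X (s k - real j / 2 ^ n * L) \<omega> - X (s k - 0 * L) \<omega>\<bar> \<le> (\<Sum>i\<le>n. lam k i)"
        proof (rule dyadic_chain[where y = "\<lambda>u. X (s k - u * L) \<omega>", OF _ j])
          fix i j :: nat assume "j < 2 ^ i"
          then show "\<bar>X (s k - real (Suc j) / 2 ^ i * L) \<omega> - X (s k - real j / 2 ^ i * L) \<omega>\<bar> \<le> lam k i"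
            using nF[of i] w unfolding F_def L_def mem_Collect_eq not_less[symmetric] by blast
        qed
        also have "\<dots> \<le> (\<Sum>i\<le>n. (2 * g (s k) * q ^ m * l k / \<kappa>) * (real (Suc i) * q ^ i))"
        proof (rule sum_mono)
          fix i
          have "2 * l k + 2 * real i \<le> 2 * (l k * real (Suc i))"
            using mult_right_mono[OF l1[OF kk(1)], of "real i"] by (simp add: algebra_simps)
          then have "lam k i \<le> g (s k) * q ^ m * (q ^ i * (2 * (l k * real (Suc i)))) / \<kappa>"
            unfolding lam_def using q pos by (intro divide_right_mono mult_left_mono) auto
          then show "lam k i \<le> (2 * g (s k) * q ^ m * l k / \<kappa>) * (real (Suc i) * q ^ i)"
            by (simp only: mult_ac times_divide_eq_left times_divide_eq_right)
        qed
        also have "\<dots> = (2 * g (s k) * q ^ m * l k / \<kappa>) * (\<Sum>i\<le>n. real (Suc i) * q ^ i)"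
          by (rule sum_distrib_left[symmetric])
        also have "\<dots> \<le> (2 * g (s k) * q ^ m * l k / \<kappa>) * (1 / (1 - q)\<^sup>2)"
        proof (rule mult_left_mono)
          have gs: "(\<lambda>i. real (Suc i) * q ^ i) sums (1 / (1 - q)\<^sup>2)"
            using geometric_deriv_sums[of q] q by simp
          have "(\<Sum>i<Suc n. real (Suc i) * q ^ i) \<le> (\<Sum>i. real (Suc i) * q ^ i)"
            using gs q by (intro sum_le_suminf) (auto simp: sums_iff)
          then show "(\<Sum>i\<le>n. real (Suc i) * q ^ i) \<le> 1 / (1 - q)\<^sup>2"
            using gs by (simp only: lessThan_Suc_atMost sums_iff)
          show "0 \<le> 2 * g (s k) * q ^ m * l k / \<kappa>" using q pos l1[OF kk(1)] by auto
        qed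
        also have "\<dots> = g (s k) * q ^ m * Q * l k" by (simp add: Q_def)
        finally show "X (s k - real j / 2 ^ n * L) \<omega> - X (s k) \<omega> \<le> g (s k) * q ^ m * Q * l k" by simp
      qed
      have lk: "1 \<le> l k" by (rule l1[OF kk(1)])
      have "g (s k) * (q ^ m * Q) * l k \<le> A (s k) * (\<epsilon> / 4) * l k"
        using A_lower[OF s01[OF kk(1)]] qmQ qm pos lk Apos[OF kk(1)] by (intro mult_right_mono mult_mono) auto
      moreover have "X (s k) \<omega> \<le> (1 + \<epsilon> / 4) * A (s k) * l k"
        using nG w by (simp add: G_def not_less)
      ultimately have X1: "X t \<omega> \<le> (1 + \<epsilon> / 2) * A (s k) * l k"
        using osc[folded tu] by (simp add: algebra_simps)
      have "c * g (s k - t) \<le> \<epsilon> / 4 * A (s k)"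
      proof -
        have "g (s k - t) \<le> g L / (1 - q\<^sup>2)"
          using k sL L k1(1)[OF kk(1)] by (intro g_le_endpoint) auto
        also have "\<dots> = K * g L" by (simp add: K_def)
        also have "\<dots> \<le> K * (q ^ (2 * m) * g (s k))"
          using g_half_iterate[OF spos k1(1)[OF kk(1)], of m] pos by (intro mult_left_mono) (auto simp: L_def)
        also have "\<dots> \<le> K * (q ^ m * A (s k))"
          using A_lower[OF s01[OF kk(1)]] pos q by (intro mult_left_mono mult_mono power_decreasing) auto
        finally have "c * g (s k - t) \<le> c * (K * (q ^ m * A (s k)))" using pos by simp
        also have "\<dots> = (q ^ m * (c * K)) * A (s k)" by simp
        also have "\<dots> \<le> \<epsilon> / 4 * A (s k)" using qmK Apos[OF kk(1)] by (intro mult_right_mono) auto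
        finally show ?thesis .
      qed
      then have At: "(1 - \<epsilon> / 4) * A (s k) \<le> A t"
        using A_diff[OF s01[OF kk(1)] t01] by (simp add: algebra_simps abs_le_iff)
      \<comment> \<open>Replacing \<open>A (s k)\<close> by \<open>A t\<close> uses up the other
        half of \<open>\<epsilon>\<close>.\<close>
      have "(1 + \<epsilon> / 2) \<le> (1 + \<epsilon>) * (1 - \<epsilon> / 4)"
      proof -
        have "\<epsilon> * \<epsilon> \<le> \<epsilon> * 1" using \<epsilon> by (intro mult_left_mono) auto
        moreover have "(1 + \<epsilon>) * (1 - \<epsilon> / 4) = 1 + 3 * \<epsilon> / 4 - \<epsilon> * \<epsilon> / 4" by (simp add: field_simps)
        ultimately show ?thesis using \<epsilon> by linarith
      qed
      then have "(1 + \<epsilon> / 2) * A (s k) \<le> (1 + \<epsilon>) * (1 - \<epsilon> / 4) * A (s k)"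
        using Apos[OF kk(1)] by (intro mult_right_mono) auto
      also have "\<dots> \<le> (1 + \<epsilon>) * A t" using At \<epsilon> by (simp add: mult.assoc)
      finally have X2: "(1 + \<epsilon> / 2) * A (s k) \<le> (1 + \<epsilon>) * A t" .
      have lt: "l k \<le> ln (ln (1 / t))"
      proof -
        have "ln (1 / s k) \<le> ln (1 / t)" using k t spos[of k] by (intro ln_mono) (auto simp: field_simps)
        then have "ln (ln (1 / s k)) \<le> ln (ln (1 / t))" using kb[OF kk(1)] by (subst ln_le_cancel_iff) (auto simp: lns)
        then show ?thesis by (simp add: lns l_def)
      qed
      have "0 \<le> A t" using A_lower[OF t01] g_nonneg[of t] by linarith
      then have "(1 + \<epsilon> / 2) * A (s k) * l k \<le> (1 + \<epsilon>) * A t * ln (ln (1 / t))"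
        using lk \<epsilon> by (intro mult_mono[OF X2 lt]) auto
      then show ?thesis using X1 by linarith
    qed
    show ?case
      unfolding eventually_at_right_field using bd spos[of k0] by (intro exI[of _ "s k0"]) auto
  qed
qed

text \<open>The normalisation \<open>a\<close> is kept apart from the diagonal \<open>A\<close>, so
  that one statement serves both \<open>a = g\<close> and \<open>a t = C * t\<close>. A single null
  set suffices because \<open>\<epsilon>\<close> runs through the values
  \<open>1 / real (Suc n)\<close>.\<close>

lemma lil:
  assumes cont: "\<And>\<omega>. \<omega> \<in> space M \<Longrightarrow> continuous_on {0..1} (\<lambda>t. X t \<omega>)"
    and A_lower: "\<And>t. t \<in> {0..1} \<Longrightarrow> g t \<le> A t"
    and A_diff: "\<And>s t. s \<in> {0..1} \<Longrightarrow> t \<in> {0..1} \<Longrightarrow> \<bar>A s - A t\<bar> \<le> c * g (s - t)"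
    and mgf: "\<And>t p d. t \<in> {0..1} \<Longrightarrow> 0 \<le> p \<Longrightarrow> 0 < d \<Longrightarrow> p * A t \<le> 1 - d \<Longrightarrow>
      (\<integral>\<^sup>+ \<omega>. ennreal (exp (p * X t \<omega>)) \<partial>M) \<le> ennreal (D d)"
    and D: "\<And>d. 0 \<le> D d"
    and norm: "((\<lambda>t. A t / a t) \<longlongrightarrow> \<Lambda>) (at_right 0)" "eventually (\<lambda>t. 0 < a t) (at_right 0)"
  shows "AE \<omega> in M. Limsup (at_right 0) (\<lambda>t. ereal (X t \<omega> / (a t * ln (ln (1 / t))))) \<le> ereal \<Lambda>"
proof -
  have "AE \<omega> in M. \<forall>n. eventually (\<lambda>t. X t \<omega> \<le> (1 + 1 / real (Suc n)) * A t * ln (ln (1 / t))) (at_right 0)"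
    unfolding AE_all_countable
    by (intro allI lil_fixed[OF cont A_lower A_diff mgf D]) auto
  then show ?thesis
  proof eventually_elim
    case (elim \<omega>)
    have le: "Limsup (at_right 0) (\<lambda>t. ereal (X t \<omega> / (a t * ln (ln (1 / t))))) \<le> ereal ((1 + 1 / real (Suc n)) * \<Lambda>)" for n
    proof -
      have ll: "eventually (\<lambda>t. 0 < ln (ln (1 / t))) (at_right (0::real))" by real_asymp
      have "Limsup (at_right 0) (\<lambda>t. ereal (X t \<omega> / (a t * ln (ln (1 / t))))) \<le>
          Limsup (at_right 0) (\<lambda>t. ereal ((1 + 1 / real (Suc n)) * (A t / a t)))"
      proof (rule Limsup_mono)
        show "eventually (\<lambda>t. ereal (X t \<omega> / (a t * ln (ln (1 / t)))) \<le> ereal ((1 + 1 / real (Suc n)) * (A t / a t))) (at_right 0)"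
          using elim[rule_format, of n] norm(2) ll
        proof eventually_elim
          case (elim t)
          then show ?case by (simp add: field_simps del: of_nat_Suc)
        qed
      qed
      also have "\<dots> = ereal ((1 + 1 / real (Suc n)) * \<Lambda>)"
        by (intro lim_imp_Limsup tendsto_ereal tendsto_mult_left norm(1)) simp
      finally show ?thesis .
    qed
    show ?case
    proof (rule LIMSEQ_le_const)
      have "(\<lambda>n. (1 + 1 / real (Suc n)) * \<Lambda>) \<longlonglongrightarrow> \<Lambda>" by real_asymp
      then show "(\<lambda>n. ereal ((1 + 1 / real (Suc n)) * \<Lambda>)) \<longlonglongrightarrow> ereal \<Lambda>" by (rule tendsto_ereal)
      show "\<exists>N. \<forall>n\<ge>N. Limsup (at_right 0) (\<lambda>t. ereal (X t \<omega> / (a t * ln (ln (1 / t))))) \<le> ereal ((1 + 1 / real (Suc n)) * \<Lambda>)"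
        using le by blast
    qed
  qed
qed

end

section \<open>Permanental processes\<close>

lemma permanental_laplace:
  fixes t s :: "nat \<Rightarrow> real"
  assumes "permanental_process M \<alpha> K X" and "\<forall>i<n. t i \<in> {0..1} \<and> 0 < s i"
  shows "(LINT \<omega>|M. exp (- (\<Sum>i<n. s i * X (t i) \<omega>))) =
    1 / (Determinant.det (1\<^sub>m n + Matrix.mat n n (\<lambda>(i, j). K (t i) (t j)) * mat_diag n s)) powr \<alpha>"
proof -
  have "\<forall>(n::nat) (t :: nat \<Rightarrow> real) (s :: nat \<Rightarrow> real). (\<forall>i<n. t i \<in> {0..1} \<and> 0 < s i) \<longrightarrow>
      (LINT \<omega>|M. exp (- (\<Sum>i<n. s i * X (t i) \<omega>))) =
        1 / (Determinant.det (1\<^sub>m n + Matrix.mat n n (\<lambda>(i, j). K (t i) (t j)) * mat_diag n s)) powr \<alpha>"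
    using assms(1) unfolding permanental_process_def by (elim conjE)
  then show ?thesis using assms(2) by blast
qed

lemma permanental_laplace_single:
  assumes P: "permanental_process M \<alpha> K X" and t: "t \<in> {0..1}" and s: "0 < s"
  shows "(LINT \<omega>|M. exp (- s * X t \<omega>)) = (1 + K t t * s) powr (- \<alpha>)"
proof -
  have "(LINT \<omega>|M. exp (- (\<Sum>i<(1::nat). s * X t \<omega>))) =
      1 / (Determinant.det (1\<^sub>m 1 + Matrix.mat 1 1 (\<lambda>(i, j). K t t) * mat_diag 1 (\<lambda>_. s))) powr \<alpha>"
    using permanental_laplace[OF P, of 1 "\<lambda>_. t" "\<lambda>_. s"] t s by simp
  then show ?thesis
    using det_one_plus_single[of "\<lambda>i j. K t t" "\<lambda>_. s"] by (simp add: powr_minus_divide)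
qed

lemma permanental_laplace_pair:
  assumes P: "permanental_process M \<alpha> K X" and t: "t \<in> {0..1}" "t' \<in> {0..1}" and s: "0 < s" "0 < s'"
  shows "(LINT \<omega>|M. exp (- s' * X t' \<omega>) * exp (- s * X t \<omega>)) =
    ((1 + K t t * s) * (1 + K t' t' * s') - K t t' * K t' t * s * s') powr (- \<alpha>)"
proof -
  define \<tau> where "\<tau> i = (if i = 0 then t else t')" for i :: nat
  define \<sigma> where "\<sigma> i = (if i = 0 then s else s')" for i :: nat
  have "\<forall>i<2. \<tau> i \<in> {0..1} \<and> 0 < \<sigma> i" using t s by (auto simp: \<tau>_def \<sigma>_def)
  then have "(LINT \<omega>|M. exp (- (\<Sum>i<2. \<sigma> i * X (\<tau> i) \<omega>))) =
      1 / (Determinant.det (1\<^sub>m 2 + Matrix.mat 2 2 (\<lambda>(i, j). (\<lambda>i j. K (\<tau> i) (\<tau> j)) i j) * mat_diag 2 \<sigma>)) powr \<alpha>"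
    by (rule permanental_laplace[OF P])
  also have "(\<lambda>\<omega>. exp (- (\<Sum>i<2. \<sigma> i * X (\<tau> i) \<omega>))) = (\<lambda>\<omega>. exp (- s' * X t' \<omega>) * exp (- s * X t \<omega>))"
    by (simp add: numeral_2_eq_2 \<sigma>_def \<tau>_def mult_exp_exp add.commute)
  finally show ?thesis
    unfolding det_one_plus_pair by (simp add: \<tau>_def \<sigma>_def powr_minus_divide mult_ac)
qed

lemma permanental_mgf_single:
  assumes P: "permanental_process M \<alpha> K X" and t: "t \<in> {0..1}"
    and A: "0 \<le> K t t" and p: "0 \<le> p" "p * K t t < 1"
  shows "(\<integral>\<^sup>+ \<omega>. ennreal (exp (p * X t \<omega>)) \<partial>M) = ennreal ((1 - p * K t t) powr (- \<alpha>))"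
proof -
  interpret prob_space M using P by (simp add: permanental_process_def)
  have [measurable]: "X t \<in> borel_measurable M" and nn: "\<And>\<omega>. \<omega> \<in> space M \<Longrightarrow> 0 \<le> X t \<omega>"
    using P t by (auto simp: permanental_process_def)
  have "(\<integral>\<^sup>+ \<omega>. ennreal ((\<lambda>_. 1) \<omega> * exp (p * X t \<omega>)) \<partial>M) = ennreal ((1 - K t t * p) powr (- \<alpha>))"
    by (rule gamma_laplace_imp_mgf)
      (use A p nn permanental_laplace_single[OF P t] in \<open>simp_all add: mult.commute\<close>)
  then show ?thesis by (simp add: mult.commute)
qed

text \<open>Only one variable is continued beyond its given range: \<open>X t'\<close> stays at the
  admissible exponent \<open>p\<close> and becomes the weight \<open>exp (- p * X t')\<close>, while
  the exponent of \<open>X t\<close> moves to \<open>- p\<close>. In that variable the determinant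
  is affine with slope \<open>K t t + p * e\<close>, where \<open>e\<close> is the second minor;
  \<open>0 \<le> e\<close> makes the slope nonnegative.\<close>

lemma permanental_mgf_difference:
  assumes P: "permanental_process M \<alpha> K X" and t: "t \<in> {0..1}" "t' \<in> {0..1}"
    and K: "0 \<le> K t t" "0 \<le> K t' t'" and e: "e = K t t * K t' t' - K t t' * K t' t" "0 \<le> e"
    and p: "0 < p" and D: "p * (K t t - K t' t') + p\<^sup>2 * e < 1"
  shows "(\<integral>\<^sup>+ \<omega>. ennreal (exp (p * (X t \<omega> - X t' \<omega>))) \<partial>M) =
    ennreal ((1 - (p * (K t t - K t' t') + p\<^sup>2 * e)) powr (- \<alpha>))"
proof -
  interpret prob_space M using P by (simp add: permanental_process_def)
  have [measurable]: "X t \<in> borel_measurable M" "X t' \<in> borel_measurable M"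
    and nn: "\<And>\<omega>. \<omega> \<in> space M \<Longrightarrow> 0 \<le> X t \<omega>" "\<And>\<omega>. \<omega> \<in> space M \<Longrightarrow> 0 \<le> X t' \<omega>"
    using P t by (auto simp: permanental_process_def)
  have "(\<integral>\<^sup>+ \<omega>. ennreal (exp (- p * X t' \<omega>) * exp (p * X t \<omega>)) \<partial>M) =
      ennreal (((1 + p * K t' t') - (K t t + p * e) * p) powr (- \<alpha>))"
  proof (rule gamma_laplace_imp_mgf)
    show "integrable M (\<lambda>\<omega>. exp (- p * X t' \<omega>))"
      by (rule integrable_const_bound[where B = 1]) (use nn p in \<open>auto intro!: AE_I2\<close>)
    show "(LINT \<omega>|M. exp (- p * X t' \<omega>) * exp (- s * X t \<omega>)) = (1 + p * K t' t' + (K t t + p * e) * s) powr (- \<alpha>)"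
      if s: "0 < s" for s
    proof -
      have "(1 + K t t * s) * (1 + K t' t' * p) - K t t' * K t' t * s * p = 1 + p * K t' t' + (K t t + p * e) * s"
        unfolding e(1) by (simp add: algebra_simps)
      then show ?thesis using permanental_laplace_pair[OF P t s p] by simp
    qed
    show "0 \<le> K t t + p * e" using K e(2) p by simp
    show "0 < 1 + p * K t' t'" using K p by (simp add: add_pos_nonneg)
    show "(K t t + p * e) * p < 1 + p * K t' t'"
      using D by (simp add: algebra_simps power2_eq_square)
  qed (use nn p in auto)
  then show ?thesis by (simp add: mult_exp_exp algebra_simps power2_eq_square)
qed

context subadditive_gauge
begin

text \<open>The kernel \<open>v\<close> with \<open>f_Phi\<close> replaced by an unspecified
  \<open>f\<close>, about which the estimates use \<open>0 \<le> f t\<close>, \<open>f 0 = 0\<close>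
  and a bound on increments by a multiple of \<open>g\<close>.\<close>

definition gauge_kernel :: "(real \<Rightarrow> real) \<Rightarrow> real \<Rightarrow> real \<Rightarrow> real" where
  "gauge_kernel f x y = g x / 2 + g y / 2 - g (x - y) / 2 + f y"

lemma gauge_kernel_diag: "gauge_kernel f x x = g x + f x"
  by (simp add: gauge_kernel_def)

text \<open>The absolute value is split by
  \<open>exp (p * \<bar>z\<bar>) \<le> exp (p * z) + exp (- p * z)\<close>, which gives the factor
  \<open>2\<close>. Each half has a determinant at least \<open>1/2\<close>, which gives
  \<open>2 powr \<alpha>\<close>.\<close>

lemma permanental_exp_increment:
  assumes P: "permanental_process M \<alpha> (gauge_kernel f) X" and \<alpha>: "0 < \<alpha>"
    and f0: "\<And>t. 0 \<le> f t" and f1: "f 0 = 0" and f2: "\<And>s t. \<bar>f s - f t\<bar> \<le> m * g (s - t)"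
    and st: "s \<in> {0..1}" "t \<in> {0..1}" and p: "0 \<le> p" "p * (1 + m) * g (s - t) \<le> 1/4"
    "p\<^sup>2 * (1 + m) * (g s + g t) * g (s - t) \<le> 1/4"
  shows "(\<integral>\<^sup>+ \<omega>. ennreal (exp (p * \<bar>X s \<omega> - X t \<omega>\<bar>)) \<partial>M) \<le> ennreal (2 * 2 powr \<alpha>)"
proof (cases "p = 0")
  case True
  interpret prob_space M using P by (simp add: permanental_process_def)
  have "1 \<le> 2 powr \<alpha>" using \<alpha> by (simp add: ge_one_powr_ge_zero)
  then have "ennreal 1 \<le> ennreal (2 * 2 powr \<alpha>)" by (intro ennreal_leI) simp
  then show ?thesis using True by (simp add: emeasure_space_1)
next
  case False
  then have p0: "0 < p" using p by simp
  interpret prob_space M using P by (simp add: permanental_process_def)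
  have [measurable]: "X s \<in> borel_measurable M" "X t \<in> borel_measurable M"
    using P st by (auto simp: permanental_process_def)
  have half: "(\<integral>\<^sup>+ \<omega>. ennreal (exp (p * (X s \<omega> - X t \<omega>))) \<partial>M) \<le> ennreal (2 powr \<alpha>)"
    if st: "s \<in> {0..1}" "t \<in> {0..1}" and p1: "p * (1 + m) * g (s - t) \<le> 1/4"
      and p2: "p\<^sup>2 * (1 + m) * (g s + g t) * g (s - t) \<le> 1/4" for s t
  proof -
    define h where "h = g (s - t)"
    \<comment> \<open>In the variables \<open>a\<close>, \<open>b\<close>, \<open>x\<close>,
      \<open>y\<close> the kernel matrix has rows \<open>(a + x, b)\<close> and
      \<open>(a, b + y)\<close>. The product \<open>a * b\<close> cancels from its determinant, and
      every remaining term contains \<open>x\<close> or \<open>y\<close>, which lie between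
      \<open>0\<close> and \<open>h\<close>.\<close>
    define \<phi> where "\<phi> = g s / 2 + g t / 2 - h / 2"
    define x where "x = g s - \<phi>"
    define y where "y = g t - \<phi>"
    define a where "a = \<phi> + f s"
    define b where "b = \<phi> + f t"
    have h0: "0 \<le> h" by (simp add: h_def)
    have gst: "\<bar>g s - g t\<bar> \<le> h" using g_diff_le[of s t] by (simp add: h_def)
    have \<phi>: "0 \<le> \<phi>"
      using g_subadd[of s "- t"] g_even[of t] by (simp add: \<phi>_def h_def)
    have xy: "0 \<le> x" "x \<le> h" "0 \<le> y" "y \<le> h"
      using gst unfolding x_def y_def \<phi>_def by linarith+
    have ab: "0 \<le> a" "0 \<le> b" using \<phi> f0 by (simp_all add: a_def b_def)
    have Ks: "gauge_kernel f s s = a + x" "gauge_kernel f t t = b + y"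
      by (simp_all add: gauge_kernel_diag a_def b_def x_def y_def)
    have Kst: "gauge_kernel f s t = b" "gauge_kernel f t s = a"
      using g_even[of "s - t"] by (simp_all add: gauge_kernel_def a_def b_def \<phi>_def h_def)
    define e where "e = (a + x) * (b + y) - b * a"
    have e: "e = a * y + x * b + x * y" by (simp add: e_def algebra_simps)
    have e0: "0 \<le> e" using xy ab by (simp add: e)
    have A: "a + x \<le> (1 + m) * g s" "b + y \<le> (1 + m) * g t"
      using f2[of s 0] f2[of t 0] f0[of s] f0[of t] f1
      by (simp_all add: a_def b_def x_def y_def algebra_simps)
    have "e \<le> (a + x) * h + (b + y) * h"
    proof -
      have "a * y \<le> a * h" "x * b \<le> h * b" "x * y \<le> x * h"
        using xy ab by (auto intro: mult_left_mono mult_right_mono)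
      moreover have "0 \<le> y * h" using xy h0 by simp
      ultimately show ?thesis unfolding e distrib_right by (simp add: mult.commute)
    qed
    also have "\<dots> \<le> (1 + m) * (g s + g t) * h"
      using mult_right_mono[OF A(1) h0] mult_right_mono[OF A(2) h0] by (simp add: algebra_simps)
    finally have "p\<^sup>2 * e \<le> p\<^sup>2 * ((1 + m) * (g s + g t) * h)" by (intro mult_left_mono) auto
    then have pe: "p\<^sup>2 * e \<le> 1/4" using p2 by (simp add: h_def mult.assoc)
    have "(a + x) - (b + y) \<le> (1 + m) * h"
      using gst f2[of s t] unfolding a_def b_def x_def y_def h_def[symmetric] by (simp add: algebra_simps)
    then have "p * ((a + x) - (b + y)) \<le> p * ((1 + m) * h)" using p0 by (intro mult_left_mono) auto
    moreover have "p * ((1 + m) * h) \<le> 1/4" using p1 by (simp add: h_def mult.assoc)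
    ultimately have pd: "p * ((a + x) - (b + y)) \<le> 1/4" by linarith
    have "(\<integral>\<^sup>+ \<omega>. ennreal (exp (p * (X s \<omega> - X t \<omega>))) \<partial>M) =
        ennreal ((1 - (p * ((a + x) - (b + y)) + p\<^sup>2 * e)) powr (- \<alpha>))"
      using permanental_mgf_difference[OF P st, of e p] Ks Kst e0 e_def xy ab p0 pe pd by simp
    also have "\<dots> \<le> ennreal ((1/2) powr (- \<alpha>))"
    proof (intro ennreal_leI powr_mono2')
      show "1/2 \<le> 1 - (p * ((a + x) - (b + y)) + p\<^sup>2 * e)" using pe pd by linarith
    qed (use \<alpha> in auto)
    also have "(1/2) powr (- \<alpha>) = 2 powr \<alpha>" by (simp add: powr_minus_divide powr_divide)
    finally show ?thesis .
  qed
  have gts: "g (t - s) = g (s - t)" using g_even[of "s - t"] by simp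
  have "(\<integral>\<^sup>+ \<omega>. ennreal (exp (p * \<bar>X s \<omega> - X t \<omega>\<bar>)) \<partial>M) \<le>
      (\<integral>\<^sup>+ \<omega>. ennreal (exp (p * (X s \<omega> - X t \<omega>))) + ennreal (exp (p * (X t \<omega> - X s \<omega>))) \<partial>M)"
    by (intro nn_integral_mono) (auto simp: abs_if ennreal_plus[symmetric] simp del: ennreal_plus intro!: ennreal_leI)
  also have "\<dots> = (\<integral>\<^sup>+ \<omega>. ennreal (exp (p * (X s \<omega> - X t \<omega>))) \<partial>M) + (\<integral>\<^sup>+ \<omega>. ennreal (exp (p * (X t \<omega> - X s \<omega>))) \<partial>M)"
    by (rule nn_integral_add) measurable
  also have "\<dots> \<le> ennreal (2 powr \<alpha>) + ennreal (2 powr \<alpha>)"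
    using st p gts by (intro add_mono half) (simp_all add: add.commute)
  also have "\<dots> = ennreal (2 * 2 powr \<alpha>)" by (simp add: ennreal_plus[symmetric] del: ennreal_plus)
  finally show ?thesis .
qed

lemma permanental_exp_increments:
  assumes P: "permanental_process M \<alpha> (gauge_kernel f) X" and \<alpha>: "0 < \<alpha>" and m: "0 \<le> m"
    and f0: "\<And>t. 0 \<le> f t" and f1: "f 0 = 0" and f2: "\<And>s t. \<bar>f s - f t\<bar> \<le> m * g (s - t)"
  shows "exp_increments M g x0 q X (1 + m) (2 * 2 powr \<alpha>)"
proof -
  interpret prob_space M using P by (simp add: permanental_process_def)
  show ?thesis
  proof
    show "X t \<in> borel_measurable M" if "t \<in> {0..1}" for t
      using P that by (auto simp: permanental_process_def)
  qed (use m permanental_exp_increment[OF P \<alpha> f0 f1 f2] in auto)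
qed

text \<open>The increment estimates are used twice: for \<open>X\<close>, to construct
  \<open>Y\<close>, and then for \<open>Y\<close>, which has the same finite-dimensional Laplace
  transforms, because the growth bound requires continuous paths.\<close>

lemma permanental_continuous_lil:
  assumes P: "permanental_process M \<alpha> (gauge_kernel f) X" and \<alpha>: "0 < \<alpha>" and m: "0 \<le> m"
    and f0: "\<And>t. 0 \<le> f t" and f1: "f 0 = 0" and f2: "\<And>s t. \<bar>f s - f t\<bar> \<le> m * g (s - t)"
  obtains Y where "version_of M X Y" "permanental_process M \<alpha> (gauge_kernel f) Y"
    "\<And>\<omega>. continuous_on {0..1} (\<lambda>t. Y t \<omega>)"
    "\<And>a \<Lambda>. ((\<lambda>t. (g t + f t) / a t) \<longlongrightarrow> \<Lambda>) (at_right 0) \<Longrightarrow> eventually (\<lambda>t. 0 < a t) (at_right 0) \<Longrightarrow>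
      AE \<omega> in M. Limsup (at_right 0) (\<lambda>t. ereal (Y t \<omega> / (a t * ln (ln (1 / t))))) \<le> ereal \<Lambda>"
proof -
  interpret X: exp_increments M g x0 q X "1 + m" "2 * 2 powr \<alpha>"
    by (rule permanental_exp_increments[OF P \<alpha> m f0 f1 f2])
  have nn: "0 \<le> X t \<omega>" if "t \<in> {0..1}" "\<omega> \<in> space M" for t \<omega>
    using P that by (auto simp: permanental_process_def)
  obtain Y where Y: "\<And>t. t \<in> {0..1} \<Longrightarrow> Y t \<in> borel_measurable M"
    "\<And>t. t \<in> {0..1} \<Longrightarrow> AE \<omega> in M. Y t \<omega> = X t \<omega>"
    "\<And>\<omega>. continuous_on {0..1} (\<lambda>t. Y t \<omega>)"
    "\<And>t \<omega>. t \<in> {0..1} \<Longrightarrow> \<omega> \<in> space M \<Longrightarrow> 0 \<le> Y t \<omega>"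
  proof (rule X.continuous_version[OF nn])
    fix Y
    assume "\<And>t. t \<in> {0..1} \<Longrightarrow> Y t \<in> borel_measurable M"
      "\<And>t. t \<in> {0..1} \<Longrightarrow> AE \<omega> in M. Y t \<omega> = X t \<omega>"
      "\<And>\<omega>. continuous_on {0..1} (\<lambda>t. Y t \<omega>)"
      "\<And>t \<omega>. t \<in> {0..1} \<Longrightarrow> \<omega> \<in> space M \<Longrightarrow> 0 \<le> Y t \<omega>"
    then show thesis by (rule that[of Y])
  qed
  have PY: "permanental_process M \<alpha> (gauge_kernel f) Y"
    unfolding permanental_process_def
  proof (intro conjI allI impI ballI)
    fix n :: nat and t s :: "nat \<Rightarrow> real"
    assume ts: "\<forall>i<n. t i \<in> {0..1} \<and> 0 < s i"
    have [measurable]: "X (t i) \<in> borel_measurable M" "Y (t i) \<in> borel_measurable M" if "i < n" for i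
      using ts that X.X_meas Y(1) by auto
    have "AE \<omega> in M. \<forall>i\<in>{..<n}. Y (t i) \<omega> = X (t i) \<omega>"
      using ts Y(2) by (intro AE_finite_allI) auto
    then have "AE \<omega> in M. exp (- (\<Sum>i<n. s i * Y (t i) \<omega>)) = exp (- (\<Sum>i<n. s i * X (t i) \<omega>))"
      by eventually_elim simp
    then have "(LINT \<omega>|M. exp (- (\<Sum>i<n. s i * Y (t i) \<omega>))) = (LINT \<omega>|M. exp (- (\<Sum>i<n. s i * X (t i) \<omega>)))"
      by (rule integral_cong_AE[rotated 2]) measurable
    then show "(LINT \<omega>|M. exp (- (\<Sum>i<n. s i * Y (t i) \<omega>))) =
        1 / (Determinant.det (1\<^sub>m n + Matrix.mat n n (\<lambda>(i, j). gauge_kernel f (t i) (t j)) * mat_diag n s)) powr \<alpha>"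
      using permanental_laplace[OF P ts] by simp
  next
    show "prob_space M" by (rule X.prob_space_axioms)
  qed (rule Y(1) Y(4), assumption+)+
  interpret Y: exp_increments M g x0 q Y "1 + m" "2 * 2 powr \<alpha>"
    by (rule permanental_exp_increments[OF PY \<alpha> m f0 f1 f2])
  show thesis
  proof
    show "version_of M X Y" using Y(1,2) by (auto simp: version_of_def)
    show "permanental_process M \<alpha> (gauge_kernel f) Y" by (rule PY)
    show "continuous_on {0..1} (\<lambda>t. Y t \<omega>)" for \<omega> by (rule Y(3))
    fix a \<Lambda>
    assume lim: "((\<lambda>t. (g t + f t) / a t) \<longlongrightarrow> \<Lambda>) (at_right 0)" "eventually (\<lambda>t. 0 < a t) (at_right 0)"
    show "AE \<omega> in M. Limsup (at_right 0) (\<lambda>t. ereal (Y t \<omega> / (a t * ln (ln (1 / t))))) \<le> ereal \<Lambda>"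
    proof (rule Y.lil[where D = "\<lambda>d. d powr (- \<alpha>)", OF Y(3) _ _ _ _ lim])
      show "g t \<le> g t + f t" for t using f0 by simp
      show "\<bar>g s + f s - (g t + f t)\<bar> \<le> (1 + m) * g (s - t)" for s t
        using g_diff_le[of s t] f2[of s t] by (simp add: algebra_simps)
      fix t p d :: real
      assume t: "t \<in> {0..1}" and p: "0 \<le> p" and d: "0 < d" "p * (g t + f t) \<le> 1 - d"
      have "(\<integral>\<^sup>+ \<omega>. ennreal (exp (p * Y t \<omega>)) \<partial>M) = ennreal ((1 - p * (g t + f t)) powr (- \<alpha>))"
        using permanental_mgf_single[OF PY t, of p] p d f0 by (simp add: gauge_kernel_diag)
      also have "\<dots> \<le> ennreal (d powr (- \<alpha>))"
        using d \<alpha> by (intro ennreal_leI powr_mono2') auto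
      finally show "(\<integral>\<^sup>+ \<omega>. ennreal (exp (p * Y t \<omega>)) \<partial>M) \<le> ennreal (d powr (- \<alpha>))" .
    qed auto
  qed
qed

end

section \<open>The maximum principle for resolvents\<close>

lemma one_minus_cos_le: "1 - cos x \<le> x\<^sup>2 / (2::real)"
proof -
  have "1 - cos x = 2 * (sin (x / 2))\<^sup>2"
    using cos_double_sin[of "x / 2"] by simp
  also have "\<dots> \<le> 2 * (x / 2)\<^sup>2"
  proof (rule mult_left_mono)
    show "(sin (x / 2))\<^sup>2 \<le> (x / 2)\<^sup>2"
      unfolding abs_le_square_iff[symmetric] by (rule abs_sin_x_le_abs_x)
  qed simp
  finally show ?thesis by (simp add: power2_eq_square)
qed

text \<open>Integration by parts leads to the sine integral \<open>Si\<close>: the antiderivative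
  tends to \<open>0\<close> at \<open>0\<close>, and \<open>Si\<close> tends to
  \<open>pi / 2\<close> at infinity.\<close>

lemma integral_one_minus_cos_pos:
  fixes a :: real
  assumes a: "0 < a"
  shows "set_integrable lborel {0<..} (\<lambda>l. (1 - cos (l * a)) / l\<^sup>2)"
    and "(LBINT l:{0<..}. (1 - cos (l * a)) / l\<^sup>2) = pi / 2 * a"
proof -
  define F where "F l = - (1 - cos (l * a)) / l + a * Si (a * l)" for l
  have deriv: "DERIV F l :> (1 - cos (l * a)) / l\<^sup>2" if l: "0 < l" for l
  proof -
    have "((\<lambda>l. - (1 - cos (l * a)) / l + a * Si (a * l)) has_real_derivative
        ((- (sin (l * a) * a)) * l - (- (1 - cos (l * a))) * 1) / (l * l) + a * (sinc (a * l) * a)) (at l)"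
      using l by (auto intro!: derivative_eq_intros DERIV_chain2[OF DERIV_Si])
    moreover have "((- (sin (l * a) * a)) * l - (- (1 - cos (l * a))) * 1) / (l * l) + a * (sinc (a * l) * a) = (1 - cos (l * a)) / l\<^sup>2"
      using l a by (simp add: field_simps power2_eq_square)
    ultimately show ?thesis unfolding F_def by simp
  qed
  have Si0: "Si 0 = 0" by (simp add: Si_def zero_ereal_def[symmetric])
  have lim0: "((F \<circ> real_of_ereal) \<longlongrightarrow> 0) (at_right 0)"
  proof -
    have "((\<lambda>l. - (1 - cos (l * a)) / l) \<longlongrightarrow> 0) (at_right 0)" by real_asymp
    moreover have "((\<lambda>l. a * Si (a * l)) \<longlongrightarrow> a * Si (a * 0)) (at_right 0)"
      by (intro tendsto_mult_left isCont_tendsto_compose[OF isCont_Si] tendsto_intros)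
    ultimately have "(F \<longlongrightarrow> 0 + a * Si (a * 0)) (at_right 0)"
      unfolding F_def by (intro tendsto_add)
    then show ?thesis by (simp add: zero_ereal_def ereal_tendsto_simps1 Si0)
  qed
  have limI: "((F \<circ> real_of_ereal) \<longlongrightarrow> pi / 2 * a) (at_left \<infinity>)"
  proof -
    have "((\<lambda>l. - (1 - cos (l * a)) / l) \<longlongrightarrow> 0) at_top"
    proof (rule Lim_null_comparison)
      show "eventually (\<lambda>l. norm (- (1 - cos (l * a)) / l) \<le> 2 / l) at_top"
        using eventually_gt_at_top[of 0]
      proof eventually_elim
        case (elim l)
        have "\<bar>1 - cos (l * a)\<bar> \<le> 2" using cos_le_one[of "l * a"] cos_ge_minus_one[of "l * a"] by linarith
        then show ?case using elim by (simp add: divide_right_mono)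
      qed
      show "((\<lambda>l. 2 / l) \<longlongrightarrow> (0::real)) at_top" by real_asymp
    qed
    moreover have "((\<lambda>l. a * Si (a * l)) \<longlongrightarrow> a * (pi / 2)) at_top"
    proof (intro tendsto_mult_left filterlim_compose[OF Si_at_top])
      show "filterlim (\<lambda>l. a * l) at_top at_top" using a by real_asymp
    qed
    ultimately have "(F \<longlongrightarrow> 0 + a * (pi / 2)) at_top"
      unfolding F_def by (intro tendsto_add)
    then show ?thesis by (simp add: ereal_tendsto_simps1 mult.commute)
  qed
  have FTC: "set_integrable lborel (einterval 0 \<infinity>) (\<lambda>l. (1 - cos (l * a)) / l\<^sup>2)"
    "(LBINT l=0..\<infinity>. (1 - cos (l * a)) / l\<^sup>2) = pi / 2 * a - 0"
    by (rule interval_integral_FTC_nonneg[OF _ _ _ _ lim0 limI];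
        auto simp: zero_ereal_def intro!: deriv continuous_intros AE_I2)+
  have ein: "einterval 0 \<infinity> = {0::real<..}" by (auto simp: einterval_def zero_ereal_def)
  show "set_integrable lborel {0<..} (\<lambda>l. (1 - cos (l * a)) / l\<^sup>2)"
    using FTC(1) by (simp add: ein)
  show "(LBINT l:{0<..}. (1 - cos (l * a)) / l\<^sup>2) = pi / 2 * a"
    using FTC(2) by (simp add: interval_lebesgue_integral_def ein)
qed

lemma integral_one_minus_cos:
  fixes a :: real
  shows "set_integrable lborel {0<..} (\<lambda>l. (1 - cos (l * a)) / l\<^sup>2)"
    and "(LBINT l:{0<..}. (1 - cos (l * a)) / l\<^sup>2) = pi / 2 * \<bar>a\<bar>"
proof -
  have "set_integrable lborel {0<..} (\<lambda>l. (1 - cos (l * a)) / l\<^sup>2) \<and>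
      (LBINT l:{0<..}. (1 - cos (l * a)) / l\<^sup>2) = pi / 2 * \<bar>a\<bar>"
  proof (cases a "0::real" rule: linorder_cases)
    case less
    then show ?thesis using integral_one_minus_cos_pos[of "- a"] by simp
  next
    case equal
    then show ?thesis by (simp add: set_integrable_def)
  next
    case greater
    then show ?thesis using integral_one_minus_cos_pos[of a] by simp
  qed
  then show "set_integrable lborel {0<..} (\<lambda>l. (1 - cos (l * a)) / l\<^sup>2)"
    "(LBINT l:{0<..}. (1 - cos (l * a)) / l\<^sup>2) = pi / 2 * \<bar>a\<bar>" by auto
qed

text \<open>The integrand is half the second difference in \<open>x\<close>, with step
  \<open>\<eta>\<close>, of \<open>(1 - cos (l * x)) / l\<^sup>2\<close>, whose integral is
  \<open>pi / 2 * \<bar>x\<bar>\<close>; and half the second difference of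
  \<open>\<bar>x\<bar>\<close> is the tent.\<close>

lemma tent_fourier:
  fixes \<eta> x :: real
  assumes "0 \<le> \<eta>"
  shows "(LBINT l:{0<..}. (1 - cos (l * \<eta>)) / l\<^sup>2 * cos (l * x)) = pi / 2 * max 0 (\<eta> - \<bar>x\<bar>)"
proof -
  have e: "(1 - cos (l * \<eta>)) / l\<^sup>2 * cos (l * x) =
      1/2 * ((1 - cos (l * (x + \<eta>))) / l\<^sup>2) + 1/2 * ((1 - cos (l * (x - \<eta>))) / l\<^sup>2) - (1 - cos (l * x)) / l\<^sup>2" for l
  proof -
    have "cos (l * (x + \<eta>)) + cos (l * (x - \<eta>)) = 2 * cos (l * x) * cos (l * \<eta>)"
      by (simp add: distrib_left right_diff_distrib cos_add cos_diff)
    then have "(1 - cos (l * \<eta>)) * cos (l * x) =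
        1/2 * (1 - cos (l * (x + \<eta>))) + 1/2 * (1 - cos (l * (x - \<eta>))) - (1 - cos (l * x))"
      by (simp add: algebra_simps)
    moreover have "(1/2 * P + 1/2 * Q - R) / d = 1/2 * (P / d) + 1/2 * (Q / d) - R / d" for P Q R d :: real
      by (simp add: diff_divide_distrib add_divide_distrib)
    ultimately show ?thesis by (simp only: times_divide_eq_left)
  qed
  have "(LBINT l:{0<..}. (1 - cos (l * \<eta>)) / l\<^sup>2 * cos (l * x)) =
      1/2 * (pi / 2 * \<bar>x + \<eta>\<bar>) + 1/2 * (pi / 2 * \<bar>x - \<eta>\<bar>) - pi / 2 * \<bar>x\<bar>"
  proof -
    define T where "T a l = (1 - cos (l * a)) / l\<^sup>2" for a l :: real
    have T: "set_integrable lborel {0<..} (T a)" "(LBINT l:{0<..}. T a l) = pi / 2 * \<bar>a\<bar>" for a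
      using integral_one_minus_cos[of a] by (simp_all add: T_def[abs_def])
    have h: "set_integrable lborel {0<..} (\<lambda>l. 1/2 * T a l)" for a
      by (intro set_integrable_mult_right T)
    have "(LBINT l:{0<..}. 1/2 * T (x + \<eta>) l + 1/2 * T (x - \<eta>) l - T x l) =
        (LBINT l:{0<..}. 1/2 * T (x + \<eta>) l) + (LBINT l:{0<..}. 1/2 * T (x - \<eta>) l) - (LBINT l:{0<..}. T x l)"
      using set_integral_diff(2)[OF set_integral_add(1)[OF h h] T(1)] set_integral_add(2)[OF h h] by simp
    moreover have "(1 - cos (l * \<eta>)) / l\<^sup>2 * cos (l * x) = 1/2 * T (x + \<eta>) l + 1/2 * T (x - \<eta>) l - T x l" for l
      unfolding T_def by (rule e)
    ultimately show ?thesis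
      by (simp only: set_integral_mult_right T(2))
  qed
  also have "\<dots> = pi / 2 * max 0 (\<eta> - \<bar>x\<bar>)"
  proof -
    have "1/2 * \<bar>x + \<eta>\<bar> + 1/2 * \<bar>x - \<eta>\<bar> - \<bar>x\<bar> = max 0 (\<eta> - \<bar>x\<bar>)" using assms by (auto simp: abs_if max_def field_simps)
    then show ?thesis by (metis (no_types, lifting) distrib_left right_diff_distrib mult.left_commute)
  qed
  finally show ?thesis .
qed

section \<open>Walks with killing, and the passage to continuous time\<close>

text \<open>\<open>G\<close> is the potential of the charge \<open>\<phi>\<close> for a walk with
  step law \<open>P\<close> that survives each step with probability \<open>r\<close>. Where the
  charge is not positive, \<open>G\<close> is at most \<open>r\<close> times its supremum; elsewhere
  it is at most \<open>c\<close> by assumption. As \<open>r < 1\<close>, the supremum cannot exceed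
  \<open>c\<close>, whether or not it is attained.\<close>

lemma walk_maximum_principle:
  fixes G \<phi> :: "real \<Rightarrow> real"
  assumes P: "prob_space P" "sets P = sets borel"
    and G [measurable]: "G \<in> borel_measurable borel" and B: "\<And>x. \<bar>G x\<bar> \<le> B"
    and eq: "\<And>x. G x = \<phi> x + r * (LINT z|P. G (x + z))"
    and r: "0 \<le> r" "r < 1" and c: "0 \<le> c"
    and sign: "\<And>x. \<phi> x \<le> 0 \<or> G x \<le> c"
  shows "G x \<le> c"
proof -
  interpret prob_space P by fact
  define S where "S = Sup (range G)"
  have bdd: "bdd_above (range G)" using B by (auto intro!: bdd_aboveI[of _ B] simp: abs_le_iff)
  have GS: "G y \<le> S" for y unfolding S_def by (intro cSup_upper bdd) auto
  have int: "integrable P (\<lambda>z. G (y + z))" for y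
  proof (rule integrable_const_bound[where B = B])
    show "(\<lambda>z. G (y + z)) \<in> borel_measurable P"
      unfolding measurable_cong_sets[OF P(2) refl] by measurable
  qed (use B in auto)
  have step: "G y \<le> max c (r * S)" for y
  proof (cases "\<phi> y \<le> 0")
    case True
    have "(LINT z|P. G (y + z)) \<le> (LINT z|P. S)" by (intro integral_mono int integrable_const GS)
    also have "\<dots> = S" by (simp add: prob_space)
    finally have "r * (LINT z|P. G (y + z)) \<le> r * S" using r by (intro mult_left_mono)
    then show ?thesis using eq[of y] True by simp
  next
    case False
    then show ?thesis using sign[of y] by simp
  qed
  have "S \<le> max c (r * S)" unfolding S_def by (intro cSup_least) (use step in \<open>auto simp: S_def\<close>)
  then have "S \<le> c"
  proof (cases "S \<le> c")
    case False
    then have "S \<le> r * S" using \<open>S \<le> max c (r * S)\<close> by simp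
    then have "(1 - r) * S \<le> 0" by (simp add: algebra_simps)
    then have "S \<le> 0" using r by (simp add: mult_le_0_iff)
    then show ?thesis using c by simp
  qed
  then show ?thesis using GS[of x] by simp
qed

lemma real_char_cos_sin:
  assumes P: "real_distribution P" and ch: "char P l = complex_of_real h"
  shows "(LINT z|P. cos (l * z)) = h" "(LINT z|P. sin (l * z)) = 0"
proof -
  interpret real_distribution P by fact
  have int: "integrable P (\<lambda>z. iexp (l * z))" by (rule integrable_iexp) simp_all
  have "(LINT z|P. Re (iexp (l * z))) = Re (char P l)" unfolding char_def by (rule integral_Re[OF int])
  then show "(LINT z|P. cos (l * z)) = h" using ch by (simp add: Re_exp)
  have "(LINT z|P. Im (iexp (l * z))) = Im (char P l)" unfolding char_def by (rule integral_Im[OF int])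
  then show "(LINT z|P. sin (l * z)) = 0" using ch by (simp add: Im_exp)
qed

lemma integral_cos_shift:
  assumes P: "real_distribution P" and ch: "char P l = complex_of_real h"
  shows "(LINT z|P. cos (l * (x + z))) = cos (l * x) * h"
proof -
  interpret real_distribution P by fact
  have int: "integrable P (\<lambda>z. cos (l * z))" "integrable P (\<lambda>z. sin (l * z))"
    by (rule integrable_const_bound[where B = 1]; simp)+
  have "(LINT z|P. cos (l * (x + z))) = (LINT z|P. cos (l * x) * cos (l * z) - sin (l * x) * sin (l * z))"
    by (simp add: distrib_left cos_add)
  also have "\<dots> = cos (l * x) * h"
    using int real_char_cos_sin[OF P ch] by simp
  finally show ?thesis .
qed

lemma fubini_cos:
  fixes H h :: "real \<Rightarrow> real"
  assumes P: "real_distribution P" and ch: "\<And>l. char P l = complex_of_real (h l)"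
    and H: "integrable lborel H"
  shows "(LINT z|P. LINT l|lborel. H l * cos (l * (x + z))) = (LINT l|lborel. H l * (cos (l * x) * h l))"
proof -
  interpret real_distribution P by fact
  interpret pair_sigma_finite P lborel ..
  have [measurable]: "H \<in> borel_measurable borel" using H by (simp add: borel_measurable_integrable)
  have i1: "integrable (P \<Otimes>\<^sub>M lborel) (\<lambda>(z, l). H l)"
    by (rule Fubini_integrable) (use H in auto)
  have "integrable (P \<Otimes>\<^sub>M lborel) (\<lambda>(z, l). H l * cos (l * (x + z)))"
    by (rule Bochner_Integration.integrable_bound[OF i1]) (auto intro!: AE_I2 simp: abs_mult mult_left_le)
  then have "(LINT z|P. LINT l|lborel. H l * cos (l * (x + z))) = (LINT l|lborel. LINT z|P. H l * cos (l * (x + z)))"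
    by (rule Fubini_integral[symmetric])
  also have "\<dots> = (LINT l|lborel. H l * (cos (l * x) * h l))"
    by (simp add: integral_cos_shift[OF P ch])
  finally show ?thesis .
qed

text \<open>\<open>e / (1 - exp (- (e * a)))\<close> is the sum of
  \<open>e * exp (- (n * e * a))\<close> over \<open>n\<close>, the resolvent multiplier of the
  skeleton of mesh \<open>e\<close>; it is a Riemann sum for \<open>1 / a\<close>. What matters is
  that the error is at most \<open>e\<close> uniformly in \<open>a\<close>.\<close>

lemma resolvent_approx:
  fixes a e :: real
  assumes a: "0 < a" and e: "0 < e"
  shows "1 / a \<le> e / (1 - exp (- (e * a)))" "e / (1 - exp (- (e * a))) \<le> 1 / a + e"
proof -
  define x where "x = e * a"
  have x: "0 < x" using a e by (simp add: x_def)
  have le: "1 - exp (- x) \<le> x" using exp_ge_add_one_self[of "- x"] by simp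
  have pos: "0 < 1 - exp (- x)" using x by simp
  have "exp (- x) \<le> 1 / (1 + x)"
    using exp_ge_add_one_self[of x] x by (simp add: exp_minus inverse_eq_divide divide_left_mono)
  then have ge: "x / (1 + x) \<le> 1 - exp (- x)" using x by (simp add: field_simps)
  have "e / x \<le> e / (1 - exp (- x))" using le pos e x by (intro divide_left_mono) auto
  then show "1 / a \<le> e / (1 - exp (- (e * a)))" using e a by (simp add: x_def)
  have "e / (1 - exp (- x)) \<le> e / (x / (1 + x))" using ge x pos e by (intro divide_left_mono) auto
  also have "\<dots> = 1 / a + e" using a e by (simp add: x_def field_simps)
  finally show "e / (1 - exp (- (e * a))) \<le> 1 / a + e" by (simp add: x_def)
qed

text \<open>What the analysis retains of the process: its laws at positive times, which act as step
  laws of the skeletons.\<close>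

locale levy_exponent =
  fixes \<psi> :: "real \<Rightarrow> real"
  assumes psi_nonneg: "0 \<le> \<psi> l"
    and psi_meas [measurable]: "\<psi> \<in> borel_measurable borel"
    and psi_int: "integrable lborel (\<lambda>l. 1 / (1 + \<psi> l))"
    and laws: "0 < e \<Longrightarrow> \<exists>P. real_distribution P \<and> (\<forall>l. char P l = complex_of_real (exp (- e * \<psi> l)))"
begin

text \<open>The resolvent of order \<open>\<beta>\<close> applied to the cosine transform of
  \<open>K\<close>. For \<open>K = indicator {0<..}\<close> it is \<open>pi\<close> times the
  resolvent density; the factor is harmless because the inequalities proved for it are
  homogeneous.\<close>

definition cos_potential :: "(real \<Rightarrow> real) \<Rightarrow> real \<Rightarrow> real \<Rightarrow> real" where
  "cos_potential K \<beta> x = (LINT l|lborel. K l * cos (l * x) / (\<beta> + \<psi> l))"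

lemma resolvent_integrable:
  assumes \<beta>: "0 < \<beta>"
  shows "integrable lborel (\<lambda>l. 1 / (\<beta> + \<psi> l))"
proof (rule Bochner_Integration.integrable_bound)
  define B where "B = max 1 (1 / \<beta>)"
  show "integrable lborel (\<lambda>l. B * (1 / (1 + \<psi> l)))" by (intro integrable_mult_right psi_int)
  show "AE l in lborel. norm (1 / (\<beta> + \<psi> l)) \<le> norm (B * (1 / (1 + \<psi> l)))"
  proof (rule AE_I2)
    fix l
    have p: "0 < \<beta> + \<psi> l" "0 < 1 + \<psi> l" using psi_nonneg[of l] \<beta> by (auto intro: add_pos_nonneg)
    have B: "1 \<le> B" "1 \<le> B * \<beta>" using \<beta> by (auto simp: B_def max_def field_simps)
    have "\<psi> l \<le> B * \<psi> l" using mult_right_mono[OF B(1) psi_nonneg[of l]] by simp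
    then have "1 + \<psi> l \<le> B * (\<beta> + \<psi> l)" using B(2) by (simp add: distrib_left)
    then have "1 / (\<beta> + \<psi> l) \<le> B * (1 / (1 + \<psi> l))" using p by (simp add: field_simps)
    then show "norm (1 / (\<beta> + \<psi> l)) \<le> norm (B * (1 / (1 + \<psi> l)))" using p B by simp
  qed
qed measurable

lemma cos_potential_integrable:
  assumes \<beta>: "0 < \<beta>" and K [measurable]: "K \<in> borel_measurable borel" and K1: "\<And>l. \<bar>K l\<bar> \<le> 1"
  shows "integrable lborel (\<lambda>l. K l * cos (l * x) / (\<beta> + \<psi> l))"
proof (rule Bochner_Integration.integrable_bound[OF resolvent_integrable[OF \<beta>]])
  show "AE l in lborel. norm (K l * cos (l * x) / (\<beta> + \<psi> l)) \<le> norm (1 / (\<beta> + \<psi> l))"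
  proof (rule AE_I2)
    fix l
    have "\<bar>K l * cos (l * x)\<bar> \<le> 1" unfolding abs_mult using K1[of l] by (intro mult_le_one) auto
    then show "norm (K l * cos (l * x) / (\<beta> + \<psi> l)) \<le> norm (1 / (\<beta> + \<psi> l))"
      by (simp add: divide_right_mono)
  qed
qed measurable

text \<open>The charge is \<open>a * k x - b * k (x + y)\<close>, with \<open>k\<close> the cosine
  transform of \<open>K\<close>. Replacing the process by its skeleton of mesh \<open>e\<close>
  changes a potential by at most \<open>e\<close> times the integral of
  \<open>\<bar>K\<bar>\<close>. Hence \<open>K\<close> must be integrable, which the indicator of
  the half-line is not, and point charges have to be smoothed.\<close>

lemma potential_maximum_principle:
  assumes \<beta>: "0 < \<beta>" and K: "integrable lborel K" "\<And>l. \<bar>K l\<bar> \<le> 1" and c: "0 \<le> c"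
    and sign: "\<And>x. a * (LINT l|lborel. K l * cos (l * x)) - b * (LINT l|lborel. K l * cos (l * (x + y))) \<le> 0
      \<or> a * cos_potential K \<beta> x - b * cos_potential K \<beta> (x + y) \<le> c"
  shows "a * cos_potential K \<beta> x - b * cos_potential K \<beta> (x + y) \<le> c"
proof -
  have [measurable]: "K \<in> borel_measurable borel" using K by (simp add: borel_measurable_integrable)
  define k where "k x = (LINT l|lborel. K l * cos (l * x))" for x
  define u where "u = cos_potential K \<beta>"
  define J where "J = (LINT l|lborel. \<bar>K l\<bar>)"
  have J: "0 \<le> J" by (simp add: J_def)
  \<comment> \<open>The factor \<open>2\<close>: the error is met when the sign condition is carried
    to the skeleton and again when the bound is carried back.\<close>
  define C where "C = 2 * (\<bar>a\<bar> + \<bar>b\<bar>) * J"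
  have key: "a * u x - b * u (x + y) \<le> c + e * C" if e: "0 < e" for e
  proof -
    obtain P where P: "real_distribution P" "\<And>l. char P l = complex_of_real (exp (- e * \<psi> l))"
      using laws[OF e] by blast
    interpret P: real_distribution P by (rule P(1))
    define r where "r = exp (- (e * \<beta>))"
    have r: "0 \<le> r" "r < 1" using e \<beta> by (simp_all add: r_def)
    define T where "T l = e / (1 - exp (- (e * (\<beta> + \<psi> l))))" for l
    have bp: "0 < \<beta> + \<psi> l" for l using \<beta> psi_nonneg[of l] by simp
    have T: "1 / (\<beta> + \<psi> l) \<le> T l" "T l \<le> 1 / (\<beta> + \<psi> l) + e" for l
      using resolvent_approx[OF bp[of l] e] by (simp_all add: T_def)
    have [measurable]: "T \<in> borel_measurable borel" unfolding T_def[abs_def] by measurable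
    define H where "H l = K l * T l" for l
    have H: "integrable lborel H"
    proof (rule Bochner_Integration.integrable_bound)
      show "integrable lborel (\<lambda>l. (1 / \<beta> + e) * K l)" by (intro integrable_mult_right K)
      show "AE l in lborel. norm (H l) \<le> norm ((1 / \<beta> + e) * K l)"
      proof (rule AE_I2)
        fix l
        have "1 / (\<beta> + \<psi> l) \<le> 1 / \<beta>" using \<beta> psi_nonneg[of l] by (intro divide_left_mono) auto
        moreover have "0 \<le> 1 / (\<beta> + \<psi> l)" using bp[of l] by simp
        ultimately have "\<bar>T l\<bar> \<le> 1 / \<beta> + e" using T[of l] by linarith
        then have "\<bar>K l\<bar> * \<bar>T l\<bar> \<le> \<bar>K l\<bar> * (1 / \<beta> + e)" by (intro mult_left_mono) auto
        moreover have "\<bar>1 / \<beta> + e\<bar> = 1 / \<beta> + e" using \<beta> e by simp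
        ultimately show "norm (H l) \<le> norm ((1 / \<beta> + e) * K l)"
          by (simp only: H_def real_norm_def abs_mult mult.commute)
      qed
    qed (simp add: H_def[abs_def])
    define W where "W x = (LINT l|lborel. H l * cos (l * x))" for x
    have Hc: "integrable lborel (\<lambda>l. H l * (cos (l * x) * w l))"
      if "w \<in> borel_measurable borel" "\<And>l. \<bar>w l\<bar> \<le> 1" for w x
    proof (rule Bochner_Integration.integrable_bound[OF H])
      show "(\<lambda>l. H l * (cos (l * x) * w l)) \<in> borel_measurable lborel"
        using that(1) H by (auto intro!: borel_measurable_times simp: borel_measurable_integrable)
      show "AE l in lborel. norm (H l * (cos (l * x) * w l)) \<le> norm (H l)"
      proof (rule AE_I2)
        fix l
        have "\<bar>cos (l * x)\<bar> * \<bar>w l\<bar> \<le> 1" using that(2)[of l] by (intro mult_le_one) auto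
        then show "norm (H l * (cos (l * x) * w l)) \<le> norm (H l)"
          by (simp add: abs_mult mult_left_le)
      qed
    qed
    have Hi: "integrable lborel (\<lambda>l. H l * cos (l * x))" for x
      using Hc[of "\<lambda>_. 1"] by simp
    have [measurable]: "H \<in> borel_measurable borel" using H by (simp add: borel_measurable_integrable)
    have Wm [measurable]: "W \<in> borel_measurable borel" unfolding W_def[abs_def] by measurable
    have Wb: "\<bar>W x\<bar> \<le> (LINT l|lborel. \<bar>H l\<bar>)" for x
    proof -
      have "\<bar>W x\<bar> \<le> (LINT l|lborel. \<bar>H l * cos (l * x)\<bar>)" unfolding W_def by (rule integral_abs_bound)
      also have "\<dots> \<le> (LINT l|lborel. \<bar>H l\<bar>)"
        using H by (intro integral_mono integrable_abs Hi) (auto simp: abs_mult mult_left_le)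
      finally show ?thesis .
    qed
    \<comment> \<open>Multiplication by \<open>1 - r * exp (- e * \<psi> l)\<close> turns
      \<open>T l\<close> into \<open>e\<close>; so \<open>W\<close> is the potential of the charge
      \<open>e * k\<close> for the killed walk.\<close>
    have Weq: "W x = e * k x + r * (LINT z|P. W (x + z))" for x
    proof -
      have "(LINT z|P. W (x + z)) = (LINT l|lborel. H l * (cos (l * x) * exp (- e * \<psi> l)))"
        unfolding W_def by (rule fubini_cos[OF P H])
      moreover have "W x - r * (LINT l|lborel. H l * (cos (l * x) * exp (- e * \<psi> l))) =
          (LINT l|lborel. H l * cos (l * x) - r * (H l * (cos (l * x) * exp (- e * \<psi> l))))"
        unfolding W_def using psi_nonneg e
        by (subst Bochner_Integration.integral_diff) (auto intro!: Hi Hc integrable_mult_right)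
      moreover have "H l * cos (l * x) - r * (H l * (cos (l * x) * exp (- e * \<psi> l))) = e * (K l * cos (l * x))" for l
      proof -
        have re: "r * exp (- e * \<psi> l) = exp (- (e * (\<beta> + \<psi> l)))"
          by (simp add: r_def mult_exp_exp algebra_simps)
        have "1 - exp (- (e * (\<beta> + \<psi> l))) \<noteq> 0" using e bp[of l] by simp
        then have "T l * (1 - exp (- (e * (\<beta> + \<psi> l)))) = e" by (simp add: T_def)
        moreover have "H l * cos (l * x) - r * (H l * (cos (l * x) * exp (- e * \<psi> l))) =
            K l * cos (l * x) * (T l * (1 - r * exp (- e * \<psi> l)))" by (simp add: H_def algebra_simps)
        ultimately show ?thesis unfolding re by simp
      qed
      ultimately show ?thesis by (simp add: k_def)
    qed
    have ui: "integrable lborel (\<lambda>l. K l * cos (l * x) / (\<beta> + \<psi> l))" for x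
      by (rule cos_potential_integrable[OF \<beta> _ K(2)]) measurable
    have diff: "\<bar>W x - u x\<bar> \<le> e * J" for x
    proof -
      have Wu: "W x - u x = (LINT l|lborel. H l * cos (l * x) - K l * cos (l * x) / (\<beta> + \<psi> l))"
        unfolding W_def u_def cos_potential_def
        by (rule Bochner_Integration.integral_diff[OF Hi ui, symmetric])
      have "\<bar>W x - u x\<bar> \<le> (LINT l|lborel. \<bar>H l * cos (l * x) - K l * cos (l * x) / (\<beta> + \<psi> l)\<bar>)"
        unfolding Wu by (rule integral_abs_bound)
      also have "\<dots> \<le> (LINT l|lborel. e * \<bar>K l\<bar>)"
      proof (rule integral_mono)
        show "integrable lborel (\<lambda>l. \<bar>H l * cos (l * x) - K l * cos (l * x) / (\<beta> + \<psi> l)\<bar>)"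
          by (intro integrable_abs Bochner_Integration.integrable_diff Hi ui)
        show "integrable lborel (\<lambda>l. e * \<bar>K l\<bar>)" by (intro integrable_mult_right integrable_abs K)
        fix l
        have eq: "H l * cos (l * x) - K l * cos (l * x) / (\<beta> + \<psi> l) = (K l * cos (l * x)) * (T l - 1 / (\<beta> + \<psi> l))"
          by (simp add: H_def right_diff_distrib mult_ac)
        have "\<bar>K l * cos (l * x)\<bar> * \<bar>T l - 1 / (\<beta> + \<psi> l)\<bar> \<le> \<bar>K l\<bar> * e"
        proof (rule mult_mono)
          show "\<bar>K l * cos (l * x)\<bar> \<le> \<bar>K l\<bar>" by (simp add: abs_mult mult_left_le)
          show "\<bar>T l - 1 / (\<beta> + \<psi> l)\<bar> \<le> e" using T[of l] by linarith
        qed auto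
        then show "\<bar>H l * cos (l * x) - K l * cos (l * x) / (\<beta> + \<psi> l)\<bar> \<le> e * \<bar>K l\<bar>"
          unfolding eq abs_mult[of "K l * cos (l * x)"] mult.commute[of e] .
      qed
      also have "\<dots> = e * J" by (simp add: J_def)
      finally show ?thesis .
    qed
    define D where "D = (\<bar>a\<bar> + \<bar>b\<bar>) * (e * J)"
    have dd: "\<bar>(a * W x - b * W (x + y)) - (a * u x - b * u (x + y))\<bar> \<le> D" for x
    proof -
      have "\<bar>(a * W x - b * W (x + y)) - (a * u x - b * u (x + y))\<bar> =
          \<bar>a * (W x - u x) - b * (W (x + y) - u (x + y))\<bar>" by (simp add: algebra_simps)
      also have "\<dots> \<le> \<bar>a\<bar> * \<bar>W x - u x\<bar> + \<bar>b\<bar> * \<bar>W (x + y) - u (x + y)\<bar>"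
        using abs_triangle_ineq4[of "a * (W x - u x)" "b * (W (x + y) - u (x + y))"] by (simp add: abs_mult)
      also have "\<dots> \<le> \<bar>a\<bar> * (e * J) + \<bar>b\<bar> * (e * J)"
        by (intro add_mono mult_left_mono diff) auto
      finally show ?thesis by (simp add: D_def algebra_simps)
    qed
    have D0: "0 \<le> D" using e J by (simp add: D_def)
    define BH where "BH = (LINT l|lborel. \<bar>H l\<bar>)"
    have "a * W x - b * W (x + y) \<le> c + D"
    proof (rule walk_maximum_principle[where P = P and G = "\<lambda>x. a * W x - b * W (x + y)"
          and \<phi> = "\<lambda>x. a * (e * k x) - b * (e * k (x + y))" and r = r and B = "\<bar>a\<bar> * BH + \<bar>b\<bar> * BH"])
      show "prob_space P" by (rule P.prob_space_axioms)
      show "sets P = sets borel" by simp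
      show "(\<lambda>x. a * W x - b * W (x + y)) \<in> borel_measurable borel" by measurable
      show "0 \<le> r" "r < 1" by (fact r)+
      show "0 \<le> c + D" using c D0 by simp
      fix x
      have "\<bar>a * W x - b * W (x + y)\<bar> \<le> \<bar>a\<bar> * \<bar>W x\<bar> + \<bar>b\<bar> * \<bar>W (x + y)\<bar>"
        using abs_triangle_ineq4[of "a * W x" "b * W (x + y)"] by (simp add: abs_mult)
      also have "\<dots> \<le> \<bar>a\<bar> * BH + \<bar>b\<bar> * BH"
        unfolding BH_def by (intro add_mono mult_left_mono Wb) auto
      finally show "\<bar>a * W x - b * W (x + y)\<bar> \<le> \<bar>a\<bar> * BH + \<bar>b\<bar> * BH" .
      have iW: "integrable P (\<lambda>z. W (x + z))" for x
        by (rule P.integrable_const_bound[where B = BH]) (use Wb in \<open>auto simp: BH_def\<close>)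
      have "(LINT z|P. a * W (x + z) - b * W (x + z + y)) = a * (LINT z|P. W (x + z)) - b * (LINT z|P. W (x + y + z))"
        using iW[of x] iW[of "x + y"] by (simp add: add_ac)
      moreover have "a * W x = a * (e * k x) + r * (a * (LINT z|P. W (x + z)))" for a x
        by (subst Weq[of x]) (simp add: algebra_simps)
      from this[of a x] this[of b "x + y"]
      have "a * W x - b * W (x + y) = a * (e * k x) - b * (e * k (x + y)) +
          r * (a * (LINT z|P. W (x + z)) - b * (LINT z|P. W (x + y + z)))"
        unfolding right_diff_distrib by linarith
      ultimately show "a * W x - b * W (x + y) = a * (e * k x) - b * (e * k (x + y)) + r * (LINT z|P. a * W (x + z) - b * W (x + z + y))"
        by (simp only:)
      show "a * (e * k x) - b * (e * k (x + y)) \<le> 0 \<or> a * W x - b * W (x + y) \<le> c + D"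
      proof (cases "a * k x - b * k (x + y) \<le> 0")
        case True
        then have "e * (a * k x - b * k (x + y)) \<le> 0" using e by (simp add: mult_le_0_iff)
        then show ?thesis by (simp add: algebra_simps)
      next
        case False
        then have "a * u x - b * u (x + y) \<le> c" using sign[of x] by (simp add: k_def u_def)
        then show ?thesis using dd[of x] by linarith
      qed
    qed
    then have "a * u x - b * u (x + y) \<le> c + D + D" using dd[of x] by linarith
    then show ?thesis by (simp add: D_def C_def algebra_simps)
  qed
  show ?thesis
    unfolding u_def[symmetric]
  proof (rule field_le_epsilon)
    fix d :: real assume d: "0 < d"
    define e where "e = d / (C + 1)"
    have C: "0 \<le> C" using J by (simp add: C_def)
    have e: "0 < e" "e * C \<le> d" using d C by (simp_all add: e_def field_simps)
    show "a * u x - b * u (x + y) \<le> c + d" using key[OF e(1)] e(2) by linarith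
  qed
qed

end

section \<open>Fejer kernels as approximate point charges\<close>

text \<open>Normalised so as to lie below the indicator of the half-line and to increase it to full
  size as \<open>\<eta>\<close> tends to \<open>0\<close>, while the cosine transform is a
  nonnegative bump supported in \<open>[- \<eta>, \<eta>]\<close>.\<close>

definition tent_multiplier :: "real \<Rightarrow> real \<Rightarrow> real" where
  "tent_multiplier \<eta> l = indicator {0<..} l * (2 / \<eta>\<^sup>2 * ((1 - cos (l * \<eta>)) / l\<^sup>2))"

lemma tent_multiplier_measurable [measurable]: "tent_multiplier \<eta> \<in> borel_measurable borel"
  unfolding tent_multiplier_def[abs_def] by measurable

lemma tent_multiplier_bounds:
  assumes "0 < \<eta>"
  shows "0 \<le> tent_multiplier \<eta> l" "tent_multiplier \<eta> l \<le> indicator {0<..} l" "\<bar>tent_multiplier \<eta> l\<bar> \<le> 1"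
proof -
  show a: "0 \<le> tent_multiplier \<eta> l" using assms by (auto simp: tent_multiplier_def indicator_def)
  show b: "tent_multiplier \<eta> l \<le> indicator {0<..} l"
  proof (cases "0 < l")
    case True
    have "2 * (1 - cos (l * \<eta>)) \<le> (l * \<eta>)\<^sup>2" using one_minus_cos_le[of "l * \<eta>"] by simp
    then have "2 / \<eta>\<^sup>2 * ((1 - cos (l * \<eta>)) / l\<^sup>2) \<le> 1"
      using assms True by (simp add: field_simps power_mult_distrib)
    then show ?thesis using True by (simp add: tent_multiplier_def)
  qed (simp add: tent_multiplier_def)
  show "\<bar>tent_multiplier \<eta> l\<bar> \<le> 1" using a b by (cases "0 < l") auto
qed

lemma tent_multiplier_integrable:
  "integrable lborel (tent_multiplier \<eta>)"
proof -
  have "integrable lborel (\<lambda>l. 2 / \<eta>\<^sup>2 * (indicator {0<..} l * ((1 - cos (l * \<eta>)) / l\<^sup>2)))"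
    using integral_one_minus_cos(1)[of \<eta>] unfolding set_integrable_def by (intro integrable_mult_right) simp
  then show ?thesis by (simp add: tent_multiplier_def[abs_def] mult_ac)
qed

lemma tent_multiplier_transform:
  assumes "0 < \<eta>"
  shows "(LINT l|lborel. tent_multiplier \<eta> l * cos (l * x)) = pi / \<eta>\<^sup>2 * max 0 (\<eta> - \<bar>x\<bar>)"
proof -
  have "(LINT l|lborel. tent_multiplier \<eta> l * cos (l * x)) =
      (LINT l|lborel. 2 / \<eta>\<^sup>2 * (indicator {0<..} l * ((1 - cos (l * \<eta>)) / l\<^sup>2 * cos (l * x))))"
    by (simp add: tent_multiplier_def mult_ac)
  also have "\<dots> = 2 / \<eta>\<^sup>2 * (LBINT l:{0<..}. (1 - cos (l * \<eta>)) / l\<^sup>2 * cos (l * x))"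
    unfolding set_lebesgue_integral_def by (subst integral_mult_right_zero) simp
  also have "\<dots> = pi / \<eta>\<^sup>2 * max 0 (\<eta> - \<bar>x\<bar>)" unfolding tent_fourier[OF less_imp_le[OF assms]] by simp
  finally show ?thesis .
qed

lemma tent_multiplier_tendsto:
  "(\<lambda>n. tent_multiplier (1 / real (Suc n)) l) \<longlonglongrightarrow> indicator {0<..} l"
proof (cases "0 < l")
  case True
  have "((\<lambda>x. 2 * (1 - cos x) / x\<^sup>2) \<longlongrightarrow> 1) (at_right (0::real))" by real_asymp
  moreover have "filterlim (\<lambda>n. l * (1 / real (Suc n))) (at_right 0) sequentially" using True by real_asymp
  ultimately have "(\<lambda>n. 2 * (1 - cos (l * (1 / real (Suc n)))) / (l * (1 / real (Suc n)))\<^sup>2) \<longlonglongrightarrow> 1"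
    by (rule filterlim_compose)
  moreover have "tent_multiplier \<eta> l = 2 * (1 - cos (l * \<eta>)) / (l * \<eta>)\<^sup>2" for \<eta>
    using True by (simp add: tent_multiplier_def power_mult_distrib mult_ac)
  ultimately show ?thesis using True by (simp only:) simp
qed (simp add: tent_multiplier_def)

section \<open>Inequalities for the resolvent density\<close>

context levy_exponent
begin

abbreviation resolvent_density :: "real \<Rightarrow> real \<Rightarrow> real" where
  "resolvent_density \<equiv> cos_potential (indicator {0<..})"

lemma resolvent_denominator_pos: "0 < \<beta> \<Longrightarrow> 0 < \<beta> + \<psi> l"
  using psi_nonneg[of l] by simp

lemma resolvent_density_integrable:
  "0 < \<beta> \<Longrightarrow> integrable lborel (\<lambda>l. indicator {0<..} l * cos (l * x) / (\<beta> + \<psi> l))"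
  by (rule cos_potential_integrable) (auto simp: indicator_def)

lemma resolvent_density_le_zero:
  assumes \<beta>: "0 < \<beta>"
  shows "\<bar>resolvent_density \<beta> x\<bar> \<le> resolvent_density \<beta> 0"
proof -
  have "\<bar>resolvent_density \<beta> x\<bar> \<le> (LINT l|lborel. \<bar>indicator {0<..} l * cos (l * x) / (\<beta> + \<psi> l)\<bar>)"
    unfolding cos_potential_def by (rule integral_abs_bound)
  also have "\<dots> \<le> (LINT l|lborel. indicator {0<..} l * cos (l * 0) / (\<beta> + \<psi> l))"
  proof (intro integral_mono integrable_abs resolvent_density_integrable \<beta>)
    fix l
    have "\<bar>indicator {0<..} l * cos (l * x)\<bar> \<le> (indicator {0<..} l :: real)"
      by (auto simp: indicator_def)
    then show "\<bar>indicator {0<..} l * cos (l * x) / (\<beta> + \<psi> l)\<bar> \<le> indicator {0<..} l * cos (l * 0) / (\<beta> + \<psi> l)"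
      using resolvent_denominator_pos[OF \<beta>, of l] by (simp add: divide_right_mono)
  qed
  finally show ?thesis by (simp add: cos_potential_def)
qed

lemma resolvent_density_continuous:
  assumes \<beta>: "0 < \<beta>"
  shows "isCont (resolvent_density \<beta>) x"
  unfolding continuous_at_sequentially
proof (intro allI impI)
  fix X assume X: "X \<longlonglongrightarrow> x"
  show "(resolvent_density \<beta> \<circ> X) \<longlonglongrightarrow> resolvent_density \<beta> x"
    unfolding cos_potential_def comp_def
  proof (rule integral_dominated_convergence[where w = "\<lambda>l. 1 / (\<beta> + \<psi> l)"])
    show "integrable lborel (\<lambda>l. 1 / (\<beta> + \<psi> l))" by (rule resolvent_integrable[OF \<beta>])
    show "AE l in lborel. (\<lambda>n. indicator {0<..} l * cos (l * X n) / (\<beta> + \<psi> l)) \<longlonglongrightarrow> indicator {0<..} l * cos (l * x) / (\<beta> + \<psi> l)"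
    proof (rule AE_I2)
      fix l
      have "\<beta> + \<psi> l \<noteq> 0" using resolvent_denominator_pos[OF \<beta>, of l] by simp
      then show "(\<lambda>n. indicator {0<..} l * cos (l * X n) / (\<beta> + \<psi> l)) \<longlonglongrightarrow> indicator {0<..} l * cos (l * x) / (\<beta> + \<psi> l)"
        by (intro tendsto_intros X)
    qed
    show "AE l in lborel. norm (indicator {0<..} l * cos (l * X n) / (\<beta> + \<psi> l)) \<le> 1 / (\<beta> + \<psi> l)" for n
    proof (rule AE_I2)
      fix l
      have "\<bar>indicator {0<..} l * cos (l * X n)\<bar> \<le> (1 :: real)" by (auto simp: indicator_def)
      then show "norm (indicator {0<..} l * cos (l * X n) / (\<beta> + \<psi> l)) \<le> 1 / (\<beta> + \<psi> l)"
        using resolvent_denominator_pos[OF \<beta>, of l] by (simp add: divide_right_mono)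
    qed
  qed measurable
qed

text \<open>The error of the smoothed potential at \<open>x = 0\<close>. It dominates the error at
  every \<open>x\<close>, because the multiplier stays below the indicator and cosines are at most
  \<open>1\<close>.\<close>

definition tent_error :: "real \<Rightarrow> nat \<Rightarrow> real" where
  "tent_error \<beta> n = (LINT l|lborel. (indicator {0<..} l - tent_multiplier (1 / real (Suc n)) l) / (\<beta> + \<psi> l))"

lemma tent_error_tendsto:
  assumes \<beta>: "0 < \<beta>"
  shows "tent_error \<beta> \<longlonglongrightarrow> 0"
proof -
  have "(\<lambda>n. LINT l|lborel. (indicator {0<..} l - tent_multiplier (1 / real (Suc n)) l) / (\<beta> + \<psi> l)) \<longlonglongrightarrow> (LINT l|(lborel :: real measure). (0::real))"
  proof (rule integral_dominated_convergence[where w = "\<lambda>l. 1 / (\<beta> + \<psi> l)"])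
    show "integrable lborel (\<lambda>l. 1 / (\<beta> + \<psi> l))" by (rule resolvent_integrable[OF \<beta>])
    show "AE l in lborel. (\<lambda>n. (indicator {0<..} l - tent_multiplier (1 / real (Suc n)) l) / (\<beta> + \<psi> l)) \<longlonglongrightarrow> 0"
    proof (rule AE_I2)
      fix l
      have "\<beta> + \<psi> l \<noteq> 0" using resolvent_denominator_pos[OF \<beta>, of l] by simp
      then have "(\<lambda>n. (indicator {0<..} l - tent_multiplier (1 / real (Suc n)) l) / (\<beta> + \<psi> l)) \<longlonglongrightarrow> (indicator {0<..} l - indicator {0<..} l) / (\<beta> + \<psi> l)"
        by (intro tendsto_intros tent_multiplier_tendsto)
      then show "(\<lambda>n. (indicator {0<..} l - tent_multiplier (1 / real (Suc n)) l) / (\<beta> + \<psi> l)) \<longlonglongrightarrow> 0" by simp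
    qed
    show "AE l in lborel. norm ((indicator {0<..} l - tent_multiplier (1 / real (Suc n)) l) / (\<beta> + \<psi> l)) \<le> 1 / (\<beta> + \<psi> l)" for n
    proof (rule AE_I2)
      fix l
      have "0 \<le> tent_multiplier (1 / real (Suc n)) l" "tent_multiplier (1 / real (Suc n)) l \<le> indicator {0<..} l"
        by (rule tent_multiplier_bounds; simp)+
      then have "\<bar>indicator {0<..} l - tent_multiplier (1 / real (Suc n)) l\<bar> \<le> 1"
        by (cases "0 < l") auto
      then show "norm ((indicator {0<..} l - tent_multiplier (1 / real (Suc n)) l) / (\<beta> + \<psi> l)) \<le> 1 / (\<beta> + \<psi> l)"
        using resolvent_denominator_pos[OF \<beta>, of l] by (simp add: divide_right_mono)
    qed
  qed measurable
  then show ?thesis by (simp add: tent_error_def[abs_def])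
qed

lemma tent_potential_error:
  assumes \<beta>: "0 < \<beta>"
  shows "\<bar>cos_potential (tent_multiplier (1 / real (Suc n))) \<beta> x - resolvent_density \<beta> x\<bar> \<le> tent_error \<beta> n"
proof -
  let ?K = "tent_multiplier (1 / real (Suc n))"
  have K: "0 \<le> ?K l" "?K l \<le> indicator {0<..} l" "\<bar>?K l\<bar> \<le> 1" for l
    by (rule tent_multiplier_bounds; simp)+
  have i1: "integrable lborel (\<lambda>l. ?K l * cos (l * x) / (\<beta> + \<psi> l))" for x
    by (rule cos_potential_integrable[OF \<beta> _ K(3)]) measurable
  have i2: "integrable lborel (\<lambda>l. indicator {0<..} l * cos (l * x) / (\<beta> + \<psi> l))" for x
    by (rule resolvent_density_integrable[OF \<beta>])
  have eq: "cos_potential ?K \<beta> x - resolvent_density \<beta> x =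
      (LINT l|lborel. ?K l * cos (l * x) / (\<beta> + \<psi> l) - indicator {0<..} l * cos (l * x) / (\<beta> + \<psi> l))"
    unfolding cos_potential_def by (rule Bochner_Integration.integral_diff[OF i1 i2, symmetric])
  have "\<bar>cos_potential ?K \<beta> x - resolvent_density \<beta> x\<bar> \<le>
      (LINT l|lborel. \<bar>?K l * cos (l * x) / (\<beta> + \<psi> l) - indicator {0<..} l * cos (l * x) / (\<beta> + \<psi> l)\<bar>)"
    unfolding eq by (rule integral_abs_bound)
  also have "\<dots> \<le> tent_error \<beta> n"
    unfolding tent_error_def
  proof (rule integral_mono)
    show "integrable lborel (\<lambda>l. \<bar>?K l * cos (l * x) / (\<beta> + \<psi> l) - indicator {0<..} l * cos (l * x) / (\<beta> + \<psi> l)\<bar>)"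
      by (intro integrable_abs Bochner_Integration.integrable_diff i1 i2)
    have "integrable lborel (\<lambda>l. indicator {0<..} l * cos (l * 0) / (\<beta> + \<psi> l) - ?K l * cos (l * 0) / (\<beta> + \<psi> l))"
      by (intro Bochner_Integration.integrable_diff i1 i2)
    then show "integrable lborel (\<lambda>l. (indicator {0<..} l - ?K l) / (\<beta> + \<psi> l))"
      by (simp add: diff_divide_distrib)
    fix l
    have "?K l * cos (l * x) / (\<beta> + \<psi> l) - indicator {0<..} l * cos (l * x) / (\<beta> + \<psi> l) =
        - ((indicator {0<..} l - ?K l) * cos (l * x)) / (\<beta> + \<psi> l)"
      by (simp add: diff_divide_distrib left_diff_distrib)
    moreover have "\<bar>- ((indicator {0<..} l - ?K l) * cos (l * x)) / (\<beta> + \<psi> l)\<bar> \<le> (indicator {0<..} l - ?K l) / (\<beta> + \<psi> l)"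
    proof -
      have "\<bar>(indicator {0<..} l - ?K l) * cos (l * x)\<bar> \<le> indicator {0<..} l - ?K l"
        using K(2)[of l] by (simp add: abs_mult mult_left_le)
      then show ?thesis using resolvent_denominator_pos[OF \<beta>, of l] by (simp add: divide_right_mono)
    qed
    ultimately show "\<bar>?K l * cos (l * x) / (\<beta> + \<psi> l) - indicator {0<..} l * cos (l * x) / (\<beta> + \<psi> l)\<bar>
        \<le> (indicator {0<..} l - ?K l) / (\<beta> + \<psi> l)" by simp
  qed
  finally show ?thesis .
qed

text \<open>The negative of a tent has no positive part, so the maximum principle applies with
  \<open>c = 0\<close>.\<close>

lemma resolvent_density_nonneg:
  assumes \<beta>: "0 < \<beta>"
  shows "0 \<le> resolvent_density \<beta> x"
proof (rule LIMSEQ_le_const[where X = "\<lambda>n. resolvent_density \<beta> x + tent_error \<beta> n"])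
  show "(\<lambda>n. resolvent_density \<beta> x + tent_error \<beta> n) \<longlonglongrightarrow> resolvent_density \<beta> x"
    using tendsto_add[OF tendsto_const tent_error_tendsto[OF \<beta>], of "resolvent_density \<beta> x"] by simp
  show "\<exists>N. \<forall>n\<ge>N. 0 \<le> resolvent_density \<beta> x + tent_error \<beta> n"
  proof (intro exI allI impI)
    fix n :: nat
    let ?K = "tent_multiplier (1 / real (Suc n))"
    have "- 1 * cos_potential ?K \<beta> x - 0 * cos_potential ?K \<beta> (x + 0) \<le> 0"
    proof (rule potential_maximum_principle[OF \<beta> tent_multiplier_integrable])
      show "\<bar>?K l\<bar> \<le> 1" for l by (rule tent_multiplier_bounds) simp
    qed (simp_all add: tent_multiplier_transform)
    then show "0 \<le> resolvent_density \<beta> x + tent_error \<beta> n"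
      using tent_potential_error[OF \<beta>, of n x] by linarith
  qed
qed

text \<open>In probabilistic terms: \<open>u x / u 0\<close> is the probability of hitting \<open>x\<close>, and hitting \<open>x\<close>
  and then \<open>x + y\<close> is one way of hitting \<open>x + y\<close>. Analytically, both sides are potentials in \<open>x\<close>
  that agree at \<open>0\<close>, where the charge of the left one sits.\<close>

lemma resolvent_density_supermultiplicative:
  assumes \<beta>: "0 < \<beta>"
  shows "resolvent_density \<beta> x * resolvent_density \<beta> y \<le> resolvent_density \<beta> 0 * resolvent_density \<beta> (x + y)"
proof -
  define u where "u = resolvent_density \<beta>"
  define a where "a = u y"
  define b where "b = u 0"
  have u0: "0 \<le> u z" for z unfolding u_def by (rule resolvent_density_nonneg[OF \<beta>])
  have ab: "0 \<le> a" "0 \<le> b" by (simp_all add: a_def b_def u0)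
  have "a * u x - b * u (x + y) \<le> 0 + \<tau>" if \<tau>: "0 < \<tau>" for \<tau>
  proof -
    have "isCont (\<lambda>z. a * u z - b * u (z + y)) 0"
      unfolding u_def by (intro continuous_intros isCont_o2[OF _ resolvent_density_continuous[OF \<beta>]] resolvent_density_continuous[OF \<beta>])
    then have "((\<lambda>z. a * u z - b * u (z + y)) \<longlongrightarrow> a * u 0 - b * u (0 + y)) (at 0)" by (simp add: isCont_def)
    moreover have "a * u 0 - b * u (0 + y) = 0" by (simp add: a_def b_def)
    ultimately have "((\<lambda>z. a * u z - b * u (z + y)) \<longlongrightarrow> 0) (at 0)" by simp
    then obtain d where d: "0 < d" "\<And>z. z \<noteq> 0 \<Longrightarrow> \<bar>z\<bar> < d \<Longrightarrow> \<bar>a * u z - b * u (z + y)\<bar> < \<tau>"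
      using \<tau> unfolding LIM_eq by (metis diff_zero real_norm_def)
    \<comment> \<open>Smoothing spreads the charge at \<open>0\<close> over
      \<open>\<bar>z\<bar> < 1 / real (Suc n)\<close>. Continuity controls the potential there once
      this interval is shorter than \<open>d\<close>; outside it the charge is at most
      \<open>0\<close>.\<close>
    have near: "a * u z - b * u (z + y) \<le> \<tau>" if "\<bar>z\<bar> < d" for z
    proof (cases "z = 0")
      case True
      then show ?thesis using \<tau> by (simp add: a_def b_def)
    next
      case False
      then show ?thesis using d(2)[of z] that by linarith
    qed
    have bound: "a * u x - b * u (x + y) \<le> \<tau> + 2 * ((a + b) * tent_error \<beta> n)" if n: "1 / real (Suc n) < d" for n
    proof -
      let ?K = "tent_multiplier (1 / real (Suc n))"
      define w where "w = cos_potential ?K \<beta>"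
      have err: "\<bar>w z - u z\<bar> \<le> tent_error \<beta> n" for z
        unfolding w_def u_def by (rule tent_potential_error[OF \<beta>])
      then have e0: "0 \<le> tent_error \<beta> n" by (meson abs_ge_zero order_trans)
      have ed: "\<bar>(a * w z - b * w (z + y)) - (a * u z - b * u (z + y))\<bar> \<le> (a + b) * tent_error \<beta> n" for z
      proof -
        have "\<bar>a * (w z - u z)\<bar> \<le> a * tent_error \<beta> n" "\<bar>b * (w (z + y) - u (z + y))\<bar> \<le> b * tent_error \<beta> n"
          using ab err by (auto simp: abs_mult intro: mult_left_mono)
        then show ?thesis unfolding right_diff_distrib distrib_right by linarith
      qed
      have "a * w x - b * w (x + y) \<le> \<tau> + (a + b) * tent_error \<beta> n"
        unfolding w_def
      proof (rule potential_maximum_principle[OF \<beta> tent_multiplier_integrable])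
        show "\<bar>?K l\<bar> \<le> 1" for l by (rule tent_multiplier_bounds) simp
        show "0 \<le> \<tau> + (a + b) * tent_error \<beta> n" using \<tau> ab e0 by simp
        fix z
        show "a * (LINT l|lborel. ?K l * cos (l * z)) - b * (LINT l|lborel. ?K l * cos (l * (z + y))) \<le> 0
          \<or> a * cos_potential ?K \<beta> z - b * cos_potential ?K \<beta> (z + y) \<le> \<tau> + (a + b) * tent_error \<beta> n"
        proof (cases "\<bar>z\<bar> < 1 / real (Suc n)")
          case True
          then have "\<bar>z\<bar> < d" using n by linarith
          from near[OF this] show ?thesis using ed[of z] unfolding w_def by linarith
        next
          case False
          then have "(LINT l|lborel. ?K l * cos (l * z)) = 0" by (simp add: tent_multiplier_transform)
          moreover have "0 \<le> (LINT l|lborel. ?K l * cos (l * (z + y)))" by (simp add: tent_multiplier_transform)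
          ultimately show ?thesis using ab by simp
        qed
      qed
      then show ?thesis using ed[of x] by linarith
    qed
    have "(\<lambda>n. \<tau> + 2 * ((a + b) * tent_error \<beta> n)) \<longlonglongrightarrow> \<tau> + 2 * ((a + b) * 0)"
      by (intro tendsto_intros tent_error_tendsto \<beta>)
    then have "a * u x - b * u (x + y) \<le> \<tau> + 2 * ((a + b) * 0)"
    proof (rule LIMSEQ_le_const)
      have "eventually (\<lambda>n. 1 / real (Suc n) < d) sequentially"
        using d(1) by real_asymp
      then show "\<exists>N. \<forall>n\<ge>N. a * u x - b * u (x + y) \<le> \<tau> + 2 * ((a + b) * tent_error \<beta> n)"
        using bound unfolding eventually_sequentially by blast
    qed
    then show ?thesis by simp
  qed
  then have "a * u x - b * u (x + y) \<le> 0" by (rule field_le_epsilon)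
  then show ?thesis by (simp add: a_def b_def u_def mult.commute)
qed

text \<open>Expand \<open>(u 0 - u x) * (u 0 - u y) \<ge> 0\<close>, bound \<open>u x * u y\<close>
  by \<open>u 0 * u (x + y)\<close> and divide by \<open>u 0\<close>; if \<open>u 0 = 0\<close>,
  then \<open>u\<close> vanishes identically.\<close>

lemma resolvent_density_deficit_subadditive:
  assumes \<beta>: "0 < \<beta>"
  shows "resolvent_density \<beta> 0 - resolvent_density \<beta> (x + y) \<le>
    (resolvent_density \<beta> 0 - resolvent_density \<beta> x) + (resolvent_density \<beta> 0 - resolvent_density \<beta> y)"
proof -
  define u where "u = resolvent_density \<beta>"
  have le: "\<bar>u z\<bar> \<le> u 0" for z unfolding u_def by (rule resolvent_density_le_zero[OF \<beta>])
  show ?thesis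
  proof (cases "u 0 = 0")
    case True
    then have "u z = 0" for z using le[of z] by simp
    then show ?thesis by (simp add: u_def)
  next
    case False
    then have u0: "0 < u 0" using le[of 0] by simp
    have "0 \<le> (u 0 - u x) * (u 0 - u y)" using le[of x] le[of y] by (intro mult_nonneg_nonneg) auto
    moreover have "u x * u y \<le> u 0 * u (x + y)"
      unfolding u_def by (rule resolvent_density_supermultiplicative[OF \<beta>])
    ultimately have "u 0 * (u x + u y - u 0 - u (x + y)) \<le> 0" by (simp add: algebra_simps)
    then have "u x + u y - u 0 - u (x + y) \<le> 0" using u0 by (simp add: mult_le_0_iff)
    then show ?thesis by (simp add: u_def)
  qed
qed

end

section \<open>Subadditivity of the increment variance\<close>

context levy_exponent
begin

text \<open>If \<open>\<psi> p = 0\<close>, the law at time \<open>1\<close> is carried by the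
  points with \<open>cos (p * z) = 1\<close>. Then \<open>\<psi>\<close> has period
  \<open>p\<close>, and \<open>1 / (1 + \<psi>)\<close> cannot be integrable. Positivity is what
  lets \<open>1 / (\<beta> + \<psi> l)\<close> tend to \<open>1 / \<psi> l\<close> as
  \<open>\<beta>\<close> tends to \<open>0\<close>, division by zero being \<open>0\<close>.\<close>

lemma psi_pos:
  assumes p: "0 < p"
  shows "0 < \<psi> p"
proof (rule ccontr)
  assume "\<not> 0 < \<psi> p"
  then have z: "\<psi> p = 0" using psi_nonneg[of p] by simp
  obtain P where P: "real_distribution P" "\<And>l. char P l = complex_of_real (exp (- 1 * \<psi> l))"
    using laws[of 1] by auto
  interpret P: real_distribution P by (rule P(1))
  have ci: "integrable P (\<lambda>z. cos (l * z))" for l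
    by (rule P.integrable_const_bound[where B = 1]) auto
  have cc: "(LINT z|P. cos (l * z)) = exp (- \<psi> l)" for l
    using real_char_cos_sin(1)[OF P(1), of l "exp (- \<psi> l)"] P(2)[of l] by simp
  have "(LINT z|P. 1 - cos (p * z)) = 0"
    using cc[of p] z ci[of p] by (simp add: P.prob_space[simplified])
  then have AE1: "AE z in P. 1 - cos (p * z) = 0"
    by (subst (asm) integral_nonneg_eq_0_iff_AE) (use ci[of p] in auto)
  have per: "\<psi> (l + p) = \<psi> l" for l
  proof -
    have "(LINT z|P. cos ((l + p) * z)) = (LINT z|P. cos (l * z))"
    proof (rule integral_cong_AE)
      show "AE z in P. cos ((l + p) * z) = cos (l * z)"
        using AE1
      proof eventually_elim
        case (elim z)
        then have "cos (p * z) = 1" by simp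
        moreover from this have "sin (p * z) = 0" using sin_cos_squared_add[of "p * z"] by simp
        ultimately show ?case by (simp add: distrib_right cos_add)
      qed
    qed auto
    then show ?thesis by (simp add: cc)
  qed
  have pern: "\<psi> (l + real n * p) = \<psi> l" for l n
  proof (induction n)
    case (Suc n)
    have "\<psi> (l + real (Suc n) * p) = \<psi> ((l + real n * p) + p)" by (simp add: algebra_simps)
    then show ?case using per Suc by simp
  qed simp
  define w where "w l = 1 / (1 + \<psi> l)" for l
  have w0: "0 < w l" for l using psi_nonneg[of l] by (simp add: w_def add_pos_nonneg)
  have wint: "integrable lborel w" using psi_int by (simp add: w_def[abs_def])
  have [measurable]: "w \<in> borel_measurable borel" unfolding w_def[abs_def] by measurable
  \<comment> \<open>Periodicity makes all integrals over the half-lines beyond \<open>n * p\<close>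
    equal to \<open>I\<close>, whereas integrability makes them tend to \<open>0\<close>.\<close>
  define I where "I = (LINT l|lborel. indicator {0<..} l * w l)"
  have const: "(LINT l|lborel. indicator {real n * p<..} l * w l) = I" for n
  proof -
    have "(LINT l|lborel. indicator {real n * p<..} l * w l) =
        (LINT l|lborel. indicator {real n * p<..} (real n * p + 1 * l) * w (real n * p + 1 * l))"
      using lborel_integral_real_affine[of 1 "\<lambda>l. indicator {real n * p<..} l * w l" "real n * p"] by simp
    also have "\<dots> = I"
      unfolding I_def
    proof (rule Bochner_Integration.integral_cong[OF refl])
      fix l
      have "w (real n * p + 1 * l) = w l" using pern[of l n] by (simp add: w_def add.commute)
      moreover have "indicator {real n * p<..} (real n * p + 1 * l) = (indicator {0<..} l :: real)"
        by (simp add: indicator_def)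
      ultimately show "indicator {real n * p<..} (real n * p + 1 * l) * w (real n * p + 1 * l) = indicator {0<..} l * w l"
        by simp
    qed
    finally show ?thesis .
  qed
  have "(\<lambda>n. LINT l|lborel. indicator {real n * p<..} l * w l) \<longlonglongrightarrow> (LINT l|(lborel::real measure). (0::real))"
  proof (rule integral_dominated_convergence[where w = w])
    show "integrable lborel w" by (rule wint)
    show "AE l in lborel. (\<lambda>n. indicator {real n * p<..} l * w l) \<longlonglongrightarrow> 0"
    proof (rule AE_I2)
      fix l
      have "eventually (\<lambda>n. l < real n * p) sequentially" using p by real_asymp
      then have "eventually (\<lambda>n. indicator {real n * p<..} l * w l = 0) sequentially"
        by eventually_elim simp
      then show "(\<lambda>n. indicator {real n * p<..} l * w l) \<longlonglongrightarrow> 0" by (rule tendsto_eventually)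
    qed
    show "AE l in lborel. norm (indicator {real n * p<..} l * w l) \<le> w l" for n
      using w0 by (intro AE_I2) (auto simp: indicator_def less_imp_le)
  qed measurable
  then have "(\<lambda>n::nat. I) \<longlonglongrightarrow> 0" by (simp add: const)
  then have "I = 0" using LIMSEQ_unique tendsto_const by blast
  moreover have "integrable lborel (\<lambda>l. indicator {0<..} l * w l)"
    by (rule Bochner_Integration.integrable_bound[OF wint]) (use w0 in \<open>auto simp: indicator_def less_imp_le\<close>)
  ultimately have "AE l in lborel. indicator {0<..} l * w l = 0"
    unfolding I_def by (subst (asm) integral_nonneg_eq_0_iff_AE) (use w0 in \<open>auto simp: less_imp_le\<close>)
  then have "AE l in lborel. l \<notin> {0<..<1::real}"
  proof eventually_elim
    case (elim l)
    then show ?case using w0[of l] by (auto simp: indicator_def)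
  qed
  then have "{0<..<1::real} \<in> null_sets lborel" by (subst AE_iff_null_sets) auto
  then have "emeasure lborel {0<..<1::real} = 0" by (rule null_setsD1)
  then show False by simp
qed

lemma sigma0_sq_zero: "sigma0_sq \<psi> 0 = 0"
  by (simp add: sigma0_sq_def set_lebesgue_integral_def)

lemma sigma0_sq_even: "sigma0_sq \<psi> (- x) = sigma0_sq \<psi> x"
  by (simp add: sigma0_sq_def)

lemma sigma0_sq_nonneg: "0 \<le> sigma0_sq \<psi> x"
  unfolding sigma0_sq_def set_lebesgue_integral_def
  using psi_nonneg by (intro mult_nonneg_nonneg integral_nonneg_AE AE_I2) (auto simp: indicator_def)

section \<open>Finiteness of the integral that defines the variance\<close>

text \<open>A function that is not integrable has integral \<open>0\<close> by convention, so a
  nonzero value certifies integrability.\<close>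

lemma sigma0_sq_pos_imp_integrable:
  assumes "sigma0_sq \<psi> x \<noteq> 0"
  shows "set_integrable lborel {0<..} (\<lambda>l. (1 - cos (l * x)) / \<psi> l)"
proof (rule ccontr)
  assume "\<not> ?thesis"
  then have "(LBINT l:{0<..}. (1 - cos (l * x)) / \<psi> l) = 0"
    unfolding set_integrable_def set_lebesgue_integral_def by (rule not_integrable_integral_eq)
  then show False using assms by (simp add: sigma0_sq_def)
qed

lemma integrable_double:
  assumes "set_integrable lborel {0<..} (\<lambda>l. (1 - cos (l * x)) / \<psi> l)"
  shows "set_integrable lborel {0<..} (\<lambda>l. (1 - cos (l * (2 * x))) / \<psi> l)"
  unfolding set_integrable_def
proof (rule Bochner_Integration.integrable_bound)
  show "integrable lborel (\<lambda>l. 4 * (indicator {0<..} l *\<^sub>R ((1 - cos (l * x)) / \<psi> l)))"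
    using assms unfolding set_integrable_def by (rule integrable_mult_right)
  show "AE l in lborel. norm (indicator {0<..} l *\<^sub>R ((1 - cos (l * (2 * x))) / \<psi> l))
      \<le> norm (4 * (indicator {0<..} l *\<^sub>R ((1 - cos (l * x)) / \<psi> l)))"
  proof (rule AE_I2)
    fix l
    define t where "t = cos (l * x)"
    have t: "- 1 \<le> t" "t \<le> 1" by (simp_all add: t_def)
    have "1 - cos (l * (2 * x)) = 2 * ((1 - t) * (1 + t))"
      using cos_double_cos[of "l * x"] by (simp add: t_def algebra_simps power2_eq_square)
    also have "\<dots> \<le> 2 * ((1 - t) * 2)" using t by (intro mult_left_mono) auto
    finally have "1 - cos (l * (2 * x)) \<le> 4 * (1 - cos (l * x))" by (simp add: t_def)
    then have "(1 - cos (l * (2 * x))) / \<psi> l \<le> 4 * (1 - cos (l * x)) / \<psi> l"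
      using psi_nonneg by (rule divide_right_mono)
    then show "norm (indicator {0<..} l *\<^sub>R ((1 - cos (l * (2 * x))) / \<psi> l))
      \<le> norm (4 * (indicator {0<..} l *\<^sub>R ((1 - cos (l * x)) / \<psi> l)))"
      using psi_nonneg[of l] by (simp add: indicator_def)
  qed
qed measurable

text \<open>Regular variation makes \<open>sigma0_sq\<close> positive near \<open>0\<close>, which
  certifies integrability there; doubling, through
  \<open>1 - cos (2 * t) \<le> 4 * (1 - cos t)\<close>, carries it to every
  \<open>x\<close>.\<close>

lemma integrable_all:
  assumes d: "0 < d" "\<And>x. 0 < x \<Longrightarrow> x < d \<Longrightarrow> sigma0_sq \<psi> x \<noteq> 0"
  shows "set_integrable lborel {0<..} (\<lambda>l. (1 - cos (l * x)) / \<psi> l)"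
proof -
  have pos: "set_integrable lborel {0<..} (\<lambda>l. (1 - cos (l * x)) / \<psi> l)" if x: "0 < x" for x
  proof -
    obtain n where n: "(1/2) ^ n < d / x" using real_arch_pow_inv[of "d / x" "1/2"] d x by auto
    have "set_integrable lborel {0<..} (\<lambda>l. (1 - cos (l * (2 ^ k * (x / 2 ^ n)))) / \<psi> l)" for k
    proof (induction k)
      case 0
      have "x / 2 ^ n < d" using n x by (simp add: power_one_over field_simps)
      then show ?case using x by (intro sigma0_sq_pos_imp_integrable d) auto
    next
      case (Suc k)
      then show ?case using integrable_double[OF Suc] by (simp add: mult.assoc)
    qed
    from this[of n] show ?thesis by simp
  qed
  show ?thesis
  proof (cases x "0::real" rule: linorder_cases)
    case less
    then show ?thesis using pos[of "- x"] by simp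
  next
    case equal
    then show ?thesis by (simp add: set_integrable_def)
  qed (rule pos)
qed

text \<open>The order of the resolvent tends to \<open>0\<close> in the deficit inequality.
  Dominated convergence applies because the integrands lie below their integrable limit.\<close>

lemma sigma0_sq_subadditive:
  assumes int: "\<And>x. set_integrable lborel {0<..} (\<lambda>l. (1 - cos (l * x)) / \<psi> l)"
  shows "sigma0_sq \<psi> (x + y) \<le> sigma0_sq \<psi> x + sigma0_sq \<psi> y"
proof -
  define h where "h n x = resolvent_density (1 / real (Suc n)) 0 - resolvent_density (1 / real (Suc n)) x" for n x
  define S where "S x = (LBINT l:{0<..}. (1 - cos (l * x)) / \<psi> l)" for x
  have lim: "(\<lambda>n. h n x) \<longlonglongrightarrow> S x" for x
  proof -
    have eq: "h n x = (LINT l|lborel. indicator {0<..} l * (1 - cos (l * x)) / (1 / real (Suc n) + \<psi> l))" for n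
    proof -
      have \<beta>: "0 < 1 / real (Suc n)" by simp
      have "h n x = (LINT l|lborel. indicator {0<..} l * cos (l * 0) / (1 / real (Suc n) + \<psi> l)
          - indicator {0<..} l * cos (l * x) / (1 / real (Suc n) + \<psi> l))"
        unfolding h_def cos_potential_def
        by (rule Bochner_Integration.integral_diff[OF resolvent_density_integrable[OF \<beta>] resolvent_density_integrable[OF \<beta>], symmetric])
      then show ?thesis by (simp add: diff_divide_distrib right_diff_distrib)
    qed
    show ?thesis
      unfolding eq S_def set_lebesgue_integral_def
    proof (rule integral_dominated_convergence[where w = "\<lambda>l. indicator {0<..} l *\<^sub>R ((1 - cos (l * x)) / \<psi> l)"])
      show "integrable lborel (\<lambda>l. indicator {0<..} l *\<^sub>R ((1 - cos (l * x)) / \<psi> l))"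
        using int[of x] by (simp add: set_integrable_def)
      show "AE l in lborel. (\<lambda>n. indicator {0<..} l * (1 - cos (l * x)) / (1 / real (Suc n) + \<psi> l))
          \<longlonglongrightarrow> indicator {0<..} l *\<^sub>R ((1 - cos (l * x)) / \<psi> l)"
      proof (rule AE_I2)
        fix l
        show "(\<lambda>n. indicator {0<..} l * (1 - cos (l * x)) / (1 / real (Suc n) + \<psi> l))
          \<longlonglongrightarrow> indicator {0<..} l *\<^sub>R ((1 - cos (l * x)) / \<psi> l)"
        proof (cases "0 < l")
          case True
          have "(\<lambda>n. 1 / real (Suc n) + \<psi> l) \<longlonglongrightarrow> \<psi> l" by real_asymp
          moreover have "\<psi> l \<noteq> 0" using psi_pos[OF True] by simp
          ultimately have "(\<lambda>n. (1 - cos (l * x)) / (1 / real (Suc n) + \<psi> l)) \<longlonglongrightarrow> (1 - cos (l * x)) / \<psi> l"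
            by (intro tendsto_divide tendsto_const)
          then show ?thesis using True by simp
        qed simp
      qed
      show "AE l in lborel. norm (indicator {0<..} l * (1 - cos (l * x)) / (1 / real (Suc n) + \<psi> l))
          \<le> indicator {0<..} l *\<^sub>R ((1 - cos (l * x)) / \<psi> l)" for n
      proof (rule AE_I2)
        fix l
        show "norm (indicator {0<..} l * (1 - cos (l * x)) / (1 / real (Suc n) + \<psi> l))
          \<le> indicator {0<..} l *\<^sub>R ((1 - cos (l * x)) / \<psi> l)"
        proof (cases "0 < l")
          case True
          have "(1 - cos (l * x)) / (1 / real (Suc n) + \<psi> l) \<le> (1 - cos (l * x)) / \<psi> l"
            using psi_pos[OF True] by (intro divide_left_mono mult_pos_pos add_pos_pos) auto
          moreover have "0 \<le> (1 - cos (l * x)) / (1 / real (Suc n) + \<psi> l)"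
            using psi_pos[OF True] by (intro divide_nonneg_nonneg add_nonneg_nonneg) auto
          moreover have "indicator {0<..} l * (1 - cos (l * x)) / (1 / real (Suc n) + \<psi> l) = (1 - cos (l * x)) / (1 / real (Suc n) + \<psi> l)"
            "indicator {0<..} l *\<^sub>R ((1 - cos (l * x)) / \<psi> l) = (1 - cos (l * x)) / \<psi> l"
            using True by simp_all
          ultimately show ?thesis by (simp only: real_norm_def abs_of_nonneg)
        qed simp
      qed
    qed measurable
  qed
  have "S (x + y) \<le> S x + S y"
  proof (rule LIMSEQ_le[OF lim tendsto_add[OF lim lim]])
    show "\<exists>N. \<forall>n\<ge>N. h n (x + y) \<le> h n x + h n y"
      unfolding h_def using resolvent_density_deficit_subadditive by simp
  qed
  then have "2 / pi * S (x + y) \<le> 2 / pi * (S x + S y)" by (intro mult_left_mono) auto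
  then show ?thesis by (simp add: sigma0_sq_def S_def distrib_left)
qed

end

section \<open>From the hypotheses to the gauge\<close>

lemma levy_exponentI:
  assumes Z: "symmetric_levy_process N Z" and ch: "has_char_exponent N Z \<psi>"
    and int: "integrable lborel (\<lambda>l. 1 / (1 + \<psi> l))"
  shows "levy_exponent \<psi>"
proof -
  have N: "prob_space N" and Zm: "\<And>t. 0 \<le> t \<Longrightarrow> Z t \<in> borel_measurable N"
    using Z by (auto simp: symmetric_levy_process_def levy_process_def)
  have rd: "real_distribution (distr N borel (Z t))" if "0 \<le> t" for t
    using prob_space.real_distribution_distr[OF N Zm[OF that]] .
  have C: "char (distr N borel (Z t)) l = complex_of_real (exp (- t * \<psi> l))" if "0 \<le> t" for t l
    using ch that by (simp add: has_char_exponent_def)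
  show ?thesis
  proof
    show nn: "0 \<le> \<psi> l" for l
    proof -
      interpret real_distribution "distr N borel (Z 1)" by (rule rd) simp
      have "norm (char (distr N borel (Z 1)) l) \<le> 1" by (rule cmod_char_le_1)
      then show ?thesis using C[of 1 l] by (simp add: norm_of_real)
    qed
    have "(\<lambda>l. 1 / (1 / (1 + \<psi> l)) - 1) \<in> borel_measurable borel"
      using borel_measurable_integrable[OF int] by measurable
    then show "\<psi> \<in> borel_measurable borel" by simp
    show "integrable lborel (\<lambda>l. 1 / (1 + \<psi> l))" by (rule int)
    show "\<exists>P. real_distribution P \<and> (\<forall>l. char P l = complex_of_real (exp (- e * \<psi> l)))" if "0 < e" for e
      using rd[of e] C[of e] that by (intro exI[of _ "distr N borel (Z e)"]) auto
  qed
qed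

lemma sigma0_sq_has_derivative:
  assumes C1: "sigma0 \<psi> C1_differentiable_on {0<..}"
    and nn: "\<And>x. 0 \<le> sigma0_sq \<psi> x" and even: "\<And>x. sigma0_sq \<psi> (- x) = sigma0_sq \<psi> x"
    and x: "x \<noteq> 0"
  shows "(sigma0_sq \<psi> has_real_derivative deriv (sigma0_sq \<psi>) x) (at x)"
proof -
  have sq: "sigma0_sq \<psi> = (\<lambda>x. (sigma0 \<psi> x)\<^sup>2)" using nn by (simp add: sigma0_def fun_eq_iff)
  have pos: "\<exists>D. (sigma0_sq \<psi> has_real_derivative D) (at y)" if y: "0 < y" for y
  proof -
    obtain D where "(sigma0 \<psi> has_vector_derivative D) (at y)"
      using C1 y unfolding C1_differentiable_on_def by auto
    then have "(sigma0 \<psi> has_real_derivative D) (at y)"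
      by (simp add: has_real_derivative_iff_has_vector_derivative)
    then have "((\<lambda>x. (sigma0 \<psi> x)\<^sup>2) has_real_derivative 2 * sigma0 \<psi> y * D) (at y)"
      by (auto intro!: derivative_eq_intros)
    then show ?thesis unfolding sq by blast
  qed
  have "\<exists>D. (sigma0_sq \<psi> has_real_derivative D) (at x)"
  proof (cases "0 < x")
    case True
    then show ?thesis by (rule pos)
  next
    case False
    then have "0 < - x" using x by simp
    then obtain D where "(sigma0_sq \<psi> has_real_derivative D) (at (- x))" using pos by blast
    then have "((\<lambda>z. sigma0_sq \<psi> (- z)) has_real_derivative D * - 1) (at x)"
      by (rule DERIV_chain2) (auto intro!: derivative_eq_intros)
    then show ?thesis unfolding even by blast
  qed
  then show ?thesis using DERIV_imp_deriv by blast
qed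

text \<open>Every small \<open>y\<close> is \<open>x / 2 ^ k\<close> with \<open>k\<close> large and
  \<open>x\<close> in \<open>[x0 / 2, x0]\<close>, a compact interval on which \<open>g\<close> is
  bounded. This supplies continuity of \<open>sigma0_sq\<close> at \<open>0\<close>; elsewhere it
  follows from differentiability.\<close>

lemma tendsto_zero_of_half_contraction:
  fixes g :: "real \<Rightarrow> real"
  assumes x0: "0 < x0" and r: "0 \<le> r" "r < 1" and nn: "\<And>x. 0 \<le> g x"
    and cont: "continuous_on {x0 / 2..x0} g"
    and half: "\<And>x. 0 < x \<Longrightarrow> x \<le> x0 \<Longrightarrow> g (x / 2) \<le> r * g x"
  shows "(g \<longlongrightarrow> 0) (at_right 0)"
proof -
  have "compact (g ` {x0 / 2..x0})" by (intro compact_continuous_image cont) simp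
  then have "bdd_above (g ` {x0 / 2..x0})" by (intro bounded_imp_bdd_above compact_imp_bounded)
  then obtain B where B: "\<And>x. x \<in> {x0 / 2..x0} \<Longrightarrow> g x \<le> B" unfolding bdd_above_def by blast
  have B0: "0 \<le> B" using B[of x0] nn[of x0] x0 by simp
  have iter: "g (x / 2 ^ n) \<le> r ^ n * g x" if x: "0 < x" "x \<le> x0" for x n
  proof (induction n)
    case (Suc n)
    have "x / 2 ^ n \<le> x" using x by (simp add: field_simps)
    then have "g (x / 2 ^ n / 2) \<le> r * g (x / 2 ^ n)" using x by (intro half) auto
    also have "\<dots> \<le> r * (r ^ n * g x)" using r by (intro mult_left_mono Suc) auto
    finally show ?case by (simp add: field_simps)
  qed simp
  show ?thesis
  proof (rule tendstoI)
    fix e :: real assume e: "0 < e"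
    have "(\<lambda>n. r ^ n * B) \<longlonglongrightarrow> 0 * B" using r by (intro tendsto_mult_right LIMSEQ_realpow_zero)
    then have "eventually (\<lambda>n. r ^ n * B < e) sequentially" using e by (intro order_tendstoD) auto
    then obtain N where N: "\<And>n. n \<ge> N \<Longrightarrow> r ^ n * B < e" by (auto simp: eventually_sequentially)
    have "dist (g y) 0 < e" if y: "0 < y" "y < x0 * (1/2) ^ N" for y
    proof -
      obtain k where k: "N \<le> k" "(1/2) ^ Suc k < y / x0" "y / x0 \<le> (1/2) ^ k"
        by (rule geometric_bracket[of "1/2" "y / x0" N]) (use y x0 in \<open>auto simp: field_simps\<close>)
      define x where "x = y * 2 ^ k"
      have x: "x \<in> {x0 / 2..x0}" "0 < x" using k(2,3) x0 y by (auto simp: x_def field_simps)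
      have "g y = g (x / 2 ^ k)" by (simp add: x_def)
      also have "\<dots> \<le> r ^ k * g x" using x by (intro iter) auto
      also have "\<dots> \<le> r ^ k * B" using r x by (intro mult_left_mono B) auto
      also have "\<dots> < e" by (rule N[OF k(1)])
      finally show ?thesis using nn[of y] by simp
    qed
    then show "eventually (\<lambda>y. dist (g y) 0 < e) (at_right 0)"
      unfolding eventually_at_right_field using x0 by (intro exI[of _ "x0 * (1/2) ^ N"]) auto
  qed
qed

lemma sigma0_sq_gauge:
  assumes L: "levy_exponent \<psi>" and C1: "sigma0 \<psi> C1_differentiable_on {0<..}"
    and rv: "0 < \<rho>" "regularly_varying_at_zero (sigma0 \<psi>) \<rho>"
  obtains x0 q where "subadditive_gauge (sigma0_sq \<psi>) x0 q"
proof -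
  interpret levy_exponent \<psi> by fact
  define g where "g = sigma0_sq \<psi>"
  obtain d where d: "0 < d" "\<And>x. 0 < x \<Longrightarrow> x < d \<Longrightarrow> 0 < sigma0 \<psi> x"
    using rv(2) unfolding regularly_varying_at_zero_def by auto
  have gpos: "0 < g x" if "0 < x" "x < d" for x
    using d(2)[OF that] by (simp add: sigma0_def g_def)
  have int: "set_integrable lborel {0<..} (\<lambda>l. (1 - cos (l * x)) / \<psi> l)" for x
    using gpos by (intro integrable_all[OF d(1)]) (auto simp: g_def less_imp_neq[symmetric])
  have sub: "g (x + y) \<le> g x + g y" for x y unfolding g_def by (rule sigma0_sq_subadditive[OF int])
  have nn: "0 \<le> g x" for x by (simp add: g_def sigma0_sq_nonneg)
  have even: "g (- x) = g x" for x by (simp add: g_def sigma0_sq_even)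
  have g0: "g 0 = 0" by (simp add: g_def sigma0_sq_zero)
  define s where "s = (1/2) powr \<rho>"
  \<comment> \<open>Any number strictly between the limiting ratio \<open>s\<close> and
    \<open>1\<close> would do; that \<open>s < 1\<close> is where the index has to be
    positive.\<close>
  define q where "q = (1 + s) / 2"
  have s: "0 < s" "s < 1" using powr_less_mono2[of \<rho> "1/2" 1] rv(1) by (auto simp: s_def)
  have q: "0 < q" "q < 1" "s < q" using s by (auto simp: q_def)
  have "((\<lambda>x. sigma0 \<psi> (1/2 * x) / sigma0 \<psi> x) \<longlongrightarrow> s) (at_right 0)"
    unfolding s_def using rv(2)[unfolded regularly_varying_at_zero_def, THEN conjunct2, THEN spec, of "1/2"] by (rule mp) simp
  then have "eventually (\<lambda>x. sigma0 \<psi> (1/2 * x) / sigma0 \<psi> x < q) (at_right 0)"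
    using q(3) by (rule order_tendstoD)
  then obtain d' where d': "0 < d'" "\<And>x. 0 < x \<Longrightarrow> x < d' \<Longrightarrow> sigma0 \<psi> (1/2 * x) / sigma0 \<psi> x < q"
    unfolding eventually_at_right_field by auto
  \<comment> \<open>Half of the smaller threshold, so that the closed range up to \<open>x0\<close>
    stays inside the open ranges of \<open>d\<close> and \<open>d'\<close>.\<close>
  define x0 where "x0 = min (1/2) (min d d' / 2)"
  have x0: "0 < x0" "x0 \<le> 1" "x0 < d" "x0 < d'" using d d' by (auto simp: x0_def min_def)
  have half: "g (x / 2) \<le> q\<^sup>2 * g x" if x: "0 < x" "x \<le> x0" for x
  proof -
    have sx: "0 < sigma0 \<psi> x" using d(2)[of x] x x0 by simp
    have "sigma0 \<psi> (x / 2) < q * sigma0 \<psi> x"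
      using d'(2)[of x] x x0 sx by (simp add: pos_divide_less_eq)
    moreover have "0 \<le> sigma0 \<psi> (x / 2)" by (simp add: sigma0_def sigma0_sq_nonneg)
    ultimately have "(sigma0 \<psi> (x / 2))\<^sup>2 \<le> (q * sigma0 \<psi> x)\<^sup>2" by (intro power_mono) auto
    then show ?thesis by (simp add: sigma0_def g_def sigma0_sq_nonneg power_mult_distrib)
  qed
  have q2: "0 \<le> q\<^sup>2" "q\<^sup>2 < 1" using q by (simp_all add: power_less_one_iff)
  have der: "(g has_real_derivative deriv g x) (at x)" if "x \<noteq> 0" for x
    unfolding g_def by (rule sigma0_sq_has_derivative[OF C1 sigma0_sq_nonneg sigma0_sq_even that])
  have cont: "continuous_on {x0 / 2..x0} g"
    using x0 by (intro continuous_at_imp_continuous_on ballI DERIV_isCont[OF der]) auto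
  have lim: "(g \<longlongrightarrow> 0) (at_right 0)"
    by (rule tendsto_zero_of_half_contraction[where g = g, OF x0(1) q2 nn cont half])
  have "((\<lambda>x. g (- x)) \<longlongrightarrow> 0) (at_right 0)" using lim by (simp add: even)
  then have "(g \<longlongrightarrow> 0) (at_left 0)" by (subst at_left_minus) (simp add: filterlim_filtermap)
  then have "isCont g 0" using lim g0 by (simp add: isCont_def filterlim_split_at)
  then have "continuous_on UNIV g"
    using DERIV_isCont[OF der] by (intro continuous_at_imp_continuous_on ballI) (metis)
  then show thesis
    using sub nn even g0 x0 q half gpos
    by (intro that[of x0 q] subadditive_gauge.intro) (auto simp: g_def[symmetric])
qed

section \<open>The kernel on the diagonal\<close>

context subadditive_gauge
begin

lemma gauge_green_bounds:
  "0 \<le> g x / 2 + g y / 2 - g (x - y) / 2" "g x / 2 + g y / 2 - g (x - y) / 2 \<le> g y"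
proof -
  show "0 \<le> g x / 2 + g y / 2 - g (x - y) / 2"
    using g_subadd[of x "- y"] g_even[of y] by simp
  show "g x / 2 + g y / 2 - g (x - y) / 2 \<le> g y"
    using g_subadd[of "x - y" y] by simp
qed

lemma g_measurable [measurable]: "g \<in> borel_measurable borel"
  by (rule borel_measurable_continuous_onI[OF g_cont])

end

locale gauge_potential = subadditive_gauge g x0 q + finite_measure \<mu>
  for g :: "real \<Rightarrow> real" and x0 q and \<mu> :: "real measure" +
  assumes sets_mu: "sets \<mu> = sets (restrict_space borel (- {0::real}))"
begin

lemma space_mu: "space \<mu> = - {0}"
  using sets_eq_imp_space_eq[OF sets_mu] by (simp add: space_restrict_space)

lemma borel_imp_mu_measurable: "h \<in> borel_measurable borel \<Longrightarrow> (h :: real \<Rightarrow> real) \<in> borel_measurable \<mu>"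
  unfolding measurable_cong_sets[OF sets_mu refl] by (rule measurable_restrict_space1)

definition potential :: "real \<Rightarrow> real" where
  "potential y = (LINT x|\<mu>. g x / 2 + g y / 2 - g (x - y) / 2)"

lemma green_integrable: "integrable \<mu> (\<lambda>x. g x / 2 + g y / 2 - g (x - y) / 2)"
proof (rule integrable_const_bound[where B = "g y"])
  show "AE x in \<mu>. norm (g x / 2 + g y / 2 - g (x - y) / 2) \<le> g y"
    using gauge_green_bounds[of _ y] by (intro AE_I2) (simp add: abs_of_nonneg)
  show "(\<lambda>x. g x / 2 + g y / 2 - g (x - y) / 2) \<in> borel_measurable \<mu>"
    by (rule borel_imp_mu_measurable) measurable
qed

lemma potential_nonneg: "0 \<le> potential y"
  unfolding potential_def by (intro integral_nonneg_AE AE_I2 gauge_green_bounds)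

lemma potential_zero: "potential 0 = 0"
  by (simp add: potential_def)

text \<open>Pointwise in \<open>x\<close>, the differences \<open>g s - g t\<close> and
  \<open>g (x - s) - g (x - t)\<close> are both at most \<open>g (s - t)\<close> in absolute value,
  and each carries the weight \<open>1/2\<close>.\<close>

lemma potential_diff: "\<bar>potential s - potential t\<bar> \<le> measure \<mu> (space \<mu>) * g (s - t)"
proof -
  let ?G = "\<lambda>y x. g x / 2 + g y / 2 - g (x - y) / 2"
  have eq: "potential s - potential t = (LINT x|\<mu>. ?G s x - ?G t x)"
    unfolding potential_def by (rule Bochner_Integration.integral_diff[OF green_integrable green_integrable, symmetric])
  have "\<bar>potential s - potential t\<bar> \<le> (LINT x|\<mu>. \<bar>?G s x - ?G t x\<bar>)"
    unfolding eq by (rule integral_abs_bound)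
  also have "\<dots> \<le> (LINT x|\<mu>. g (s - t))"
  proof (rule integral_mono)
    show "integrable \<mu> (\<lambda>x. \<bar>?G s x - ?G t x\<bar>)"
      by (intro integrable_abs Bochner_Integration.integrable_diff green_integrable)
    fix x
    have "\<bar>g s - g t\<bar> \<le> g (s - t)" "\<bar>g (x - s) - g (x - t)\<bar> \<le> g (s - t)"
      using g_diff_le[of s t] g_diff_le[of "x - s" "x - t"] g_even[of "s - t"] by simp_all
    then show "\<bar>?G s x - ?G t x\<bar> \<le> g (s - t)" by linarith
  qed simp
  finally show ?thesis by (simp add: mult.commute)
qed

text \<open>Dividing by \<open>a t\<close> splits the potential into half the mass times
  \<open>g t / a t\<close> and half the integral of \<open>(g x - g (x - t)) / a t\<close>. The
  integrand is \<open>t / a t\<close> times a difference quotient of \<open>g\<close>, so it tends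
  to \<open>\<kappa> * g' x\<close>. The two growth regimes are \<open>\<kappa> = 0\<close> and
  \<open>\<kappa> = 1 / C\<close>.\<close>

lemma potential_asymptotics:
  assumes der: "\<And>x. x \<noteq> 0 \<Longrightarrow> (g has_real_derivative g' x) (at x)"
    and ga: "((\<lambda>t. g t / a t) \<longlongrightarrow> 1) (at_right 0)" and ta: "((\<lambda>t. t / a t) \<longlongrightarrow> \<kappa>) (at_right 0)"
  shows "((\<lambda>t. (g t + potential t) / a t) \<longlongrightarrow> 1 + measure \<mu> (space \<mu>) / 2 + \<kappa> / 2 * (LINT x|\<mu>. g' x)) (at_right 0)"
  unfolding tendsto_at_iff_sequentially comp_def
proof (intro allI impI)
  fix T :: "nat \<Rightarrow> real"
  assume T: "\<forall>i. T i \<in> {0<..} - {0}" "T \<longlonglongrightarrow> 0"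
  let ?m = "measure \<mu> (space \<mu>)"
  have Tpos: "0 < T n" for n using T(1) by auto
  have ga': "(\<lambda>n. g (T n) / a (T n)) \<longlonglongrightarrow> 1" and ta': "(\<lambda>n. T n / a (T n)) \<longlonglongrightarrow> \<kappa>"
    using ga ta T unfolding tendsto_at_iff_sequentially comp_def by blast+
  \<comment> \<open>The dominating constant: by subadditivity the integrand is at most
    \<open>\<bar>g t / a t\<bar>\<close>, which converges along the sequence.\<close>
  obtain B where B: "\<And>n. \<bar>g (T n) / a (T n)\<bar> \<le> B"
    using convergent_imp_Bseq[OF convergentI[OF ga']] unfolding Bseq_def real_norm_def by blast
  have m1: "(\<lambda>x. (g x - g (x - t)) / b) \<in> borel_measurable \<mu>" for t b
    by (rule borel_imp_mu_measurable) measurable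
  have bd: "\<bar>(g x - g (x - t)) / b\<bar> \<le> \<bar>g t / b\<bar>" for x t b
    using g_diff_le[of x "x - t"] by (simp add: abs_divide divide_right_mono)
  have int: "integrable \<mu> (\<lambda>x. (g x - g (x - t)) / b)" for t b
    by (rule integrable_const_bound[where B = "\<bar>g t / b\<bar>", OF _ m1]) (use bd in auto)
  have split: "(g t + potential t) / b = g t / b + ?m / 2 * (g t / b) + (1/2) * (LINT x|\<mu>. (g x - g (x - t)) / b)" for t b
  proof -
    have "potential t / b = (LINT x|\<mu>. (g x / 2 + g t / 2 - g (x - t) / 2) / b)"
      unfolding potential_def by simp
    also have "\<dots> = (LINT x|\<mu>. g t / b / 2 + (1/2) * ((g x - g (x - t)) / b))"
      by (intro Bochner_Integration.integral_cong refl) (simp add: add_divide_distrib diff_divide_distrib)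
    also have "\<dots> = (LINT x|\<mu>. g t / b / 2) + (LINT x|\<mu>. (1/2) * ((g x - g (x - t)) / b))"
      by (rule Bochner_Integration.integral_add) (intro integrable_const integrable_mult_right int)+
    finally show ?thesis by (simp add: add_divide_distrib)
  qed
  have lim: "(\<lambda>n. LINT x|\<mu>. (g x - g (x - T n)) / a (T n)) \<longlonglongrightarrow> (LINT x|\<mu>. \<kappa> * g' x)"
  proof (rule integral_dominated_convergence[where w = "\<lambda>_. B"])
    have ptw: "(\<lambda>n. (g x - g (x - T n)) / a (T n)) \<longlonglongrightarrow> \<kappa> * g' x" if x: "x \<noteq> 0" for x
    proof -
      have "((\<lambda>h. (g (x + h) - g x) / h) \<longlongrightarrow> g' x) (at 0)" using der[OF x] by (simp add: DERIV_def)
      moreover have "filterlim (\<lambda>n. - T n) (at 0) sequentially"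
        using tendsto_minus[OF T(2)] Tpos by (auto simp: filterlim_at intro!: always_eventually less_imp_neq[symmetric])
      ultimately have "(\<lambda>n. (g (x + - T n) - g x) / (- T n)) \<longlonglongrightarrow> g' x" by (rule filterlim_compose)
      from tendsto_mult[OF ta' this]
      have "(\<lambda>n. T n / a (T n) * ((g (x + - T n) - g x) / (- T n))) \<longlonglongrightarrow> \<kappa> * g' x" .
      moreover have "T n / a (T n) * ((g (x + - T n) - g x) / (- T n)) = (g x - g (x - T n)) / a (T n)" for n
      proof -
        have "t / b * (D / (- t)) = - D / b" if "t \<noteq> 0" for t b D :: real
          using that by simp
        from this[of "T n" "a (T n)" "g (x + - T n) - g x"] show ?thesis using Tpos[of n] by simp
      qed
      ultimately show ?thesis by simp
    qed
    show "AE x in \<mu>. (\<lambda>n. (g x - g (x - T n)) / a (T n)) \<longlonglongrightarrow> \<kappa> * g' x"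
      using ptw by (intro AE_I2) (simp add: space_mu)
    show "(\<lambda>x. \<kappa> * g' x) \<in> borel_measurable \<mu>"
      by (rule borel_measurable_LIMSEQ_real[OF _ m1]) (use ptw space_mu in auto)
    show "(\<lambda>x. (g x - g (x - T n)) / a (T n)) \<in> borel_measurable \<mu>" for n by (rule m1)
    show "AE x in \<mu>. norm ((g x - g (x - T n)) / a (T n)) \<le> B" for n
      using order_trans[OF bd B] by (intro AE_I2) simp
  qed simp
  have "(\<lambda>n. g (T n) / a (T n) + ?m / 2 * (g (T n) / a (T n)) + (1/2) * (LINT x|\<mu>. (g x - g (x - T n)) / a (T n)))
      \<longlonglongrightarrow> 1 + ?m / 2 * 1 + (1/2) * (LINT x|\<mu>. \<kappa> * g' x)"
    by (intro tendsto_intros ga' lim)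
  then show "(\<lambda>n. (g (T n) + potential (T n)) / a (T n)) \<longlonglongrightarrow> 1 + ?m / 2 + \<kappa> / 2 * (LINT x|\<mu>. g' x)"
    by (simp add: split)
qed

end

section \<open>The two growth regimes\<close>

text \<open>\<open>Y\<close> is chosen before the regime and before \<open>C\<close>, so one
  continuous version serves all the bounds. The integral of the derivative runs over the space of
  \<open>\<mu>\<close>, which omits \<open>0\<close>, the one point where differentiability of
  \<open>sigma0_sq\<close> is not supplied.\<close>

theorem theorem1p4:
  fixes N :: "'b measure" and Z :: "real \<Rightarrow> 'b \<Rightarrow> real" and \<psi> :: "real \<Rightarrow> real"
    and \<mu> :: "real measure"
    and M :: "'a measure" and X :: "real \<Rightarrow> 'a \<Rightarrow> real" and \<alpha> :: real
  assumes "symmetric_levy_process N Z"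
    and "has_char_exponent N Z \<psi>"
    and "\<forall>l. \<psi> (- l) = \<psi> l"
    and "integrable lborel (\<lambda>l. 1 / (1 + \<psi> l))"
    and "zero_recurrent N Z"
    and "finite_measure \<mu>"
    and "sets \<mu> = sets (restrict_space borel (- {0::real}))"
    and "\<alpha> > 0"
    and "permanental_process M \<alpha> (v_kernel \<psi> \<mu>) X"
    and "sigma0 \<psi> C1_differentiable_on {0<..}"
    and "\<exists>\<rho>>0. regularly_varying_at_zero (sigma0 \<psi>) \<rho>"
  shows "\<exists>\<delta> Y. 0 < \<delta> \<and> \<delta> \<le> 1 \<and>
           version_of M X Y \<and> permanental_process M \<alpha> (v_kernel \<psi> \<mu>) Y \<and>
           (\<forall>\<omega>\<in>space M. continuous_on {0..\<delta>} (\<lambda>t. Y t \<omega>)) \<and>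
           (((\<lambda>t. t / sigma0_sq \<psi> t) \<longlongrightarrow> 0) (at_right 0) \<longrightarrow>
             (AE \<omega> in M.
                Limsup (at_right 0) (\<lambda>t. ereal (Y t \<omega> / (sigma0_sq \<psi> t * ln (ln (1 / t)))))
                  \<le> ereal (1 + measure \<mu> (space \<mu>) / 2))) \<and>
           (\<forall>C>0. ((\<lambda>t. t / sigma0_sq \<psi> t) \<longlongrightarrow> 1 / C) (at_right 0) \<longrightarrow>
             (AE \<omega> in M.
                Limsup (at_right 0) (\<lambda>t. ereal (Y t \<omega> / (C * t * ln (ln (1 / t)))))
                  \<le> ereal ((1 + measure \<mu> (space \<mu>) / 2)
                       + 1 / (2 * C) * (LINT u|\<mu>. deriv (sigma0_sq \<psi>) u))))"
proof -
  have L: "levy_exponent \<psi>" by (rule levy_exponentI[OF assms(1,2,4)])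
  interpret levy_exponent \<psi> by (rule L)
  obtain \<rho> where \<rho>: "0 < \<rho>" "regularly_varying_at_zero (sigma0 \<psi>) \<rho>" using assms(11) by blast
  obtain x0 q where gauge: "subadditive_gauge (sigma0_sq \<psi>) x0 q"
    by (rule sigma0_sq_gauge[OF L assms(10) \<rho>])
  interpret G: gauge_potential "sigma0_sq \<psi>" x0 q \<mu>
    by (rule gauge_potential.intro[OF gauge assms(6)]) (unfold_locales, rule assms(7))
  define g where "g = sigma0_sq \<psi>"
  define m where "m = measure \<mu> (space \<mu>)"
  have f: "f_Phi \<psi> \<mu> = G.potential"
    by (simp add: f_Phi_def G.potential_def Phi_def fun_eq_iff)
  have v: "v_kernel \<psi> \<mu> = G.gauge_kernel G.potential"
    by (simp add: v_kernel_def G.gauge_kernel_def Phi_def f fun_eq_iff)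
  have m0: "0 \<le> m" by (simp add: m_def)
  have der: "(g has_real_derivative deriv g x) (at x)" if "x \<noteq> 0" for x
    unfolding g_def by (rule sigma0_sq_has_derivative[OF assms(10) sigma0_sq_nonneg sigma0_sq_even that])
  have gp: "eventually (\<lambda>t. 0 < g t) (at_right 0)"
    unfolding eventually_at_right_field g_def using G.x0 G.g_pos by (intro exI[of _ x0]) auto
  obtain Y where Y: "version_of M X Y" "permanental_process M \<alpha> (v_kernel \<psi> \<mu>) Y"
    "\<And>\<omega>. continuous_on {0..1} (\<lambda>t. Y t \<omega>)"
    and lil: "\<And>a \<Lambda>. ((\<lambda>t. (g t + G.potential t) / a t) \<longlongrightarrow> \<Lambda>) (at_right 0) \<Longrightarrow> eventually (\<lambda>t. 0 < a t) (at_right 0) \<Longrightarrow>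
      AE \<omega> in M. Limsup (at_right 0) (\<lambda>t. ereal (Y t \<omega> / (a t * ln (ln (1 / t))))) \<le> ereal \<Lambda>"
    unfolding v g_def
  proof (rule G.permanental_continuous_lil[OF assms(9)[unfolded v] assms(8) m0 G.potential_nonneg G.potential_zero G.potential_diff[folded m_def]])
    fix Y
    assume "version_of M X Y" "permanental_process M \<alpha> (G.gauge_kernel G.potential) Y"
      "\<And>\<omega>. continuous_on {0..1} (\<lambda>t. Y t \<omega>)"
      "\<And>a \<Lambda>. ((\<lambda>t. (sigma0_sq \<psi> t + G.potential t) / a t) \<longlongrightarrow> \<Lambda>) (at_right 0) \<Longrightarrow> eventually (\<lambda>t. 0 < a t) (at_right 0) \<Longrightarrow>
        AE \<omega> in M. Limsup (at_right 0) (\<lambda>t. ereal (Y t \<omega> / (a t * ln (ln (1 / t))))) \<le> ereal \<Lambda>"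
    then show thesis by (rule that[unfolded v g_def])
  qed
  have case1: "AE \<omega> in M. Limsup (at_right 0) (\<lambda>t. ereal (Y t \<omega> / (g t * ln (ln (1 / t))))) \<le> ereal (1 + m / 2)"
    if lim: "((\<lambda>t. t / g t) \<longlongrightarrow> 0) (at_right 0)"
  proof (rule lil[OF _ gp])
    \<comment> \<open>Here \<open>a = g\<close> and \<open>\<kappa> = 0\<close>, so the derivative
      term disappears. The quotient is \<open>1\<close> only where \<open>g t\<close> is nonzero,
      hence the detour through eventual positivity.\<close>
    have "((\<lambda>t. g t / g t) \<longlongrightarrow> 1) (at_right 0)"
      by (rule tendsto_eventually) (use gp in eventually_elim, simp)
    from G.potential_asymptotics[folded g_def m_def, OF der this lim]
    show "((\<lambda>t. (g t + G.potential t) / g t) \<longlongrightarrow> 1 + m / 2) (at_right 0)"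
      unfolding g_def[symmetric] by simp
  qed
  have case2: "AE \<omega> in M. Limsup (at_right 0) (\<lambda>t. ereal (Y t \<omega> / (C * t * ln (ln (1 / t)))))
      \<le> ereal ((1 + m / 2) + 1 / (2 * C) * (LINT u|\<mu>. deriv g u))"
    if C: "0 < C" and lim: "((\<lambda>t. t / g t) \<longlongrightarrow> 1 / C) (at_right 0)" for C
  proof (rule lil)
    \<comment> \<open>Here \<open>a t = C * t\<close> and \<open>\<kappa> = 1 / C\<close>; inverting
      the hypothesis shows that \<open>g t / a t\<close> tends to \<open>1\<close>.\<close>
    have "((\<lambda>t. inverse C * inverse (t / g t)) \<longlongrightarrow> inverse C * inverse (1 / C)) (at_right 0)"
      using C by (intro tendsto_intros lim) simp
    moreover have "inverse C * inverse (t / g t) = g t / (C * t)" for t by (simp add: divide_inverse)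
    ultimately have 1: "((\<lambda>t. g t / (C * t)) \<longlongrightarrow> 1) (at_right 0)" using C by simp
    have 2: "((\<lambda>t. t / (C * t)) \<longlongrightarrow> 1 / C) (at_right 0)"
      by (rule tendsto_eventually) (use C in \<open>auto simp: eventually_at_filter\<close>)
    from G.potential_asymptotics[folded g_def m_def, OF der 1 2]
    show "((\<lambda>t. (g t + G.potential t) / (C * t)) \<longlongrightarrow> (1 + m / 2) + 1 / (2 * C) * (LINT u|\<mu>. deriv g u)) (at_right 0)"
      unfolding g_def[symmetric] by (simp add: mult.commute)
    show "eventually (\<lambda>t. 0 < C * t) (at_right 0)"
      using C unfolding eventually_at_right_field by (intro exI[of _ 1]) auto
  qed
  \<comment> \<open>The paths of \<open>Y\<close> are continuous on all of \<open>[0, 1]\<close>, so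
    \<open>\<delta> = 1\<close>.\<close>
  show ?thesis
    using Y case1 case2 unfolding g_def m_def by (intro exI[of _ 1] exI[of _ Y]) simp
qed

end
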